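(* Let $\hat R$ be a Yang-Baxter matrix of Hecke type on $V\otimes V$ with eigenvalues $q$ and $-q^{-1}$, where $V$ is a finite-dimensional vector space and $q$ is not a root of unity. Let $\mathcal U^*$ be the RTT-algebra of $\hat R$ with matrix of generators $T$, and let $\mathcal U$ be the algebra dual to it. Assume that $\mathcal U$ is quasitriangular with universal $R$-matrix $\mathcal R\in\mathcal U\otimes\mathcal U$, and that the numerical matrix $P\hat R$ is the image of $\mathcal R$ in the representation in $V$, where $P$ is the permutation matrix. Let $\phi:\mathcal U^*\to\mathcal U$ be the factorization map $\phi(x):=\langle\mathcal R_{21}\mathcal R,x\rangle_2$, and put $\tilde T:=DT$ (which again satisfies $\hat R\tilde T_1\tilde T_2=\tilde T_1\tilde T_2\hat R$) and $L:=\phi(T)$ (which satisfies $\hat RL_1\hat RL_1=L_1\hat RL_1\hat R$). Then the map $\phi$ transforms the Cayley-Hamilton-Newton identities for $\tilde T$, $$k_q\,\tilde T^{\overline{[k]}}=-\sum_{j=0}^{k-1}(-1)^{k-j}\,\tilde T^{\overline{k-j}}\,\sigma_j(\tilde T)\qquad\text{for all }k\ge1,$$ to the Cayley-Hamilton-Newton identities for $L=\phi(T)$, $$k_q\,L^{[k]}=-\sum_{j=0}^{k-1}\sigma_j(L)\,(-L)^{k-j}\qquad\text{for all }k\ge1.$$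
   Context: A Yang-Baxter matrix is an invertible operator $\hat R$ on $V\otimes V$ with $\hat R_1\hat R_2\hat R_1=\hat R_2\hat R_1\hat R_2$ on $V^{\otimes3}$, where $\hat R_i$ denotes $\hat R$ acting in the $i$-th and $(i+1)$-st copies of $V$. It is of Hecke type if its spectral decomposition has two projectors, $\hat R=qS-q^{-1}A$. Put $k_q:=(q^k-q^{-k})/(q-q^{-1})$. Antisymmetrizers $A_k$ on $V^{\otimes k}$: $A_1:=I$, $A_k:=\frac1{k_q}A_{k-1}(q^{k-1}-(k-1)_q\hat R_{k-1})A_{k-1}$, with $A_{k-1}$ acting in copies $1,\dots,k-1$. The RTT-algebra $\mathcal U^*$ is the algebra generated by the entries $T^i_j$ of a matrix $T$ with relations $\hat RT_1T_2=T_1T_2\hat R$, where $T_i$ is $T$ acting in the $i$-th copy of $V$. $\langle\,,\rangle$ is the pairing between $\mathcal U$ and $\mathcal U^*$; $\mathcal R_{21}$ is $\mathcal R$ with its tensor factors interchanged; the index 2 in $\langle\,,\rangle_2$ means that the second copy of $\mathcal U$ in the first argument is paired with $x$. The map $\phi$ is linear but not a homomorphism, and it is applied to matrices entrywise. The matrix $D$ is defined by $\mathrm{Tr}_2(\hat RD_2)=I$ (partial trace over the second copy of $V$, with $D_2$ being $D$ acting in the second copy); it satisfies $\hat RD_1D_2=D_1D_2\hat R$. The $q$-trace is $\mathrm{Tr}_q(Z):=\mathrm{Tr}(DZ)$. $\mathrm{Tr}_{(a\dots b)}$ and $\mathrm{Tr}_{q\,(a\dots b)}$ are the trace and the $q$-trace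 over copies $a,\dots,b$ of $V$ (no trace when $a>b$). For a matrix $T$ satisfying the RTT relations: $T^{\overline{[k]}}:=\mathrm{Tr}_{(2\dots k)}(A_kT_1\cdots T_k)$, $T^{\overline k}:=\mathrm{Tr}_{(2\dots k)}(\hat R_1\cdots\hat R_{k-1}T_1\cdots T_k)$, $\sigma_k(T):=q^k\,\mathrm{Tr}_{(1\dots k)}(A_kT_1\cdots T_k)$, $\sigma_0(T):=1$. For a matrix $L$ satisfying the RLRL relations $\hat RL_1\hat RL_1=L_1\hat RL_1\hat R$: $L_{\overline1}:=L_1$, $L_{\overline k}:=\hat R_{k-1}L_{\overline{k-1}}\hat R_{k-1}^{-1}$ for $k\ge2$, $L^{[k]}:=\mathrm{Tr}_{q\,(2\dots k)}(A_kL_{\overline1}\cdots L_{\overline k})$, $\sigma_j(L):=\mathrm{Tr}_{q\,(1\dots j)}(A_jL_{\overline1}\cdots L_{\overline j})$, $\sigma_0(L):=1$, and the powers of $L$ are the usual matrix powers.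
   Formalization: σ_j(L) is taken with the factor q^j, i.e. σ_j(L) := q^j Tr_q(1…j)(A_j L_1⋯L_j) with barred indices, because with the printed definition the identity for L already fails at k = 2; U⊗U is read as the completed tensor square. *)

theory Defs
  imports "HOL-Analysis.Analysis" "HOL-Library.Poly_Mapping"
begin

section \<open>Algebras over a field\<close>

locale assoc_algebra = vector_space sc
  for sc :: "'k::field \<Rightarrow> 'a::ring_1 \<Rightarrow> 'a" +
  assumes scale_mult_left: "sc c x * y = sc c (x * y)"
    and scale_mult_right: "x * sc c y = sc c (x * y)"

definition emb :: "('k \<Rightarrow> 'a::ring_1 \<Rightarrow> 'a) \<Rightarrow> 'k \<Rightarrow> 'a" where
  "emb sc c = sc c 1"

definition qnum :: "'k::field \<Rightarrow> nat \<Rightarrow> 'k" where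
  "qnum q k = (q ^ k - inverse q ^ k) / (q - inverse q)"

text \<open>The product \<open>*\<close> of the type \<open>'a^'n^'n\<close> is componentwise, so \<open>^\<close> is not the matrix power.\<close>

primrec mpow :: "('a::semiring_1)^'n^'n \<Rightarrow> nat \<Rightarrow> 'a^'n^'n" where
  "mpow X 0 = mat 1"
| "mpow X (Suc m) = X ** mpow X m"


section \<open>Operators on tensor powers of V\<close>

text \<open>
  \<open>V\<close> has a basis indexed by \<open>'n\<close>, operators on \<open>V\<close> are matrices over \<open>'n\<close> and operators on
  \<open>V \<otimes> V\<close> are matrices over \<open>'n \<times> 'n\<close>. As \<open>k\<close> varies, operators on the \<open>k\<close>-th tensor power are
  matrices indexed by lists of length \<open>k\<close>; entries at other lists are meaningless.
  The copies of \<open>V\<close> are numbered from 1, the positions in a list from 0.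
\<close>

type_synonym ('n, 'a) tmat = "'n list \<Rightarrow> 'n list \<Rightarrow> 'a"

definition tid :: "('n, 'a::zero_neq_one) tmat" where
  "tid I J = (if I = J then 1 else 0)"

definition tmult :: "nat \<Rightarrow> ('n, 'a::semiring_0) tmat \<Rightarrow> ('n, 'a) tmat \<Rightarrow> ('n, 'a) tmat" where
  "tmult k X Y I J = (\<Sum>K | length K = k. X I K * Y K J)"

definition tprod :: "nat \<Rightarrow> ('n, 'a::semiring_1) tmat list \<Rightarrow> ('n, 'a) tmat" where
  "tprod k Xs = foldr (tmult k) Xs tid"

definition tlift :: "('k \<Rightarrow> 'a::ring_1 \<Rightarrow> 'a) \<Rightarrow> ('n, 'k) tmat \<Rightarrow> ('n, 'a) tmat" where
  "tlift sc X I J = emb sc (X I J)"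

definition at1 :: "nat \<Rightarrow> ('a::zero)^'n^'n \<Rightarrow> ('n, 'a) tmat" where
  "at1 i X I J =
     (if length I = length J \<and> (\<forall>m<length I. m \<noteq> i - 1 \<longrightarrow> I ! m = J ! m)
      then X $ (I ! (i - 1)) $ (J ! (i - 1)) else 0)"

definition at2 :: "nat \<Rightarrow> ('a::zero)^('n \<times> 'n)^('n \<times> 'n) \<Rightarrow> ('n::finite, 'a) tmat" where
  "at2 i X I J =
     (if length I = length J \<and> (\<forall>m<length I. m \<noteq> i - 1 \<and> m \<noteq> i \<longrightarrow> I ! m = J ! m)
      then X $ (I ! (i - 1), I ! i) $ (J ! (i - 1), J ! i) else 0)"

text \<open>An operator on the \<open>k\<close>-th tensor power acting in the first \<open>k\<close> of \<open>k + 1\<close> copies.\<close>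

definition extend :: "('n, 'a::zero) tmat \<Rightarrow> ('n, 'a) tmat" where
  "extend X I J = (if last I = last J then X (butlast I) (butlast J) else 0)"

text \<open>\<open>trace_all k\<close> is the trace over the copies \<open>1,\<dots>,k\<close>, and \<open>trace_tail k\<close> that over \<open>2,\<dots>,k\<close>.\<close>

definition trace_all :: "nat \<Rightarrow> ('n, 'a::comm_monoid_add) tmat \<Rightarrow> 'a" where
  "trace_all k X = (\<Sum>K | length K = k. X K K)"

definition trace_tail :: "nat \<Rightarrow> ('n, 'a::comm_monoid_add) tmat \<Rightarrow> 'a^'n^'n" where
  "trace_tail k X = (\<chi> i j. \<Sum>K | length K = k - 1. X (i # K) (j # K))"

text \<open>\<open>X\<^sub>a \<cdots> X\<^sub>b\<close> on the \<open>k\<close>-th tensor power, for operators \<open>X\<close> on \<open>V\<close> and on \<open>V \<otimes> V\<close>.\<close>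

definition chain1 :: "nat \<Rightarrow> nat \<Rightarrow> nat \<Rightarrow> ('a::semiring_1)^'n^'n \<Rightarrow> ('n, 'a) tmat" where
  "chain1 k a b X = tprod k (map (\<lambda>i. at1 i X) [a..<Suc b])"

definition chain2 ::
    "nat \<Rightarrow> nat \<Rightarrow> nat \<Rightarrow> ('a::semiring_1)^('n \<times> 'n)^('n \<times> 'n) \<Rightarrow> ('n::finite, 'a) tmat" where
  "chain2 k a b X = tprod k (map (\<lambda>i. at2 i X) [a..<Suc b])"


section \<open>Yang-Baxter matrices\<close>

definition yang_baxter :: "('k::field)^('n::finite \<times> 'n)^('n \<times> 'n) \<Rightarrow> bool" where
  "yang_baxter R \<longleftrightarrow> invertible R \<and>
     tprod 3 [at2 1 R, at2 2 R, at2 1 R] = tprod 3 [at2 2 R, at2 1 R, at2 2 R]"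

definition hecke_type :: "'k::field \<Rightarrow> 'k^('n::finite \<times> 'n)^('n \<times> 'n) \<Rightarrow> bool" where
  "hecke_type q R \<longleftrightarrow>
     (\<exists>S A. S ** S = S \<and> A ** A = A \<and> S ** A = 0 \<and> A ** S = 0 \<and> S + A = mat 1 \<and>
        S \<noteq> 0 \<and> A \<noteq> 0 \<and> R = mat q ** S - mat (inverse q) ** A)"

fun antisymmetrizer ::
    "'k::field \<Rightarrow> 'k^('n::finite \<times> 'n)^('n \<times> 'n) \<Rightarrow> nat \<Rightarrow> ('n, 'k) tmat" where
  "antisymmetrizer q R 0 = tid"
| "antisymmetrizer q R (Suc 0) = tid"
| "antisymmetrizer q R (Suc (Suc k)) =
     (let n = Suc (Suc k);
          A = extend (antisymmetrizer q R (Suc k));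
          M = (\<lambda>I J. q ^ Suc k * tid I J - qnum q (Suc k) * at2 (Suc k) R I J)
      in (\<lambda>I J. 1 / qnum q n * tprod n [A, M, A] I J))"

text \<open>
  \<open>D\<close> is defined by \<open>Tr\<^sub>2 (R D\<^sub>2) = I\<close>, i.e. it is the only solution of this equation.
  By linearity, uniqueness means that \<open>X \<mapsto> Tr\<^sub>2 (R X\<^sub>2)\<close> is bijective (\<open>R\<close> is skew-invertible).
\<close>

definition is_qtrace_matrix ::
    "('k::field)^('n::finite \<times> 'n)^('n \<times> 'n) \<Rightarrow> 'k^'n^'n \<Rightarrow> bool" where
  "is_qtrace_matrix R D \<longleftrightarrow>
     (\<forall>X. trace_tail 2 (tprod 2 [at2 1 R, at1 2 X]) = mat 1 \<longleftrightarrow> X = D)"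


section \<open>RTT and RLRL matrices\<close>

definition rtt_relations ::
    "('k::field \<Rightarrow> 'a::ring_1 \<Rightarrow> 'a) \<Rightarrow> 'k^('n::finite \<times> 'n)^('n \<times> 'n) \<Rightarrow> 'a^'n^'n \<Rightarrow> bool" where
  "rtt_relations sc R T \<longleftrightarrow>
     tprod 2 [tlift sc (at2 1 R), at1 1 T, at1 2 T] =
     tprod 2 [at1 1 T, at1 2 T, tlift sc (at2 1 R)]"

definition rlrl_relations ::
    "('k::field \<Rightarrow> 'a::ring_1 \<Rightarrow> 'a) \<Rightarrow> 'k^('n::finite \<times> 'n)^('n \<times> 'n) \<Rightarrow> 'a^'n^'n \<Rightarrow> bool" where
  "rlrl_relations sc R L \<longleftrightarrow>
     tprod 2 [tlift sc (at2 1 R), at1 1 L, tlift sc (at2 1 R), at1 1 L] =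
     tprod 2 [at1 1 L, tlift sc (at2 1 R), at1 1 L, tlift sc (at2 1 R)]"

text \<open>For the RTT matrix: \<open>T\<close> to the powers \<open>[k]\<close> and \<open>k\<close> with a bar, and \<open>\<sigma>\<^sub>k(T)\<close>.\<close>

definition T_wedge :: "('k::field \<Rightarrow> 'a::ring_1 \<Rightarrow> 'a) \<Rightarrow> 'k \<Rightarrow>
    'k^('n::finite \<times> 'n)^('n \<times> 'n) \<Rightarrow> 'a^'n^'n \<Rightarrow> nat \<Rightarrow> 'a^'n^'n" where
  "T_wedge sc q R T k =
     trace_tail k (tmult k (tlift sc (antisymmetrizer q R k)) (chain1 k 1 k T))"

definition T_power :: "('k::field \<Rightarrow> 'a::ring_1 \<Rightarrow> 'a) \<Rightarrow>
    'k^('n::finite \<times> 'n)^('n \<times> 'n) \<Rightarrow> 'a^'n^'n \<Rightarrow> nat \<Rightarrow> 'a^'n^'n" where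
  "T_power sc R T k =
     trace_tail k (tmult k (tlift sc (chain2 k 1 (k - 1) R)) (chain1 k 1 k T))"

definition sigma_T :: "('k::field \<Rightarrow> 'a::ring_1 \<Rightarrow> 'a) \<Rightarrow> 'k \<Rightarrow>
    'k^('n::finite \<times> 'n)^('n \<times> 'n) \<Rightarrow> 'a^'n^'n \<Rightarrow> nat \<Rightarrow> 'a" where
  "sigma_T sc q R T k =
     (if k = 0 then 1 else
        emb sc (q ^ k) *
        trace_all k (tmult k (tlift sc (antisymmetrizer q R k)) (chain1 k 1 k T)))"

text \<open>\<open>L_copy sc R L n k\<close> is \<open>L\<close> with the lower index \<open>k\<close> with a bar, on the \<open>n\<close>-th tensor power.\<close>

fun L_copy :: "('k::field \<Rightarrow> 'a::ring_1 \<Rightarrow> 'a) \<Rightarrow> 'k^('n::finite \<times> 'n)^('n \<times> 'n) \<Rightarrow>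
    'a^'n^'n \<Rightarrow> nat \<Rightarrow> nat \<Rightarrow> ('n, 'a) tmat" where
  "L_copy sc R L n 0 = tid"
| "L_copy sc R L n (Suc 0) = at1 1 L"
| "L_copy sc R L n (Suc (Suc k)) =
     tprod n [tlift sc (at2 (Suc k) R), L_copy sc R L n (Suc k),
              tlift sc (at2 (Suc k) (matrix_inv R))]"

definition L_chain :: "('k::field \<Rightarrow> 'a::ring_1 \<Rightarrow> 'a) \<Rightarrow> 'k^('n::finite \<times> 'n)^('n \<times> 'n) \<Rightarrow>
    'a^'n^'n \<Rightarrow> nat \<Rightarrow> ('n, 'a) tmat" where
  "L_chain sc R L k = tprod k (map (L_copy sc R L k) [1..<Suc k])"

text \<open>The q-trace over the copies \<open>a,\<dots>,b\<close> is the trace of the product with \<open>D\<^sub>a \<cdots> D\<^sub>b\<close>.\<close>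

definition L_wedge :: "('k::field \<Rightarrow> 'a::ring_1 \<Rightarrow> 'a) \<Rightarrow> 'k \<Rightarrow>
    'k^('n::finite \<times> 'n)^('n \<times> 'n) \<Rightarrow> 'k^'n^'n \<Rightarrow> 'a^'n^'n \<Rightarrow> nat \<Rightarrow> 'a^'n^'n" where
  "L_wedge sc q R D L k =
     trace_tail k (tprod k [tlift sc (chain1 k 2 k D),
       tlift sc (antisymmetrizer q R k), L_chain sc R L k])"

text \<open>
  The factor \<open>q ^ k\<close> is the same as in \<open>sigma_T\<close>. With \<open>D\<close> normalised by \<open>Tr\<^sub>2 (R D\<^sub>2) = I\<close> the
  Cayley-Hamilton-Newton identities for \<open>L\<close> do not hold without it: one has
  \<open>Tr\<^sub>q\<^sub>(\<^sub>2\<^sub>) (R L\<^sub>1 R\<^sup>-\<^sup>1) = Tr\<^sub>q L\<close> and \<open>Tr\<^sub>q\<^sub>(\<^sub>2\<^sub>) (R L\<^sub>1 R L\<^sub>1 R\<^sup>-\<^sup>1) = L\<^sup>2\<close>, so that the identity for \<open>k = 2\<close>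
  is \<open>2\<^sub>q L\<^sup>[\<^sup>2\<^sup>] = q Tr\<^sub>q(L) L - L\<^sup>2\<close>.
\<close>

definition sigma_L :: "('k::field \<Rightarrow> 'a::ring_1 \<Rightarrow> 'a) \<Rightarrow> 'k \<Rightarrow>
    'k^('n::finite \<times> 'n)^('n \<times> 'n) \<Rightarrow> 'k^'n^'n \<Rightarrow> 'a^'n^'n \<Rightarrow> nat \<Rightarrow> 'a" where
  "sigma_L sc q R D L k =
     (if k = 0 then 1 else
        emb sc (q ^ k) *
        trace_all k (tprod k [tlift sc (chain1 k 1 k D),
          tlift sc (antisymmetrizer q R k), L_chain sc R L k]))"


section \<open>The RTT algebra\<close>

definition monomial :: "('a::monoid_mult)^'n^'n \<Rightarrow> 'n list \<Rightarrow> 'n list \<Rightarrow> 'a" where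
  "monomial T I J = prod_list (map2 (\<lambda>i j. T $ i $ j) I J)"

text \<open>
  Elements of the free algebra on the letters \<open>T\<^sup>i\<^sub>j\<close> are finitely supported functions on words
  in the letters \<open>(i, j)\<close>.
\<close>

definition evaluate :: "('k::field \<Rightarrow> 'a::ring_1 \<Rightarrow> 'a) \<Rightarrow> 'a^'n^'n \<Rightarrow>
    (('n \<times> 'n) list \<Rightarrow>\<^sub>0 'k) \<Rightarrow> 'a" where
  "evaluate sc T p =
     (\<Sum>w\<in>Poly_Mapping.keys p.
        sc (Poly_Mapping.lookup p w) (prod_list (map (\<lambda>(i, j). T $ i $ j) w)))"

text \<open>\<open>u (R T\<^sub>1 T\<^sub>2 - T\<^sub>1 T\<^sub>2 R) v\<close>, entry \<open>(a b, c d)\<close>, with a scalar coefficient \<open>e\<close>.\<close>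

definition rtt_element :: "('k::field)^('n::finite \<times> 'n)^('n \<times> 'n) \<Rightarrow> 'k \<Rightarrow>
    ('n \<times> 'n) list \<Rightarrow> ('n \<times> 'n) list \<Rightarrow> 'n \<Rightarrow> 'n \<Rightarrow> 'n \<Rightarrow> 'n \<Rightarrow> (('n \<times> 'n) list \<Rightarrow>\<^sub>0 'k)" where
  "rtt_element R e u v a b c d =
     (\<Sum>m\<in>UNIV. \<Sum>n\<in>UNIV.
        Poly_Mapping.single (u @ [(m, c), (n, d)] @ v) (e * R $ (a, b) $ (m, n)))
   - (\<Sum>m\<in>UNIV. \<Sum>n\<in>UNIV.
        Poly_Mapping.single (u @ [(a, m), (b, n)] @ v) (e * R $ (m, n) $ (c, d)))"

inductive_set rtt_ideal ::
    "('k::field)^('n::finite \<times> 'n)^('n \<times> 'n) \<Rightarrow> (('n \<times> 'n) list \<Rightarrow>\<^sub>0 'k) set"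
  for R where
  zero: "0 \<in> rtt_ideal R"
| add: "p \<in> rtt_ideal R \<Longrightarrow> p + rtt_element R e u v a b c d \<in> rtt_ideal R"

text \<open>The algebra generated by the entries of \<open>T\<close> with the RTT relations as defining relations.\<close>

locale rtt_algebra = assoc_algebra sc
  for sc :: "'k::field \<Rightarrow> 'x::ring_1 \<Rightarrow> 'x"
    and R :: "'k^('n::finite \<times> 'n)^('n \<times> 'n)"
    and T :: "'x^'n^'n" +
  assumes generated: "surj (evaluate sc T)"
    and presented: "evaluate sc T p = 0 \<longleftrightarrow> p \<in> rtt_ideal R"


section \<open>The dual algebra and its tensor powers\<close>

definition multilinear_form ::
    "('k::field \<Rightarrow> 'x::ring_1 \<Rightarrow> 'x) \<Rightarrow> nat \<Rightarrow> ('x list \<Rightarrow> 'k) \<Rightarrow> bool" where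
  "multilinear_form sc m B \<longleftrightarrow>
     (\<forall>xs i. length xs = m \<longrightarrow> i < m \<longrightarrow>
        Vector_Spaces.linear sc (*) (\<lambda>y. B (xs[i := y])))"

text \<open>
  The RTT algebra is a bialgebra with \<open>\<Delta> T\<^sup>i\<^sub>j = \<Sum>\<^sub>k T\<^sup>i\<^sub>k \<otimes> T\<^sup>k\<^sub>j\<close> and \<open>\<epsilon>(T\<^sup>i\<^sub>j) = \<delta>\<^sup>i\<^sub>j\<close>. The algebra \<open>U\<close>
  is its full linear dual (case \<open>m = 1\<close>), and the \<open>m\<close>-th tensor power of \<open>U\<close> is completed, i.e. it
  is the dual of the \<open>m\<close>-th tensor power of the RTT algebra: its elements are all \<open>m\<close>-linear forms.
  The product and the unit are dual to the coproduct and the counit of the tensor power, which on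
  monomials in \<open>T\<close> are given by matrix multiplication and the unit matrix.
  The uncompleted \<open>U \<otimes> U\<close> consists of forms of finite rank and in general contains no
  universal R-matrix: for \<open>R = q\<close> and \<open>dim V = 1\<close> the form is \<open>(t\<^sup>a, t\<^sup>b) \<mapsto> q\<^sup>a\<^sup>b\<close>.
\<close>

locale dual_power = U: assoc_algebra scaleU
  for sc :: "'k::field \<Rightarrow> 'x::ring_1 \<Rightarrow> 'x"
    and T :: "'x^'n::finite^'n"
    and m :: nat
    and scaleU :: "'k \<Rightarrow> 'u::ring_1 \<Rightarrow> 'u"
    and pair :: "'u \<Rightarrow> 'x list \<Rightarrow> 'k" +
  assumes pair_linear: "length xs = m \<Longrightarrow> Vector_Spaces.linear scaleU (*) (\<lambda>u. pair u xs)"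
    and pair_multilinear: "multilinear_form sc m (pair u)"
    and pair_perfect: "multilinear_form sc m B \<Longrightarrow>
          \<exists>!u. \<forall>xs. length xs = m \<longrightarrow> pair u xs = B xs"
    and pair_one: "length Is = m \<Longrightarrow> map length Js = map length Is \<Longrightarrow>
          pair 1 (map2 (monomial T) Is Js) = (if Is = Js then 1 else 0)"
    and pair_mult: "length Is = m \<Longrightarrow> map length Js = map length Is \<Longrightarrow>
          pair (u * v) (map2 (monomial T) Is Js) =
          (\<Sum>Ks | map length Ks = map length Is.
             pair u (map2 (monomial T) Is Ks) * pair v (map2 (monomial T) Ks Js))"

text \<open>The element of the \<open>m\<close>-th tensor power that corresponds to an \<open>m\<close>-linear form.\<close>

definition of_form :: "nat \<Rightarrow> ('w \<Rightarrow> 'x list \<Rightarrow> 'k) \<Rightarrow> ('x list \<Rightarrow> 'k) \<Rightarrow> 'w" where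
  "of_form m pair B = (THE w. \<forall>xs. length xs = m \<longrightarrow> pair w xs = B xs)"


section \<open>Quasitriangularity and the factorization map\<close>

definition flip :: "('v \<Rightarrow> 'x list \<Rightarrow> 'k) \<Rightarrow> 'v \<Rightarrow> 'v" where
  "flip pair2 w = of_form 2 pair2 (\<lambda>xs. pair2 w [xs ! 1, xs ! 0])"

text \<open>The coproduct of \<open>U\<close> is dual to the product of the RTT algebra.\<close>

definition coproduct :: "('u \<Rightarrow> 'x::times list \<Rightarrow> 'k) \<Rightarrow> ('v \<Rightarrow> 'x list \<Rightarrow> 'k) \<Rightarrow> 'u \<Rightarrow> 'v" where
  "coproduct pair1 pair2 u = of_form 2 pair2 (\<lambda>xs. pair1 u [xs ! 0 * xs ! 1])"

definition coproduct_id :: "('v \<Rightarrow> 'x::times list \<Rightarrow> 'k) \<Rightarrow> ('w \<Rightarrow> 'x list \<Rightarrow> 'k) \<Rightarrow> 'v \<Rightarrow> 'w" where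
  "coproduct_id pair2 pair3 r = of_form 3 pair3 (\<lambda>xs. pair2 r [xs ! 0 * xs ! 1, xs ! 2])"

definition id_coproduct :: "('v \<Rightarrow> 'x::times list \<Rightarrow> 'k) \<Rightarrow> ('w \<Rightarrow> 'x list \<Rightarrow> 'k) \<Rightarrow> 'v \<Rightarrow> 'w" where
  "id_coproduct pair2 pair3 r = of_form 3 pair3 (\<lambda>xs. pair2 r [xs ! 0, xs ! 1 * xs ! 2])"

text \<open>
  \<open>leg \<dots> a b c r\<close> is \<open>r\<close> in the factors \<open>a\<close>, \<open>b\<close> (numbered from 0) and the unit of \<open>U\<close>, i.e. the
  counit of the RTT algebra, in the factor \<open>c\<close>.
\<close>

definition leg :: "('u::one \<Rightarrow> 'x list \<Rightarrow> 'k::times) \<Rightarrow> ('v \<Rightarrow> 'x list \<Rightarrow> 'k) \<Rightarrow>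
    ('w \<Rightarrow> 'x list \<Rightarrow> 'k) \<Rightarrow> nat \<Rightarrow> nat \<Rightarrow> nat \<Rightarrow> 'v \<Rightarrow> 'w" where
  "leg pair1 pair2 pair3 a b c r =
     of_form 3 pair3 (\<lambda>xs. pair2 r [xs ! a, xs ! b] * pair1 1 [xs ! c])"

definition universal_R_matrix :: "('u::ring_1 \<Rightarrow> 'x::ring_1 list \<Rightarrow> 'k::field) \<Rightarrow>
    ('v::ring_1 \<Rightarrow> 'x list \<Rightarrow> 'k) \<Rightarrow> ('w::ring_1 \<Rightarrow> 'x list \<Rightarrow> 'k) \<Rightarrow> 'v \<Rightarrow> bool" where
  "universal_R_matrix pair1 pair2 pair3 r \<longleftrightarrow>
     (\<exists>s. r * s = 1 \<and> s * r = 1) \<and>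
     (\<forall>u. r * coproduct pair1 pair2 u = flip pair2 (coproduct pair1 pair2 u) * r) \<and>
     coproduct_id pair2 pair3 r =
       leg pair1 pair2 pair3 0 2 1 r * leg pair1 pair2 pair3 1 2 0 r \<and>
     id_coproduct pair2 pair3 r =
       leg pair1 pair2 pair3 0 2 1 r * leg pair1 pair2 pair3 0 1 2 r"

text \<open>
  \<open>U\<close> acts in \<open>V\<close> by the matrices \<open>\<langle>u, T\<rangle>\<close>; this is the matrix on \<open>V \<otimes> V\<close> of an element of
  \<open>U \<otimes> U\<close>.
\<close>

definition rep_image :: "('v \<Rightarrow> 'x list \<Rightarrow> 'k) \<Rightarrow> 'x^'n^'n \<Rightarrow> 'v \<Rightarrow>
    'k^('n::finite \<times> 'n)^('n \<times> 'n)" where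
  "rep_image pair2 T r = (\<chi> a b. pair2 r [T $ fst a $ fst b, T $ snd a $ snd b])"

definition permutation_matrix :: "('k::zero_neq_one)^('n::finite \<times> 'n)^('n \<times> 'n)" where
  "permutation_matrix = (\<chi> a b. if fst a = snd b \<and> snd a = fst b then 1 else 0)"

definition factorization_map :: "('u \<Rightarrow> 'x list \<Rightarrow> 'k) \<Rightarrow> ('v::times \<Rightarrow> 'x list \<Rightarrow> 'k) \<Rightarrow>
    'v \<Rightarrow> 'x \<Rightarrow> 'u" where
  "factorization_map pair1 pair2 r x =
     of_form 1 pair1 (\<lambda>ys. pair2 (flip pair2 r * r) [ys ! 0, x])"

end

theory Submission
  imports Defs
begin

text \<open>
  Pairing \<open>\<R>\<close> and \<open>\<R>\<^sub>2\<^sub>1\<close> with \<open>T\<close> in the second copy gives matrices \<open>L\<^sup>+\<close> and \<open>L\<^sup>-\<close> over \<open>U\<close>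
  with \<open>L = L\<^sup>- L\<^sup>+\<close>. As \<open>\<R>\<close> is a universal R-matrix,
  \<open>\<phi>(T\<^sub>1 \<cdots> T\<^sub>k) = L\<^sup>-\<^sub>1 \<cdots> L\<^sup>-\<^sub>k L\<^sup>+\<^sub>k \<cdots> L\<^sup>+\<^sub>1\<close>, and the exchange relation
  \<open>L\<^sup>+\<^sub>1 R L\<^sup>-\<^sub>1 = L\<^sup>-\<^sub>2 R L\<^sup>+\<^sub>2\<close> turns the right-hand side into the product of the matrices \<open>L\<close>
  with the barred lower indices \<open>1, \<dots>, k\<close>. All terms of the identities for \<open>D T\<close> are \<open>D\<close> times
  q-traces of numerical operators times \<open>T\<^sub>1 \<cdots> T\<^sub>k\<close>, so \<open>\<phi>\<close> maps them to the corresponding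
  q-traces for \<open>L\<close>. These are evaluated by the invariance
  \<open>Tr\<^sub>q\<^sub>(\<^sub>2\<^sub>) (R\<^sup>\<plusminus>\<^sup>1 X\<^sub>1 R\<^sup>\<mp>\<^sup>1) = Tr\<^sub>q X\<close>, which also shows that \<open>\<sigma>\<^sub>j(L)\<close> commutes with \<open>L\<close>.

  The identities themselves follow from the recursion for the antisymmetrizers and the cyclicity of
  the q-trace, for which one needs that \<open>R\<close> commutes with \<open>D\<^sub>1 D\<^sub>2\<close>. For this, write
  \<open>\<rho>(X) = Tr\<^sub>2 (R X\<^sub>2)\<close> and \<open>\<tau>(Z) = Tr\<^sub>1 (Z\<^sub>1 R\<^sup>-\<^sup>1)\<close>; the invariance of the q-trace says that
  \<open>\<rho>(D \<tau>(Z)) = D Z\<close> and \<open>\<rho>(\<tau>(Z) D) = Z D\<close>. As \<open>\<rho>\<close> is injective, \<open>D\<close> is invertible and \<open>\<tau>\<close>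
  is surjective, whence \<open>\<rho>(D X) D = D \<rho>(X D)\<close> for all \<open>X\<close>.
\<close>


section \<open>Operators on the tensor powers as one ring\<close>

text \<open>Since \<open>\<phi>\<close> is not multiplicative, a product of \<open>T_power\<close>
  and \<open>sigma_T\<close> cannot be mapped factor by factor. Each term is first brought into a
  form that is linear in the whole product T_1 ... T_k. On the side of T this only needs a
  translation of copies. The barred copies of L are conjugates by braids and spread over all earlier
  copies, so there the same q-trace has to be evaluated by conjugation invariance; this is where the
  ordinary powers of L come from. In the common form both families of identities are instances of
  one statement, \<open>chn\<close>, about any operator that commutes with the R_i.

  Coefficients are noncommutative throughout. Operators in different copies are moved past each
  other, or round a trace, only if one of them has central entries; hence numerical operators are
  kept apart from those built from T and L until the end. The theorem prescribes D only as the
  unique solution of an equation, so its commutation with R is a result here and not an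
  assumption.\<close>

text \<open>
  Operators are matrices whose rows and columns are indexed by infinite sequences of basis indices
  and whose rows have finite support. An operator on finitely many copies of \<open>V\<close> is extended by
  the identity on the others, so that no tensor power has to be named and all identities hold in
  one ring. In this ring the copies of \<open>V\<close> are numbered from 0.
\<close>

typedef (overloaded) ('n, 'a) oper =
  "{X :: (nat \<Rightarrow> 'n) \<Rightarrow> (nat \<Rightarrow> 'n) \<Rightarrow> 'a::zero. \<forall>I. finite {J. X I J \<noteq> 0}}"
  morphisms entry Oper
  by (rule exI[of _ "\<lambda>_ _. 0"]) simp

setup_lifting type_definition_oper

lemma finite_row: "finite {J. entry X I J \<noteq> 0}"
  using entry[of X] by simp

lemma oper_eqI: "(\<And>I J. entry X I J = entry Y I J) \<Longrightarrow> X = Y"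
  by (metis entry_inject ext)

section \<open>The ring of operators with finite rows\<close>

instantiation oper :: (type, ring_1) ring_1
begin

lift_definition zero_oper :: "('a, 'b) oper" is "\<lambda>_ _. 0" by simp

lift_definition one_oper :: "('a, 'b) oper" is "\<lambda>I J. if I = J then 1 else 0"
  by simp

lift_definition plus_oper :: "('a, 'b) oper \<Rightarrow> ('a, 'b) oper \<Rightarrow> ('a, 'b) oper"
  is "\<lambda>X Y I J. X I J + Y I J"
proof -
  fix X Y :: "(nat \<Rightarrow> 'a) \<Rightarrow> (nat \<Rightarrow> 'a) \<Rightarrow> 'b"
  assume "\<And>I. finite {J. X I J \<noteq> 0}" "\<And>I. finite {J. Y I J \<noteq> 0}"
  then have fin: "finite {J. X I J \<noteq> 0 \<or> Y I J \<noteq> 0}" for I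
    by (simp only: Collect_disj_eq finite_Un)
  show "finite {J. X I J + Y I J \<noteq> 0}" for I
    using fin[of I] by (rule rev_finite_subset) auto
qed

lift_definition minus_oper :: "('a, 'b) oper \<Rightarrow> ('a, 'b) oper \<Rightarrow> ('a, 'b) oper"
  is "\<lambda>X Y I J. X I J - Y I J"
proof -
  fix X Y :: "(nat \<Rightarrow> 'a) \<Rightarrow> (nat \<Rightarrow> 'a) \<Rightarrow> 'b"
  assume "\<And>I. finite {J. X I J \<noteq> 0}" "\<And>I. finite {J. Y I J \<noteq> 0}"
  then have fin: "finite {J. X I J \<noteq> 0 \<or> Y I J \<noteq> 0}" for I
    by (simp only: Collect_disj_eq finite_Un)
  show "finite {J. X I J - Y I J \<noteq> 0}" for I
    using fin[of I] by (rule rev_finite_subset) auto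
qed

lift_definition uminus_oper :: "('a, 'b) oper \<Rightarrow> ('a, 'b) oper" is "\<lambda>X I J. - X I J"
  by simp

lift_definition times_oper :: "('a, 'b) oper \<Rightarrow> ('a, 'b) oper \<Rightarrow> ('a, 'b) oper"
  is "\<lambda>X Y I J. \<Sum>K | X I K \<noteq> 0. X I K * Y K J"
proof -
  fix X Y :: "(nat \<Rightarrow> 'a) \<Rightarrow> (nat \<Rightarrow> 'a) \<Rightarrow> 'b"
  assume X: "\<And>I. finite {J. X I J \<noteq> 0}" and Y: "\<And>I. finite {J. Y I J \<noteq> 0}"
  have "{J. (\<Sum>K | X I K \<noteq> 0. X I K * Y K J) \<noteq> 0} \<subseteq> (\<Union>K\<in>{K. X I K \<noteq> 0}. {J. Y K J \<noteq> 0})" for I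
  proof
    fix J assume "J \<in> {J. (\<Sum>K | X I K \<noteq> 0. X I K * Y K J) \<noteq> 0}"
    then obtain K where "X I K \<noteq> 0" "X I K * Y K J \<noteq> 0"
      by (auto elim: sum.not_neutral_contains_not_neutral)
    then show "J \<in> (\<Union>K\<in>{K. X I K \<noteq> 0}. {J. Y K J \<noteq> 0})" by auto
  qed
  then show "finite {J. (\<Sum>K | X I K \<noteq> 0. X I K * Y K J) \<noteq> 0}" for I
    using X Y by (meson finite_UN_I finite_subset mem_Collect_eq)
qed

text \<open>The row support in the definition of the product is inconvenient as an index set; any
  finite set outside of which one of the two factors vanishes gives the same sum.\<close>

lemma entry_times:
  fixes X Y :: "('a, 'b) oper"
  assumes "finite S" "\<And>K. K \<notin> S \<Longrightarrow> entry X I K = 0 \<or> entry Y K J = 0"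
  shows "entry (X * Y) I J = (\<Sum>K\<in>S. entry X I K * entry Y K J)"
proof -
  have "entry (X * Y) I J = (\<Sum>K\<in>{K. entry X I K \<noteq> 0} \<union> S. entry X I K * entry Y K J)"
    unfolding times_oper.rep_eq
    by (rule sum.mono_neutral_left) (auto simp: finite_row assms)
  also have "\<dots> = (\<Sum>K\<in>S. entry X I K * entry Y K J)"
    by (rule sum.mono_neutral_right) (use assms finite_row in \<open>auto, force\<close>)
  finally show ?thesis .
qed

instance
proof
  fix a b c :: "('a, 'b) oper"
  show "a + b + c = a + (b + c)" "a + b = b + a" "0 + a = a" "- a + a = 0" "a - b = a + - b"
    by (rule oper_eqI; simp add: plus_oper.rep_eq zero_oper.rep_eq uminus_oper.rep_eq
      minus_oper.rep_eq)+
  show "a * b * c = a * (b * c)"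
  proof (rule oper_eqI)
    fix I J
    define S where "S = {K. entry a I K \<noteq> 0}"
    define S' where "S' = (\<Union>K\<in>S. {M. entry b K M \<noteq> 0})"
    have fin: "finite S" "finite S'"
      unfolding S_def S'_def using finite_row by auto
    have ab: "entry (a * b) I K = (\<Sum>M\<in>S. entry a I M * entry b M K)" for K
      by (rule entry_times) (use fin S_def in auto)
    have 0: "entry (a * b) I K = 0" if "K \<notin> S'" for K
      unfolding ab using that by (intro sum.neutral) (auto simp: S'_def)
    have "entry (a * b * c) I J = (\<Sum>K\<in>S'. (\<Sum>M\<in>S. entry a I M * entry b M K) * entry c K J)"
      unfolding ab[symmetric] by (rule entry_times) (use fin 0 in auto)
    also have "\<dots> = (\<Sum>M\<in>S. entry a I M * (\<Sum>K\<in>S'. entry b M K * entry c K J))"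
      by (simp add: sum_distrib_left sum_distrib_right mult.assoc)
        (rule sum.swap)
    also have "\<dots> = (\<Sum>M\<in>S. entry a I M * entry (b * c) M J)"
    proof (rule sum.cong[OF refl])
      fix M assume "M \<in> S"
      then have "entry (b * c) M J = (\<Sum>K\<in>S'. entry b M K * entry c K J)"
        by (intro entry_times) (use fin in \<open>auto simp: S'_def\<close>)
      then show "entry a I M * (\<Sum>K\<in>S'. entry b M K * entry c K J)
        = entry a I M * entry (b * c) M J" by simp
    qed
    also have "\<dots> = entry (a * (b * c)) I J"
      by (rule entry_times[symmetric]) (use fin S_def in auto)
    finally show "entry (a * b * c) I J = entry (a * (b * c)) I J" .
  qed
  show "1 * a = a"
  proof (rule oper_eqI)
    fix I J
    have "entry (1 * a) I J = (\<Sum>K\<in>{I}. entry 1 I K * entry a K J)"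
      by (rule entry_times) (auto simp: one_oper.rep_eq)
    then show "entry (1 * a) I J = entry a I J" by (simp add: one_oper.rep_eq)
  qed
  show "a * 1 = a"
  proof (rule oper_eqI)
    fix I J
    have "entry (a * 1) I J = (\<Sum>K\<in>{J}. entry a I K * entry 1 K J)"
      by (rule entry_times) (auto simp: one_oper.rep_eq)
    then show "entry (a * 1) I J = entry a I J" by (simp add: one_oper.rep_eq)
  qed
  show "(a + b) * c = a * c + b * c"
  proof (rule oper_eqI)
    fix I J
    let ?S = "{K. entry a I K \<noteq> 0} \<union> {K. entry b I K \<noteq> 0}"
    have S: "finite ?S" by (simp add: finite_row)
    have "entry (x * c) I J = (\<Sum>K\<in>?S. entry x I K * entry c K J)" if "x \<in> {a, b, a + b}" for x
      by (rule entry_times[OF S]) (use that in \<open>auto simp: plus_oper.rep_eq\<close>)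
    then show "entry ((a + b) * c) I J = entry (a * c + b * c) I J"
      by (simp add: plus_oper.rep_eq sum.distrib distrib_right)
  qed
  show "a * (b + c) = a * b + a * c"
    by (rule oper_eqI)
      (simp add: plus_oper.rep_eq times_oper.rep_eq sum.distrib algebra_simps)
  show "(0::('a, 'b) oper) \<noteq> 1"
    by transfer (metis zero_neq_one)
qed

end

lemmas entry_simps = zero_oper.rep_eq one_oper.rep_eq plus_oper.rep_eq minus_oper.rep_eq
  uminus_oper.rep_eq

section \<open>Operators in given copies, change of coefficients, translation, partial trace\<close>

lift_definition scalar :: "'a \<Rightarrow> ('n, 'a::zero) oper" is "\<lambda>u I J. if I = J then u else 0"
  by simp

text \<open>Zero entries go to 0 whatever \<open>f\<close> is, so that rows stay finite.\<close>

lift_definition map_oper :: "('a \<Rightarrow> 'b) \<Rightarrow> ('n, 'a::zero) oper \<Rightarrow> ('n, 'b::zero) oper"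
  is "\<lambda>f X I J. if X I J = 0 then 0 else f (X I J)"
proof -
  fix f :: "'a \<Rightarrow> 'b" and X :: "(nat \<Rightarrow> 'n) \<Rightarrow> (nat \<Rightarrow> 'n) \<Rightarrow> 'a"
  assume "\<And>I. finite {J. X I J \<noteq> 0}"
  then show "finite {J. (if X I J = 0 then 0 else f (X I J)) \<noteq> 0}" for I
    by (rule rev_finite_subset) auto
qed

lemma entry_map_oper: "f 0 = 0 \<Longrightarrow> entry (map_oper f X) I J = f (entry X I J)"
  by (simp add: map_oper.rep_eq)

lift_definition on1 :: "nat \<Rightarrow> 'a^'n^'n \<Rightarrow> ('n::finite, 'a::zero) oper"
  is "\<lambda>i X I J. if \<forall>m. m \<noteq> i \<longrightarrow> I m = J m then X $ I i $ J i else 0"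
proof -
  fix i and X :: "'a^'n^'n"
  have "{J. (if \<forall>m. m \<noteq> i \<longrightarrow> I m = J m then X $ I i $ J i else 0) \<noteq> 0} \<subseteq> (\<lambda>a. I(i := a)) ` UNIV"
    for I
  proof
    fix J assume "J \<in> {J. (if \<forall>m. m \<noteq> i \<longrightarrow> I m = J m then X $ I i $ J i else 0) \<noteq> 0}"
    then have "J = I(i := J i)"
      by (auto simp: fun_eq_iff split: if_splits)
    then show "J \<in> (\<lambda>a. I(i := a)) ` UNIV" by blast
  qed
  then show "finite {J. (if \<forall>m. m \<noteq> i \<longrightarrow> I m = J m then X $ I i $ J i else 0) \<noteq> 0}" for I
    by (meson finite finite_imageI finite_subset)
qed

lift_definition on2 :: "nat \<Rightarrow> 'a^('n \<times> 'n)^('n \<times> 'n) \<Rightarrow> ('n::finite, 'a::zero) oper"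
  is "\<lambda>i X I J. if \<forall>m. m \<noteq> i \<and> m \<noteq> Suc i \<longrightarrow> I m = J m
    then X $ (I i, I (Suc i)) $ (J i, J (Suc i)) else 0"
proof -
  fix i and X :: "'a^('n \<times> 'n)^('n \<times> 'n)"
  have "{J. (if \<forall>m. m \<noteq> i \<and> m \<noteq> Suc i \<longrightarrow> I m = J m
      then X $ (I i, I (Suc i)) $ (J i, J (Suc i)) else 0) \<noteq> 0}
    \<subseteq> (\<lambda>(a, b). I(i := a, Suc i := b)) ` UNIV" for I
  proof
    fix J assume "J \<in> {J. (if \<forall>m. m \<noteq> i \<and> m \<noteq> Suc i \<longrightarrow> I m = J m
      then X $ (I i, I (Suc i)) $ (J i, J (Suc i)) else 0) \<noteq> 0}"
    then have "J = I(i := J i, Suc i := J (Suc i))"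
      by (auto simp: fun_eq_iff split: if_splits)
    then show "J \<in> (\<lambda>(a, b). I(i := a, Suc i := b)) ` UNIV"
      by (intro image_eqI[where x = "(J i, J (Suc i))"]) simp_all
  qed
  then show "finite {J. (if \<forall>m. m \<noteq> i \<and> m \<noteq> Suc i \<longrightarrow> I m = J m
      then X $ (I i, I (Suc i)) $ (J i, J (Suc i)) else 0) \<noteq> 0}" for I
    by (meson finite finite_imageI finite_subset)
qed

lemma finite_agree: "finite {J :: nat \<Rightarrow> 'n::finite. \<forall>m\<ge>k. I m = J m}"
proof (rule finite_subset)
  show "{J. \<forall>m\<ge>k. I m = J m} \<subseteq> (\<lambda>l m. if m < k then l ! m else I m) ` {l :: 'n list. length l = k}"
  proof
    fix J assume "J \<in> {J. \<forall>m\<ge>k. I m = J m}"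
    then show "J \<in> (\<lambda>l m. if m < k then l ! m else I m) ` {l :: 'n list. length l = k}"
      by (intro image_eqI[where x = "map J [0..<k]"]) (auto simp: fun_eq_iff)
  qed
  show "finite ((\<lambda>l m. if m < k then l ! m else I m) ` {l :: 'n list. length l = k})"
    using finite_lists_length_eq[of "UNIV :: 'n set" k] by simp
qed

text \<open>Only entries at lists of length \<open>k\<close> are read, so the meaningless part of a
  \<open>tmat\<close> disappears.\<close>

lift_definition first :: "nat \<Rightarrow> ('n, 'a) tmat \<Rightarrow> ('n::finite, 'a::zero) oper"
  is "\<lambda>k X I J. if \<forall>m\<ge>k. I m = J m then X (map I [0..<k]) (map J [0..<k]) else 0"
proof -
  fix k and X :: "('n, 'a) tmat"
  show "finite {J. (if \<forall>m\<ge>k. I m = J m then X (map I [0..<k]) (map J [0..<k]) else 0) \<noteq> 0}" for I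
    by (auto intro: finite_subset[OF _ finite_agree[of k]] split: if_splits)
qed

text \<open>Moves an operator one copy to the right. Iterating it carries a relation proved in
  copies 0 and 1 to all neighbouring copies.\<close>

lift_definition shift :: "('n, 'a) oper \<Rightarrow> ('n, 'a::zero) oper"
  is "\<lambda>X I J. if I 0 = J 0 then X (I \<circ> Suc) (J \<circ> Suc) else 0"
proof -
  fix X :: "(nat \<Rightarrow> 'n) \<Rightarrow> (nat \<Rightarrow> 'n) \<Rightarrow> 'a"
  assume X: "\<And>I. finite {J. X I J \<noteq> 0}"
  have "{J. (if I 0 = J 0 then X (I \<circ> Suc) (J \<circ> Suc) else 0) \<noteq> 0}
    \<subseteq> case_nat (I 0) ` {J. X (I \<circ> Suc) J \<noteq> 0}" for I
  proof
    fix J assume J: "J \<in> {J. (if I 0 = J 0 then X (I \<circ> Suc) (J \<circ> Suc) else 0) \<noteq> 0}"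
    then have "J = case_nat (I 0) (J \<circ> Suc)"
      by (auto simp: fun_eq_iff split: nat.split if_splits)
    then show "J \<in> case_nat (I 0) ` {J. X (I \<circ> Suc) J \<noteq> 0}"
      using J by (auto split: if_splits)
  qed
  then show "finite {J. (if I 0 = J 0 then X (I \<circ> Suc) (J \<circ> Suc) else 0) \<noteq> 0}" for I
    using X by (meson finite_imageI finite_subset)
qed

text \<open>The result acts as the identity in the traced copy instead of losing it, so the numbers
  of the other copies do not change.\<close>

lift_definition ptrace :: "nat \<Rightarrow> ('n, 'a) oper \<Rightarrow> ('n::finite, 'a::comm_monoid_add) oper"
  is "\<lambda>i X I J. if I i = J i then \<Sum>a\<in>UNIV. X (I(i := a)) (J(i := a)) else 0"
proof -
  fix i :: nat and X :: "(nat \<Rightarrow> 'n) \<Rightarrow> (nat \<Rightarrow> 'n) \<Rightarrow> 'a"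
  assume X: "\<And>I. finite {J. X I J \<noteq> 0}"
  have "{J. (if I i = J i then \<Sum>a\<in>UNIV. X (I(i := a)) (J(i := a)) else 0) \<noteq> 0}
    \<subseteq> (\<Union>a. (\<lambda>J. J(i := I i)) ` {J. X (I(i := a)) J \<noteq> 0})" for I
  proof
    fix J assume J: "J \<in> {J. (if I i = J i then \<Sum>a\<in>UNIV. X (I(i := a)) (J(i := a)) else 0) \<noteq> 0}"
    then have "I i = J i" and "(\<Sum>a\<in>UNIV. X (I(i := a)) (J(i := a))) \<noteq> 0"
      by (auto split: if_splits)
    then obtain a where "X (I(i := a)) (J(i := a)) \<noteq> 0"
      by (auto elim: sum.not_neutral_contains_not_neutral)
    moreover have "J = (J(i := a))(i := I i)" using \<open>I i = J i\<close> by auto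
    ultimately show "J \<in> (\<Union>a. (\<lambda>J. J(i := I i)) ` {J. X (I(i := a)) J \<noteq> 0})" by blast
  qed
  then show "finite {J. (if I i = J i then \<Sum>a\<in>UNIV. X (I(i := a)) (J(i := a)) else 0) \<noteq> 0}" for I
    by (rule finite_subset) (use X in auto)
qed

section \<open>Products with operators in one or two copies\<close>

lemma entry_on1_times:
  fixes Y :: "('n::finite, 'a::ring_1) oper"
  shows "entry (on1 i X * Y) I J = (\<Sum>a\<in>UNIV. X $ I i $ a * entry Y (I(i := a)) J)"
proof -
  have inj: "inj_on (\<lambda>a. I(i := a)) UNIV"
    by (rule inj_onI) (metis fun_upd_same)
  have "K = I(i := K i)" if "\<forall>m. m \<noteq> i \<longrightarrow> I m = K m" for K
    using that by (auto simp: fun_eq_iff)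
  then have "entry (on1 i X * Y) I J
    = (\<Sum>K\<in>range (\<lambda>a. I(i := a)). entry (on1 i X) I K * entry Y K J)"
    by (intro entry_times) (auto simp: on1.rep_eq)
  also have "\<dots> = (\<Sum>a\<in>UNIV. entry (on1 i X) I (I(i := a)) * entry Y (I(i := a)) J)"
    by (simp add: sum.reindex[OF inj])
  finally show ?thesis by (simp add: on1.rep_eq)
qed

lemma entry_times_on1:
  fixes Y :: "('n::finite, 'a::ring_1) oper"
  shows "entry (Y * on1 i X) I J = (\<Sum>a\<in>UNIV. entry Y I (J(i := a)) * X $ a $ J i)"
proof -
  have inj: "inj_on (\<lambda>a. J(i := a)) UNIV"
    by (rule inj_onI) (metis fun_upd_same)
  have "K = J(i := K i)" if "\<forall>m. m \<noteq> i \<longrightarrow> K m = J m" for K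
    using that by (auto simp: fun_eq_iff)
  then have "entry (Y * on1 i X) I J
    = (\<Sum>K\<in>range (\<lambda>a. J(i := a)). entry Y I K * entry (on1 i X) K J)"
    by (intro entry_times) (auto simp: on1.rep_eq)
  also have "\<dots> = (\<Sum>a\<in>UNIV. entry Y I (J(i := a)) * entry (on1 i X) (J(i := a)) J)"
    by (simp add: sum.reindex[OF inj])
  finally show ?thesis by (simp add: on1.rep_eq)
qed

abbreviation upd2 :: "(nat \<Rightarrow> 'n) \<Rightarrow> nat \<Rightarrow> 'n \<times> 'n \<Rightarrow> nat \<Rightarrow> 'n" where
  "upd2 I i p \<equiv> I(i := fst p, Suc i := snd p)"

lemma inj_upd2: "inj_on (upd2 I i) UNIV"
proof (rule inj_onI)
  fix p r assume eq: "upd2 I i p = upd2 I i r"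
  show "p = r"
    using fun_cong[OF eq, of i] fun_cong[OF eq, of "Suc i"] by (simp add: prod_eq_iff)
qed

lemma upd2_eqI: "(\<And>m. m \<noteq> i \<Longrightarrow> m \<noteq> Suc i \<Longrightarrow> I m = K m) \<Longrightarrow> K = upd2 I i (K i, K (Suc i))"
  by (auto simp: fun_eq_iff)

lemma entry_on2_times:
  fixes Y :: "('n::finite, 'a::ring_1) oper"
  shows "entry (on2 i X * Y) I J
    = (\<Sum>p\<in>UNIV. X $ (I i, I (Suc i)) $ p * entry Y (upd2 I i p) J)"
proof -
  have "K \<in> range (upd2 I i)" if "\<forall>m. m \<noteq> i \<and> m \<noteq> Suc i \<longrightarrow> I m = K m" for K
    using upd2_eqI[of i I K] that by blast
  then have "entry (on2 i X * Y) I J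
    = (\<Sum>K\<in>range (upd2 I i). entry (on2 i X) I K * entry Y K J)"
    by (intro entry_times) (auto simp: on2.rep_eq)
  also have "\<dots> = (\<Sum>p\<in>UNIV. entry (on2 i X) I (upd2 I i p) * entry Y (upd2 I i p) J)"
    by (simp add: sum.reindex[OF inj_upd2])
  finally show ?thesis by (simp add: on2.rep_eq)
qed

lemma entry_times_on2:
  fixes Y :: "('n::finite, 'a::ring_1) oper"
  shows "entry (Y * on2 i X) I J
    = (\<Sum>p\<in>UNIV. entry Y I (upd2 J i p) * X $ p $ (J i, J (Suc i)))"
proof -
  have "K \<in> range (upd2 J i)" if "\<forall>m. m \<noteq> i \<and> m \<noteq> Suc i \<longrightarrow> K m = J m" for K
  proof -
    have "K = upd2 J i (K i, K (Suc i))" by (rule upd2_eqI) (use that in auto)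
    then show ?thesis by (rule range_eqI)
  qed
  then have "entry (Y * on2 i X) I J
    = (\<Sum>K\<in>range (upd2 J i). entry Y I K * entry (on2 i X) K J)"
    by (intro entry_times) (auto simp: on2.rep_eq)
  also have "\<dots> = (\<Sum>p\<in>UNIV. entry Y I (upd2 J i p) * entry (on2 i X) (upd2 J i p) J)"
    by (simp add: sum.reindex[OF inj_upd2])
  finally show ?thesis by (simp add: on2.rep_eq)
qed

text \<open>For a noncommuting coefficient \<open>u\<close> the side matters:
  \<open>scalar u\<close> need not be central. This allows full traces such as \<sigma>_j to be
  treated as operators.\<close>

lemma entry_scalar_times [simp]:
  "entry (scalar u * Y) I J = u * entry Y I J" for Y :: "('n, 'a::ring_1) oper"
  by (subst entry_times[where S = "{I}"]) (auto simp: scalar.rep_eq)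

lemma entry_times_scalar [simp]:
  "entry (Y * scalar u) I J = entry Y I J * u" for Y :: "('n, 'a::ring_1) oper"
  by (subst entry_times[where S = "{J}"]) (auto simp: scalar.rep_eq)

lemma scalar_mult: "scalar (u * v) = (scalar u * scalar v :: ('n, 'a::ring_1) oper)"
  by (rule oper_eqI) (simp add: scalar.rep_eq)

lemma scalar_0 [simp]: "scalar 0 = (0 :: ('n, 'a::ring_1) oper)"
  by (rule oper_eqI) (simp add: scalar.rep_eq entry_simps)

lemma scalar_1 [simp]: "scalar 1 = (1 :: ('n, 'a::ring_1) oper)"
  by (rule oper_eqI) (simp add: scalar.rep_eq entry_simps)

lemma scalar_add: "scalar (u + v) = (scalar u + scalar v :: ('n, 'a::ring_1) oper)"
  by (rule oper_eqI) (simp add: scalar.rep_eq entry_simps)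

lemma scalar_uminus: "scalar (- u) = (- scalar u :: ('n, 'a::ring_1) oper)"
  by (rule oper_eqI) (simp add: scalar.rep_eq entry_simps)

lemma scalar_diff: "scalar (u - v) = (scalar u - scalar v :: ('n, 'a::ring_1) oper)"
  by (rule oper_eqI) (simp add: scalar.rep_eq entry_simps)

lemma scalar_power: "scalar (u ^ m) = (scalar u ^ m :: ('n, 'a::ring_1) oper)"
  by (induction m) (simp_all add: scalar_mult)

lemma on1_mult: "on1 i (A ** B) = (on1 i A * on1 i B :: ('n::finite, 'a::ring_1) oper)"
proof (rule oper_eqI)
  fix I J
  show "entry (on1 i (A ** B)) I J = entry (on1 i A * on1 i B) I J"
    by (cases "\<forall>m. m \<noteq> i \<longrightarrow> I m = J m")
      (auto simp: entry_on1_times on1.rep_eq matrix_matrix_mult_def intro!: sum.neutral)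
qed

lemma on1_mat: "on1 i (mat u) = (scalar u :: ('n::finite, 'a::ring_1) oper)"
  by (rule oper_eqI) (auto simp: on1.rep_eq scalar.rep_eq mat_def)

lemma on1_add: "on1 i (A + B) = (on1 i A + on1 i B :: ('n::finite, 'a::ring_1) oper)"
  by (rule oper_eqI) (auto simp: on1.rep_eq entry_simps)

lemma on1_uminus: "on1 i (- A) = (- on1 i A :: ('n::finite, 'a::ring_1) oper)"
  by (rule oper_eqI) (auto simp: on1.rep_eq entry_simps)

lemma on1_0 [simp]: "on1 i 0 = (0 :: ('n::finite, 'a::ring_1) oper)"
  by (rule oper_eqI) (auto simp: on1.rep_eq entry_simps)

lemma on1_sum: "on1 i (\<Sum>j\<in>S. A j) = (\<Sum>j\<in>S. on1 i (A j) :: ('n::finite, 'a::ring_1) oper)"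
  by (induction S rule: infinite_finite_induct) (simp_all add: on1_add)

lemma on1_inject: "on1 i A = (on1 i B :: ('n::finite, 'a::zero) oper) \<longleftrightarrow> A = B"
proof
  assume eq: "on1 i A = (on1 i B :: ('n, 'a) oper)"
  show "A = B"
  proof (simp add: vec_eq_iff, intro allI)
    fix a b
    show "A $ a $ b = B $ a $ b"
      using arg_cong[OF eq, of "\<lambda>X. entry X ((\<lambda>_. a)(i := a)) ((\<lambda>_. a)(i := b))"]
      by (simp add: on1.rep_eq del: fun_upd_triv)
  qed
qed simp

lemma on1_mpow: "on1 i (mpow X m) = (on1 i X ^ m :: ('n::finite, 'a::ring_1) oper)"
  by (induction m) (simp_all add: on1_mult on1_mat)

lemma on2_mult: "on2 i (A ** B) = (on2 i A * on2 i B :: ('n::finite, 'a::ring_1) oper)"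
proof (rule oper_eqI)
  fix I J
  show "entry (on2 i (A ** B)) I J = entry (on2 i A * on2 i B) I J"
    by (cases "\<forall>m. m \<noteq> i \<and> m \<noteq> Suc i \<longrightarrow> I m = J m")
      (auto simp: entry_on2_times on2.rep_eq matrix_matrix_mult_def intro!: sum.neutral)
qed

lemma on2_mat: "on2 i (mat u) = (scalar u :: ('n::finite, 'a::ring_1) oper)"
proof (rule oper_eqI)
  fix I J :: "nat \<Rightarrow> 'n"
  have "I = J \<longleftrightarrow> (\<forall>m. m \<noteq> i \<and> m \<noteq> Suc i \<longrightarrow> I m = J m) \<and> I i = J i \<and> I (Suc i) = J (Suc i)"
    by (metis ext)
  then show "entry (on2 i (mat u)) I J = entry (scalar u :: ('n, 'a) oper) I J"
    by (auto simp: on2.rep_eq scalar.rep_eq mat_def)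
qed

lemma on2_add: "on2 i (A + B) = (on2 i A + on2 i B :: ('n::finite, 'a::ring_1) oper)"
  by (rule oper_eqI) (auto simp: on2.rep_eq entry_simps)

lemma on2_diff: "on2 i (A - B) = (on2 i A - on2 i B :: ('n::finite, 'a::ring_1) oper)"
  by (rule oper_eqI) (auto simp: on2.rep_eq entry_simps)

lemma on2_inject: "on2 i A = (on2 i B :: ('n::finite, 'a::zero) oper) \<longleftrightarrow> A = B"
proof
  assume eq: "on2 i A = (on2 i B :: ('n, 'a) oper)"
  show "A = B"
  proof (simp add: vec_eq_iff, intro allI)
    fix a b c d
    show "A $ (a, b) $ (c, d) = B $ (a, b) $ (c, d)"
      using arg_cong[OF eq, of "\<lambda>X. entry X (upd2 (\<lambda>_. a) i (a, b)) (upd2 (\<lambda>_. a) i (c, d))"]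
      by (simp add: on2.rep_eq del: fun_upd_triv)
  qed
qed simp


subsection \<open>Operators that act trivially in a copy\<close>

definition triv :: "nat \<Rightarrow> ('n, 'a::zero) oper \<Rightarrow> bool" where
  "triv i X \<longleftrightarrow> (\<forall>I J a. entry X I J = (if I i = J i then entry X (I(i := a)) (J(i := a)) else 0))"

lemma triv_upd: "triv i X \<Longrightarrow> I i = J i \<Longrightarrow> entry X (I(i := a)) (J(i := a)) = entry X I J"
  unfolding triv_def by metis

lemma triv_0: "triv i X \<Longrightarrow> I i \<noteq> J i \<Longrightarrow> entry X I J = 0"
  unfolding triv_def by metis

lemma triv_swap: "triv i X \<Longrightarrow> entry X (I(i := J i)) J = entry X I (J(i := I i))"
  using triv_upd[of i X "I(i := J i)" J "I i"] by simp

lemma entry_triv_times: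
  fixes A X :: "('n, 'a::ring_1) oper"
  assumes "triv i A"
  shows "entry (A * X) (I(i := a)) J
    = (\<Sum>K | entry A I K \<noteq> 0. entry A I K * entry X (K(i := a)) J)"
proof -
  let ?S = "{K. entry A I K \<noteq> 0}"
  have S: "K i = I i" if "K \<in> ?S" for K
    using triv_0[OF assms, of I K] that by (metis mem_Collect_eq)
  have inj: "inj_on (\<lambda>K. K(i := a)) ?S"
    by (rule inj_onI) (metis S fun_upd_triv fun_upd_upd)
  have "entry (A * X) (I(i := a)) J
    = (\<Sum>K\<in>(\<lambda>K. K(i := a)) ` ?S. entry A (I(i := a)) K * entry X K J)"
  proof (rule entry_times)
    fix K assume K: "K \<notin> (\<lambda>K. K(i := a)) ` ?S"
    have "entry A (I(i := a)) K = 0"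
    proof (rule ccontr)
      assume nz: "entry A (I(i := a)) K \<noteq> 0"
      then have "K i = a" using triv_0[OF assms, of "I(i := a)" K] by auto
      moreover have "entry A I (K(i := I i)) \<noteq> 0"
        using triv_swap[OF assms, of I K] nz \<open>K i = a\<close> by simp
      ultimately show False using K by (auto simp: image_iff)
    qed
    then show "entry A (I(i := a)) K = 0 \<or> entry X K J = 0" ..
  qed (simp add: finite_row)
  also have "\<dots> = (\<Sum>K\<in>?S. entry A (I(i := a)) (K(i := a)) * entry X (K(i := a)) J)"
    by (simp add: sum.reindex[OF inj])
  also have "\<dots> = (\<Sum>K\<in>?S. entry A I K * entry X (K(i := a)) J)"
    by (rule sum.cong[OF refl]) (simp add: triv_upd[OF assms] S)
  finally show ?thesis .
qed

lemma triv_times: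
  fixes A B :: "('n, 'a::ring_1) oper"
  assumes A: "triv i A" and B: "triv i B"
  shows "triv i (A * B)"
  unfolding triv_def
proof (intro allI)
  fix I J a
  have S: "K i = I i" if "entry A I K \<noteq> 0" for K
    using triv_0[OF A, of I K] that by metis
  show "entry (A * B) I J = (if I i = J i then entry (A * B) (I(i := a)) (J(i := a)) else 0)"
  proof (cases "I i = J i")
    case True
    have "entry (A * B) (I(i := a)) (J(i := a)) = (\<Sum>K | entry A I K \<noteq> 0. entry A I K * entry B K J)"
      unfolding entry_triv_times[OF A]
      by (rule sum.cong[OF refl]) (simp add: S True triv_upd[OF B])
    then show ?thesis using True by (simp add: times_oper.rep_eq)
  next
    case False
    then show ?thesis unfolding times_oper.rep_eq
      by (auto intro!: sum.neutral simp: triv_0[OF B] S)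
  qed
qed

lemma triv_diff: "triv i A \<Longrightarrow> triv i B \<Longrightarrow> triv i (A - B)" for A B :: "('n, 'a::ring_1) oper"
  unfolding triv_def entry_simps by (metis diff_zero)

lemma triv_scalar [simp]: "triv i (scalar u)"
  unfolding triv_def scalar.rep_eq by (auto simp: fun_eq_iff split: if_splits; metis)

lemma triv_1 [simp]: "triv i (1 :: ('n, 'a::ring_1) oper)"
  using triv_scalar[of i "1 :: 'a"] by simp

lemma triv_on1 [simp]: "i \<noteq> j \<Longrightarrow> triv i (on1 j X)"
  unfolding triv_def on1.rep_eq by (auto simp: fun_upd_def)

lemma triv_on2 [simp]: "i \<noteq> j \<Longrightarrow> i \<noteq> Suc j \<Longrightarrow> triv i (on2 j X)"
  unfolding triv_def on2.rep_eq by (auto simp: fun_upd_def)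

definition central :: "'a::times \<Rightarrow> bool" where
  "central c \<longleftrightarrow> (\<forall>x. c * x = x * c)"

text \<open>The two products multiply the same coefficients in opposite orders, hence the centrality
  of the entries of \<open>C\<close>.\<close>

lemma on1_commute:
  fixes X :: "('n::finite, 'a::ring_1) oper"
  assumes X: "triv i X" and C: "\<And>a b. central (C $ a $ b)"
  shows "on1 i C * X = X * on1 i C"
proof (rule oper_eqI)
  fix I J
  have "entry (on1 i C * X) I J = (\<Sum>a\<in>{J i}. C $ I i $ a * entry X (I(i := a)) J)"
    unfolding entry_on1_times by (rule sum.mono_neutral_right) (auto simp: triv_0[OF X])
  moreover have "entry (X * on1 i C) I J = (\<Sum>a\<in>{I i}. entry X I (J(i := a)) * C $ a $ J i)"
    unfolding entry_times_on1 by (rule sum.mono_neutral_right) (auto simp: triv_0[OF X])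
  ultimately show "entry (on1 i C * X) I J = entry (X * on1 i C) I J"
    using C by (simp add: triv_swap[OF X] central_def)
qed

lemma on2_commute:
  fixes X :: "('n::finite, 'a::ring_1) oper"
  assumes X: "triv i X" "triv (Suc i) X" and C: "\<And>a b. central (C $ a $ b)"
  shows "on2 i C * X = X * on2 i C"
proof (rule oper_eqI)
  fix I J
  have "entry X (upd2 I i p) J = 0" if "p \<noteq> (J i, J (Suc i))" for p
    using triv_0[OF X(1), of "upd2 I i p" J] triv_0[OF X(2), of "upd2 I i p" J] that
    by (auto simp: prod_eq_iff)
  then have "entry (on2 i C * X) I J
    = (\<Sum>p\<in>{(J i, J (Suc i))}. C $ (I i, I (Suc i)) $ p * entry X (upd2 I i p) J)"
    unfolding entry_on2_times by (intro sum.mono_neutral_right) auto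
  moreover have "entry X I (upd2 J i p) = 0" if "p \<noteq> (I i, I (Suc i))" for p
    using triv_0[OF X(1), of I "upd2 J i p"] triv_0[OF X(2), of I "upd2 J i p"] that
    by (auto simp: prod_eq_iff)
  then have "entry (X * on2 i C) I J
    = (\<Sum>p\<in>{(I i, I (Suc i))}. entry X I (upd2 J i p) * C $ p $ (J i, J (Suc i)))"
    unfolding entry_times_on2 by (intro sum.mono_neutral_right) auto
  moreover have "entry X (upd2 I i (J i, J (Suc i))) J = entry X I (upd2 J i (I i, I (Suc i)))"
    using triv_swap[OF X(2), of "I(i := J i)" J] triv_swap[OF X(1), of I "J(Suc i := I (Suc i))"]
    by (simp add: fun_upd_twist)
  ultimately show "entry (on2 i C * X) I J = entry (X * on2 i C) I J"
    using C by (simp add: central_def)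
qed


subsection \<open>Partial traces\<close>

text \<open>An operator that ignores copy \<open>i\<close> can be pulled out of the trace over it.
  The order of the coefficients is kept, so noncommuting entries do no harm.\<close>

lemma ptrace_triv_times:
  fixes A X :: "('n::finite, 'a::ring_1) oper"
  assumes A: "triv i A"
  shows "ptrace i (A * X) = A * ptrace i X"
proof (rule oper_eqI)
  fix I J
  have S: "K i = I i" if "entry A I K \<noteq> 0" for K
    using triv_0[OF A, of I K] that by metis
  have *: "entry (A * ptrace i X) I J
    = (\<Sum>K | entry A I K \<noteq> 0. entry A I K * entry (ptrace i X) K J)"
    by (simp add: times_oper.rep_eq)
  show "entry (ptrace i (A * X)) I J = entry (A * ptrace i X) I J"
  proof (cases "I i = J i")
    case True
    have "entry (ptrace i (A * X)) I J
      = (\<Sum>a\<in>UNIV. \<Sum>K | entry A I K \<noteq> 0. entry A I K * entry X (K(i := a)) (J(i := a)))"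
      by (simp add: ptrace.rep_eq True entry_triv_times[OF A])
    also have "\<dots> = (\<Sum>K | entry A I K \<noteq> 0. entry A I K * (\<Sum>a\<in>UNIV. entry X (K(i := a)) (J(i := a))))"
      by (subst sum.swap) (simp add: sum_distrib_left)
    also have "\<dots> = entry (A * ptrace i X) I J"
      unfolding * by (rule sum.cong[OF refl]) (simp add: ptrace.rep_eq S True)
    finally show ?thesis .
  next
    case False
    then show ?thesis unfolding *
      by (auto simp: ptrace.rep_eq S intro!: sum.neutral[symmetric])
  qed
qed

lemma ptrace_times_triv:
  fixes B X :: "('n::finite, 'a::ring_1) oper"
  assumes B: "triv i B"
  shows "ptrace i (X * B) = ptrace i X * B"
proof (rule oper_eqI)
  fix I J
  \<comment> \<open>The rows \<open>I(i := a)\<close> of \<open>X\<close> may have different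
    supports; \<open>S\<close> collects them for all \<open>a\<close>, with copy \<open>i\<close>
    reset to \<open>I i\<close>.\<close>
  define S where "S = (\<Union>a. (\<lambda>K. K(i := I i)) ` {K. entry X (I(i := a)) K \<noteq> 0})"
  have fin: "finite S" unfolding S_def by (auto simp: finite_row)
  have S: "K i = I i" if "K \<in> S" for K using that by (auto simp: S_def)
  have *: "entry (ptrace i X * B) I J = (\<Sum>K\<in>S. entry (ptrace i X) I K * entry B K J)"
  proof (rule entry_times[OF fin])
    fix K assume K: "K \<notin> S"
    have "entry (ptrace i X) I K = 0"
    proof (cases "I i = K i")
      case True
      then have "entry X (I(i := a)) (K(i := a)) = 0" for a
        using K unfolding S_def by (auto simp: image_iff) (metis fun_upd_triv fun_upd_upd)
      then show ?thesis by (simp add: ptrace.rep_eq)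
    qed (simp add: ptrace.rep_eq)
    then show "entry (ptrace i X) I K = 0 \<or> entry B K J = 0" ..
  qed
  show "entry (ptrace i (X * B)) I J = entry (ptrace i X * B) I J"
  proof (cases "I i = J i")
    case True
    have "entry (X * B) (I(i := a)) (J(i := a))
      = (\<Sum>K\<in>S. entry X (I(i := a)) (K(i := a)) * entry B K J)" for a
    proof -
      have inj: "inj_on (\<lambda>K. K(i := a)) S"
        by (rule inj_onI) (metis S fun_upd_triv fun_upd_upd)
      have "entry (X * B) (I(i := a)) (J(i := a))
        = (\<Sum>K\<in>(\<lambda>K. K(i := a)) ` S. entry X (I(i := a)) K * entry B K (J(i := a)))"
      proof (rule entry_times)
        fix K assume K: "K \<notin> (\<lambda>K. K(i := a)) ` S"
        show "entry X (I(i := a)) K = 0 \<or> entry B K (J(i := a)) = 0"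
        proof (cases "K i = a")
          case True
          then have "K = (K(i := I i))(i := a)" by auto
          then have "K(i := I i) \<notin> S" using K by blast
          then show ?thesis unfolding S_def by auto
        qed (simp add: triv_0[OF B])
      qed (simp add: fin)
      also have "\<dots> = (\<Sum>K\<in>S. entry X (I(i := a)) (K(i := a)) * entry B (K(i := a)) (J(i := a)))"
        by (simp add: sum.reindex[OF inj])
      also have "\<dots> = (\<Sum>K\<in>S. entry X (I(i := a)) (K(i := a)) * entry B K J)"
        by (rule sum.cong[OF refl]) (simp add: triv_upd[OF B] S True)
      finally show ?thesis .
    qed
    then have "entry (ptrace i (X * B)) I J
      = (\<Sum>a\<in>UNIV. \<Sum>K\<in>S. entry X (I(i := a)) (K(i := a)) * entry B K J)"
      by (simp add: ptrace.rep_eq True)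
    also have "\<dots> = (\<Sum>K\<in>S. (\<Sum>a\<in>UNIV. entry X (I(i := a)) (K(i := a))) * entry B K J)"
      by (subst sum.swap) (simp add: sum_distrib_right)
    also have "\<dots> = entry (ptrace i X * B) I J"
      unfolding * by (rule sum.cong[OF refl]) (simp add: ptrace.rep_eq S)
    finally show ?thesis .
  next
    case False
    then show ?thesis unfolding *
      by (auto simp: ptrace.rep_eq S triv_0[OF B] intro!: sum.neutral[symmetric])
  qed
qed

lemma ptrace_diff: "ptrace i (X - Y) = ptrace i X - ptrace i Y"
  for X Y :: "('n::finite, 'a::ring_1) oper"
  by (rule oper_eqI) (simp add: ptrace.rep_eq entry_simps sum_subtractf)

lemma triv_ptrace: "triv i (ptrace i X)"
  unfolding triv_def ptrace.rep_eq by simp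

lemma triv_ptrace_other:
  assumes "triv j X"
  shows "triv j (ptrace i X)"
proof (cases "i = j")
  case False
  have "entry X (I(i := x)) (J(i := x)) = entry X (I(j := a, i := x)) (J(j := a, i := x))"
    if "I j = J j" for I J x a
    using triv_upd[OF assms, of "I(i := x)" "J(i := x)" a] that False
    by (simp add: fun_upd_twist[of j i])
  then show ?thesis unfolding triv_def ptrace.rep_eq
    using False triv_0[OF assms]
    by (auto intro!: sum.cong sum.neutral)
qed (simp add: triv_ptrace)

lemma ptrace_cyclic:
  fixes X :: "('n::finite, 'a::ring_1) oper"
  assumes C: "\<And>a b. central (C $ a $ b)"
  shows "ptrace i (on1 i C * X) = ptrace i (X * on1 i C)"
proof (rule oper_eqI)
  fix I J
  have "(\<Sum>a\<in>UNIV. \<Sum>b\<in>UNIV. C $ a $ b * entry X (I(i := b)) (J(i := a)))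
    = (\<Sum>a\<in>UNIV. \<Sum>b\<in>UNIV. entry X (I(i := a)) (J(i := b)) * C $ b $ a)"
    by (subst sum.swap) (use C in \<open>simp add: central_def\<close>)
  then show "entry (ptrace i (on1 i C * X)) I J = entry (ptrace i (X * on1 i C)) I J"
    by (simp add: ptrace.rep_eq entry_on1_times entry_times_on1)
qed

lemma entry_ptrace2:
  "entry (ptrace i (ptrace (Suc i) X)) I J = (if I i = J i \<and> I (Suc i) = J (Suc i)
    then \<Sum>p\<in>UNIV. entry X (upd2 I i p) (upd2 J i p) else 0)"
  by (simp add: ptrace.rep_eq sum.cartesian_product case_prod_unfold)

text \<open>An operator in two copies goes round only under the traces over both of them; central
  entries let the coefficients change places.\<close>

lemma ptrace_cyclic2:
  fixes X :: "('n::finite, 'a::ring_1) oper"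
  assumes C: "\<And>a b. central (C $ a $ b)"
  shows "ptrace i (ptrace (Suc i) (on2 i C * X)) = ptrace i (ptrace (Suc i) (X * on2 i C))"
proof (rule oper_eqI)
  fix I J
  have upd: "upd2 (upd2 K i p) i r = upd2 K i r" for K p and r :: "'n \<times> 'n"
    by (auto simp: fun_eq_iff)
  have "(\<Sum>p\<in>UNIV. \<Sum>r\<in>UNIV. C $ p $ r * entry X (upd2 I i r) (upd2 J i p))
    = (\<Sum>p\<in>UNIV. \<Sum>r\<in>UNIV. entry X (upd2 I i p) (upd2 J i r) * C $ r $ p)"
    by (subst sum.swap) (use C in \<open>simp add: central_def\<close>)
  then show "entry (ptrace i (ptrace (Suc i) (on2 i C * X))) I J
    = entry (ptrace i (ptrace (Suc i) (X * on2 i C))) I J"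
    by (simp add: entry_ptrace2 entry_on2_times entry_times_on2 upd del: fun_upd_apply)
      (simp add: upd)
qed

section \<open>Translation by one copy\<close>

lemma shift_times:
  fixes X Y :: "('n, 'a::ring_1) oper"
  shows "shift (X * Y) = shift X * shift Y"
proof (rule oper_eqI)
  fix I J :: "nat \<Rightarrow> 'n"
  let ?S = "{K. entry X (I \<circ> Suc) K \<noteq> 0}"
  have inj: "inj_on (case_nat (I 0)) ?S"
  proof (rule inj_onI)
    fix K K' assume "case_nat (I 0) K = case_nat (I 0) K'"
    then have "case_nat (I 0) K (Suc m) = case_nat (I 0) K' (Suc m)" for m by simp
    then show "K = K'" by (simp add: fun_eq_iff)
  qed
  have "entry (shift X * shift Y) I J
    = (\<Sum>K\<in>case_nat (I 0) ` ?S. entry (shift X) I K * entry (shift Y) K J)"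
  proof (rule entry_times)
    fix K assume K: "K \<notin> case_nat (I 0) ` ?S"
    have "K = case_nat (K 0) (K \<circ> Suc)" by (auto simp: fun_eq_iff split: nat.split)
    then have "I 0 = K 0 \<Longrightarrow> K \<circ> Suc \<notin> ?S" using K by (metis image_eqI)
    then show "entry (shift X) I K = 0 \<or> entry (shift Y) K J = 0"
      by (auto simp: shift.rep_eq)
  qed (simp add: finite_row)
  also have "\<dots> = (\<Sum>K\<in>?S. entry (shift X) I (case_nat (I 0) K) *
    entry (shift Y) (case_nat (I 0) K) J)"
    by (simp add: sum.reindex[OF inj])
  also have "\<dots> = entry (shift (X * Y)) I J"
    by (simp add: shift.rep_eq times_oper.rep_eq comp_def)
  finally show "entry (shift (X * Y)) I J = entry (shift X * shift Y) I J" ..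
qed

lemma all_nat_split: "(\<forall>m::nat. P m) \<longleftrightarrow> P 0 \<and> (\<forall>m. P (Suc m))"
proof (intro iffI allI)
  fix m assume "P 0 \<and> (\<forall>m. P (Suc m))"
  then show "P m" by (cases m) auto
qed auto

lemma fun_eq_0_Suc: "I = J \<longleftrightarrow> I 0 = J 0 \<and> I \<circ> Suc = J \<circ> Suc"
  unfolding fun_eq_iff comp_def by (rule all_nat_split)

lemma shift_scalar: "shift (scalar u) = scalar u"
proof (rule oper_eqI)
  fix I J
  show "entry (shift (scalar u)) I J = entry (scalar u) I J"
    unfolding shift.rep_eq scalar.rep_eq fun_eq_0_Suc[of I J] by simp
qed

lemma shift_1 [simp]: "shift 1 = (1 :: ('n, 'a::ring_1) oper)"
  using shift_scalar[of "1 :: 'a"] by simp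

lemma shift_diff: "shift (X - Y) = shift X - shift Y" for X Y :: "('n, 'a::ring_1) oper"
  by (rule oper_eqI) (simp add: shift.rep_eq entry_simps)

lemma shift_on1: "shift (on1 i X) = on1 (Suc i) X"
proof (rule oper_eqI)
  fix I J
  show "entry (shift (on1 i X)) I J = entry (on1 (Suc i) X) I J"
    unfolding shift.rep_eq on1.rep_eq all_nat_split[of "\<lambda>m. m \<noteq> Suc i \<longrightarrow> I m = J m"] by auto
qed

lemma shift_on2: "shift (on2 i X) = on2 (Suc i) X"
proof (rule oper_eqI)
  fix I J
  show "entry (shift (on2 i X)) I J = entry (on2 (Suc i) X) I J"
    unfolding shift.rep_eq on2.rep_eq
      all_nat_split[of "\<lambda>m. m \<noteq> Suc i \<and> m \<noteq> Suc (Suc i) \<longrightarrow> I m = J m"]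
    by auto
qed

lemma upd_comp_Suc: "(I(Suc i := a)) \<circ> Suc = (I \<circ> Suc)(i := a)"
  by (auto simp: fun_eq_iff)

lemma shift_ptrace: "shift (ptrace i X) = ptrace (Suc i) (shift X)"
  by (rule oper_eqI) (simp add: shift.rep_eq ptrace.rep_eq upd_comp_Suc)

text \<open>Here \<open>f\<close> need not be multiplicative: it suffices that it splits the
  products of entries that actually occur. This is the form in which a merely linear map passes a
  numerical operator. By \<open>supp\<close> the row support of \<open>X\<close> also serves for
  \<open>X'\<close>.\<close>

lemma map_oper_times_eq:
  fixes X Y :: "('n, 'a::ring_1) oper" and X' Y' :: "('n, 'b::ring_1) oper"
  assumes add: "\<And>x y. f (x + y) = f x + f y"
    and supp: "\<And>I J. entry X I J = 0 \<Longrightarrow> entry X' I J = 0"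
    and mult: "\<And>I J K. f (entry X I J * entry Y J K) = entry X' I J * entry Y' J K"
  shows "map_oper f (X * Y) = X' * Y'"
proof (rule oper_eqI)
  fix I J
  let ?S = "{K. entry X I K \<noteq> 0}"
  have f0: "f 0 = 0" using add[of 0 0] by simp
  have "f (\<Sum>K\<in>S. t K) = (\<Sum>K\<in>S. f (t K))" for S and t :: "(nat \<Rightarrow> 'n) \<Rightarrow> 'a"
    by (induction S rule: infinite_finite_induct) (simp_all add: f0 add)
  then have "entry (map_oper f (X * Y)) I J = (\<Sum>K\<in>?S. entry X' I K * entry Y' K J)"
    by (simp add: entry_map_oper f0 times_oper.rep_eq mult)
  also have "\<dots> = entry (X' * Y') I J"
    by (rule entry_times[symmetric]) (auto simp: finite_row supp)
  finally show "entry (map_oper f (X * Y)) I J = entry (X' * Y') I J" .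
qed

lemma map_oper_times:
  fixes X Y :: "('n, 'a::ring_1) oper"
    and f :: "'a \<Rightarrow> 'b::ring_1"
  assumes add: "\<And>x y. f (x + y) = f x + f y" and mult: "\<And>x y. f (x * y) = f x * f y"
  shows "map_oper f (X * Y) = map_oper f X * map_oper f Y"
proof -
  have "f 0 = 0" using add[of 0 0] by simp
  then show ?thesis by (intro map_oper_times_eq add) (simp_all add: entry_map_oper mult)
qed

lemma map_oper_add:
  fixes X Y :: "('n, 'a::ring_1) oper"
  assumes add: "\<And>x y. f (x + y) = (f x + f y :: 'b::ring_1)"
  shows "map_oper f (X + Y) = map_oper f X + map_oper f Y"
proof -
  have "f 0 = 0" using add[of 0 0] by simp
  then show ?thesis by (intro oper_eqI) (simp add: entry_map_oper entry_simps add)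
qed

lemma map_oper_ptrace:
  fixes X :: "('n::finite, 'a::ring_1) oper"
  assumes add: "\<And>x y. f (x + y) = (f x + f y :: 'b::ring_1)"
  shows "map_oper f (ptrace i X) = ptrace i (map_oper f X)"
proof -
  have f0: "f 0 = 0" using add[of 0 0] by simp
  have "f (\<Sum>a\<in>S. t a) = (\<Sum>a\<in>S. f (t a))" for S and t :: "'n \<Rightarrow> 'a"
    by (induction S rule: infinite_finite_induct) (simp_all add: f0 add)
  then show ?thesis
    by (intro oper_eqI) (simp add: entry_map_oper[where f = f, OF f0] ptrace.rep_eq f0)
qed

lemma map_oper_scalar: "f 0 = 0 \<Longrightarrow> map_oper f (scalar u) = scalar (f u)"
  by (rule oper_eqI) (auto simp: entry_map_oper scalar.rep_eq)

lemma map_oper_on1: "f 0 = 0 \<Longrightarrow> map_oper f (on1 i X) = on1 i (map_matrix f X)"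
  by (rule oper_eqI) (auto simp: entry_map_oper on1.rep_eq map_matrix_def)

lemma map_oper_on2: "f 0 = 0 \<Longrightarrow> map_oper f (on2 i X) = on2 i (map_matrix f X)"
  by (rule oper_eqI) (auto simp: entry_map_oper on2.rep_eq map_matrix_def)

lemma map_oper_first: "f 0 = 0 \<Longrightarrow> map_oper f (first k X) = first k (\<lambda>I J. f (X I J))"
  by (rule oper_eqI) (auto simp: entry_map_oper first.rep_eq)

lemma triv_map_oper:
  assumes "triv i X" "f 0 = 0"
  shows "triv i (map_oper f X)"
  unfolding triv_def entry_map_oper[where f = f, OF assms(2)]
proof (intro allI)
  fix I J a
  show "f (entry X I J) = (if I i = J i then f (entry X (I(i := a)) (J(i := a))) else 0)"
    by (cases "I i = J i") (simp_all add: triv_upd[OF assms(1)] triv_0[OF assms(1)] assms(2))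
qed


subsection \<open>Operators given on the first copies\<close>

definition upd_first :: "nat \<Rightarrow> (nat \<Rightarrow> 'n) \<Rightarrow> 'n list \<Rightarrow> nat \<Rightarrow> 'n" where
  "upd_first k I l m = (if m < k then l ! m else I m)"

lemma upd_first_ge [simp]: "m \<ge> k \<Longrightarrow> upd_first k I l m = I m"
  by (simp add: upd_first_def)

lemma map_upd_first [simp]: "length l = k \<Longrightarrow> map (upd_first k I l) [0..<k] = l"
  by (rule nth_equalityI) (simp_all add: upd_first_def)

lemma upd_first_eqI: "(\<And>m. m \<ge> k \<Longrightarrow> I m = K m) \<Longrightarrow> K = upd_first k I (map K [0..<k])"
  by (auto simp: fun_eq_iff upd_first_def)

lemma inj_upd_first: "inj_on (upd_first k I) {l. length l = k}"
  by (rule inj_on_inverseI[where g = "\<lambda>f. map f [0..<k]"]) simp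

lemma finite_lists_length: "finite {l :: 'n::finite list. length l = k}"
  using finite_lists_length_eq[of "UNIV :: 'n set" k] by simp

lemma entry_first_times:
  fixes Y :: "('n::finite, 'a::ring_1) oper"
  shows "entry (first k X * Y) I J
    = (\<Sum>l | length l = k. X (map I [0..<k]) l * entry Y (upd_first k I l) J)"
proof -
  have "K \<in> upd_first k I ` {l. length l = k}" if "\<forall>m\<ge>k. I m = K m" for K
    using upd_first_eqI[of k I K] that by (intro image_eqI) auto
  then have "entry (first k X * Y) I J
    = (\<Sum>K\<in>upd_first k I ` {l. length l = k}. entry (first k X) I K * entry Y K J)"
    by (intro entry_times) (auto simp: finite_lists_length first.rep_eq)
  also have "\<dots> = (\<Sum>l | length l = k. entry (first k X) I (upd_first k I l) * entry Y (upd_first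
    k I l) J)"
    by (simp add: sum.reindex[OF inj_upd_first])
  also have "\<dots> = (\<Sum>l | length l = k. X (map I [0..<k]) l * entry Y (upd_first k I l) J)"
    by (rule sum.cong[OF refl]) (simp add: first.rep_eq)
  finally show ?thesis .
qed

lemma first_tmult:
  "first k (tmult k X Y) = (first k X * first k Y :: ('n::finite, 'a::ring_1) oper)"
proof (rule oper_eqI)
  fix I J
  show "entry (first k (tmult k X Y)) I J = entry (first k X * first k Y) I J"
  proof (cases "\<forall>m\<ge>k. I m = J m")
    case True
    then show ?thesis unfolding entry_first_times
      by (simp add: first.rep_eq tmult_def)
  next
    case False
    then show ?thesis unfolding entry_first_times
      by (auto simp: first.rep_eq intro!: sum.neutral)
  qed
qed

lemma first_tid: "first k tid = (1 :: ('n::finite, 'a::ring_1) oper)"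
proof (rule oper_eqI)
  fix I J :: "nat \<Rightarrow> 'n"
  have "I = J \<longleftrightarrow> (\<forall>m\<ge>k. I m = J m) \<and> map I [0..<k] = map J [0..<k]"
    by (auto simp: fun_eq_iff not_le[symmetric])
  then show "entry (first k tid) I J = entry (1 :: ('n, 'a) oper) I J"
    by (auto simp: first.rep_eq entry_simps tid_def)
qed

lemma first_tprod:
  "first k (tprod k Xs) = (prod_list (map (first k) Xs) :: ('n::finite, 'a::ring_1) oper)"
  by (induction Xs) (simp_all add: tprod_def first_tid first_tmult)

lemma first_scale: "first k (\<lambda>I J. c * X I J)
  = (scalar c * first k X :: ('n::finite, 'a::ring_1) oper)"
  by (rule oper_eqI) (auto simp: first.rep_eq)

lemma first_diff: "first k (\<lambda>I J. X I J - Y I J)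
  = (first k X - first k Y :: ('n::finite, 'a::ring_1) oper)"
  by (rule oper_eqI) (auto simp: first.rep_eq entry_simps)

lemma first_at1: "1 \<le> i \<Longrightarrow> i \<le> k \<Longrightarrow> first k (at1 i X) = on1 (i - 1) X"
proof (rule oper_eqI)
  fix I J :: "nat \<Rightarrow> 'a" assume "1 \<le> i" "i \<le> k"
  then have "(\<forall>m. m \<noteq> i - 1 \<longrightarrow> I m = J m) \<longleftrightarrow> (\<forall>m\<ge>k. I m = J m) \<and> (\<forall>m<k. m \<noteq> i - 1 \<longrightarrow> I m = J m)"
    by (metis Suc_le_eq Suc_pred' not_le less_eq_Suc_le not_less_eq_eq One_nat_def)
  then show "entry (first k (at1 i X)) I J = entry (on1 (i - 1) X) I J"
    using \<open>1 \<le> i\<close> \<open>i \<le> k\<close> by (auto simp: first.rep_eq at1_def on1.rep_eq)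
qed

lemma first_at2: "1 \<le> i \<Longrightarrow> i < k \<Longrightarrow> first k (at2 i X) = on2 (i - 1) X"
proof (rule oper_eqI)
  fix I J :: "nat \<Rightarrow> 'a" assume i: "1 \<le> i" "i < k"
  then obtain i' where i': "i = Suc i'" by (cases i) auto
  have "(\<forall>m. m \<noteq> i' \<and> m \<noteq> Suc i' \<longrightarrow> I m = J m)
    \<longleftrightarrow> (\<forall>m\<ge>k. I m = J m) \<and> (\<forall>m<k. m \<noteq> i' \<and> m \<noteq> Suc i' \<longrightarrow> I m = J m)"
    using i i' by (auto simp: not_le) (metis not_le)
  then show "entry (first k (at2 i X)) I J = entry (on2 (i - 1) X) I J"
    using i i' by (auto simp: first.rep_eq at2_def on2.rep_eq)
qed

text \<open>Extension by the identity to one more copy is invisible once every operator acts on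
  infinitely many copies.\<close>

lemma first_extend: "first (Suc k) (extend X) = first k X"
proof (rule oper_eqI)
  fix I J :: "nat \<Rightarrow> 'a"
  have "(\<forall>m\<ge>k. I m = J m) \<longleftrightarrow> I k = J k \<and> (\<forall>m\<ge>Suc k. I m = J m)"
    by (metis Suc_le_eq le_eq_less_or_eq)
  then show "entry (first (Suc k) (extend X)) I J = entry (first k X) I J"
    by (auto simp: first.rep_eq extend_def)
qed

lemma first_inject:
  assumes "first k X = first k Y" "length I = k" "length J = k"
  shows "X I J = Y I J"
proof -
  have "entry (first k X) (upd_first k (\<lambda>_. undefined) I) (upd_first k (\<lambda>_. undefined) J)
      = entry (first k Y) (upd_first k (\<lambda>_. undefined) I) (upd_first k (\<lambda>_. undefined) J)"
    using assms(1) by simp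
  then show ?thesis using assms(2,3) by (simp add: first.rep_eq)
qed

lemma triv_first:
  assumes "k \<le> i"
  shows "triv i (first k X)"
  unfolding triv_def first.rep_eq
proof (intro allI)
  fix I J :: "nat \<Rightarrow> 'a" and a
  have A: "map (K(i := a)) [0..<k] = map K [0..<k]" for K :: "nat \<Rightarrow> 'a"
    using assms by auto
  have B: "(\<forall>m\<ge>k. I m = J m) \<longleftrightarrow> I i = J i \<and> (\<forall>m\<ge>k. (I(i := a)) m = (J(i := a)) m)"
    using assms by auto
  show "(if \<forall>m\<ge>k. I m = J m then X (map I [0..<k]) (map J [0..<k]) else 0)
    = (if I i = J i then if \<forall>m\<ge>k. (I(i := a)) m = (J(i := a)) m
        then X (map (I(i := a)) [0..<k]) (map (J(i := a)) [0..<k]) else 0 else 0)"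
    unfolding A B by (cases "I i = J i") (simp_all only: simp_thms if_True if_False)
qed

text \<open>\<open>ptraces a m\<close> is the trace over the copies \<open>a, \<dots>, a + m - 1\<close>.\<close>

primrec ptraces :: "nat \<Rightarrow> nat \<Rightarrow> ('n, 'a) oper \<Rightarrow> ('n::finite, 'a::comm_monoid_add) oper" where
  "ptraces a 0 X = X"
| "ptraces a (Suc m) X = ptraces a m (ptrace (a + m) X)"

lemma ptraces_add: "ptraces a (l + m) X = ptraces a l (ptraces (a + l) m X)"
  by (induction m arbitrary: X) (simp_all add: add.assoc)

lemma ptraces_triv_times:
  fixes A X :: "('n::finite, 'a::ring_1) oper"
  assumes "\<And>i. a \<le> i \<Longrightarrow> i < a + m \<Longrightarrow> triv i A"
  shows "ptraces a m (A * X) = A * ptraces a m X"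
  using assms by (induction m arbitrary: X) (simp_all add: ptrace_triv_times)

lemma sum_lists_Suc:
  "(\<Sum>l | length l = Suc m. g l) = (\<Sum>l | length l = m. \<Sum>a\<in>(UNIV :: 'n::finite set). g (l @ [a]))"
proof -
  have eq: "{l :: 'n list. length l = Suc m} = (\<lambda>(l, a). l @ [a]) ` ({l. length l = m} \<times> UNIV)"
    by (auto simp: image_iff length_Suc_conv_rev)
  have "inj_on (\<lambda>(l, a). l @ [a]) ({l :: 'n list. length l = m} \<times> UNIV)"
    by (auto simp: inj_on_def)
  then show ?thesis unfolding eq
    by (simp add: sum.reindex sum.cartesian_product case_prod_unfold comp_def)
qed

definition upd_at :: "nat \<Rightarrow> nat \<Rightarrow> (nat \<Rightarrow> 'n) \<Rightarrow> 'n list \<Rightarrow> nat \<Rightarrow> 'n" where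
  "upd_at a m I l i = (if a \<le> i \<and> i < a + m then l ! (i - a) else I i)"

lemma upd_at_snoc:
  "length l = m \<Longrightarrow> (upd_at a m I l)(a + m := b) = upd_at a (Suc m) I (l @ [b])"
  by (auto simp: fun_eq_iff upd_at_def nth_append)

lemma entry_ptraces:
  fixes X :: "('n::finite, 'a::comm_monoid_add) oper"
  shows "entry (ptraces a m X) I J = (if \<forall>i. a \<le> i \<and> i < a + m \<longrightarrow> I i = J i
    then \<Sum>l | length l = m. entry X (upd_at a m I l) (upd_at a m J l) else 0)"
proof (induction m arbitrary: X)
  case 0
  have "upd_at a 0 K [] = K" for K :: "nat \<Rightarrow> 'n" by (auto simp: upd_at_def fun_eq_iff)
  then show ?case by auto
next
  case (Suc m)
  have split: "(\<forall>i. a \<le> i \<and> i < a + Suc m \<longrightarrow> I i = J i)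
    \<longleftrightarrow> (\<forall>i. a \<le> i \<and> i < a + m \<longrightarrow> I i = J i) \<and> I (a + m) = J (a + m)"
    by (auto simp: less_Suc_eq)
  have "upd_at a m K l (a + m) = K (a + m)" for K :: "nat \<Rightarrow> 'n" and l by (simp add: upd_at_def)
  then show ?case unfolding ptraces.simps Suc.IH split
    by (auto simp: ptrace.rep_eq upd_at_snoc sum_lists_Suc)
qed

lemma ptraces_first_eq_trace_all:
  fixes X :: "('n::finite, 'a::comm_monoid_add) tmat"
  shows "ptraces 0 k (first k X) = scalar (trace_all k X)"
proof (rule oper_eqI)
  fix I J :: "nat \<Rightarrow> 'n"
  have "map (upd_at 0 k K l) [0..<k] = l" if "length l = k" for K :: "nat \<Rightarrow> 'n" and l
    using that by (intro nth_equalityI) (auto simp: upd_at_def)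
  moreover have "(\<forall>m\<ge>k. upd_at 0 k I l m = upd_at 0 k J l m) \<longleftrightarrow> (\<forall>m\<ge>k. I m = J m)" for l
    by (simp add: upd_at_def)
  moreover have "I = J \<longleftrightarrow> (\<forall>i<k. I i = J i) \<and> (\<forall>m\<ge>k. I m = J m)"
    by (auto simp: fun_eq_iff not_le[symmetric])
  ultimately show "entry (ptraces 0 k (first k X)) I J = entry (scalar (trace_all k X)) I J"
    by (auto simp: entry_ptraces first.rep_eq scalar.rep_eq trace_all_def intro!: sum.neutral)
qed

lemma ptraces_first_eq_trace_tail:
  fixes X :: "('n::finite, 'a::comm_monoid_add) tmat"
  assumes "k \<ge> 1"
  shows "ptraces 1 (k - 1) (first k X) = on1 0 (trace_tail k X)"
proof (rule oper_eqI)
  fix I J :: "nat \<Rightarrow> 'n"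
  from assms obtain m where k: "k = Suc m" by (cases k) auto
  have "map (upd_at 1 m K l) [0..<Suc m] = K 0 # l" if "length l = m" for K :: "nat \<Rightarrow> 'n" and l
    using that by (intro nth_equalityI)
      (auto simp: upd_at_def nth_Cons simp del: upt_Suc split: nat.split)
  moreover have "(\<forall>i\<ge>Suc m. upd_at 1 m I l i = upd_at 1 m J l i) \<longleftrightarrow> (\<forall>i\<ge>Suc m. I i = J i)" for l
    by (simp add: upd_at_def)
  moreover have "(\<forall>i::nat. i \<noteq> 0 \<longrightarrow> I i = J i)
    \<longleftrightarrow> (\<forall>i. 1 \<le> i \<and> i < 1 + m \<longrightarrow> I i = J i) \<and> (\<forall>i\<ge>Suc m. I i = J i)"
  proof (intro iffI conjI allI impI)
    fix i :: nat assume "(\<forall>i. 1 \<le> i \<and> i < 1 + m \<longrightarrow> I i = J i) \<and> (\<forall>i\<ge>Suc m. I i = J i)" "i \<noteq> 0"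
    then show "I i = J i" by (cases "i \<le> m") auto
  qed auto
  ultimately show "entry (ptraces 1 (k - 1) (first k X)) I J = entry (on1 0 (trace_tail k X)) I J"
    by (auto simp: entry_ptraces first.rep_eq on1.rep_eq trace_tail_def k intro!: sum.neutral
      simp del: upt_Suc)
qed


section \<open>The matrix D\<close>

text \<open>An injective linear map preserves the dimension, so one inclusion between a subspace and
  its image forces equality. For the dimension count matrices are flattened to vectors indexed by
  pairs.\<close>

lemma linear_inj_image_subspace:
  fixes f :: "'k::field^'n^'m \<Rightarrow> 'k^'n^'m"
  assumes add: "\<And>X Y. f (X + Y) = f X + f Y" and scale: "\<And>c X. f (mat c ** X) = mat c ** f X"
    and inj: "\<And>X. f X = 0 \<Longrightarrow> X = 0"
    and S: "0 \<in> S" "\<And>X Y. X \<in> S \<Longrightarrow> Y \<in> S \<Longrightarrow> X + Y \<in> S" "\<And>c X. X \<in> S \<Longrightarrow> mat c ** X \<in> S"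
    and sub: "S \<subseteq> f ` S \<or> f ` S \<subseteq> S"
  shows "f ` S = S"
proof -
  define v :: "'k^'n^'m \<Rightarrow> 'k^('m \<times> 'n)" where "v X = (\<chi> p. X $ fst p $ snd p)" for X
  define w :: "'k^('m \<times> 'n) \<Rightarrow> 'k^'n^'m" where "w x = (\<chi> i j. x $ (i, j))" for x
  have vw [simp]: "v (w x) = x" "w (v X) = X" for x X by (simp_all add: v_def w_def vec_eq_iff)
  have mat: "(mat c ** X) $ i $ j = c * X $ i $ j" for c :: 'k and X :: "'k^'n^'m" and i j
    by (simp add: matrix_matrix_mult_def mat_def if_distrib if_distribR sum.delta' cong: if_cong)
  have w: "w (x + y) = w x + w y" "w (c *s x) = mat c ** w x" "w 0 = 0" for x y c
    by (simp_all add: w_def vec_eq_iff mat)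
  have v: "v (X + Y) = v X + v Y" "v (mat c ** X) = c *s v X" "v 0 = 0" for X Y c
    by (simp_all add: v_def vec_eq_iff mat)
  define g where "g = v \<circ> f \<circ> w"
  have lin: "Vector_Spaces.linear (*s) (*s) g"
    by unfold_locales (simp_all add: g_def w v add scale)
  interpret g: Vector_Spaces.linear "(*s)" "(*s)" g by (rule lin)
  have inj: "inj g"
  proof (rule injI)
    fix x y assume "g x = g y"
    then have "g (x - y) = 0" by (simp add: g.diff)
    then have z: "f (w (x - y)) = 0" unfolding g_def by (metis comp_apply vw(2) w(3))
    have "w (x - y) = 0" by (rule inj[OF z])
    then have "x - y = 0" by (metis vw(1) v(3))
    then show "x = y" by simp
  qed
  have sS: "vec.subspace (v ` S)"
  proof (rule vec.subspaceI)
    show "0 \<in> v ` S" using S(1) v(3) by (metis image_eqI)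
    show "x + y \<in> v ` S" if "x \<in> v ` S" "y \<in> v ` S" for x y
      using that S(2) v(1) by (auto simp: image_iff) metis
    show "c *s x \<in> v ` S" if "x \<in> v ` S" for c x
      using that S(3) v(2) by (auto simp: image_iff) metis
  qed
  then have sgS: "vec.subspace (g ` v ` S)" by (rule g.subspace_image)
  have dim: "vec.dim (g ` v ` S) = vec.dim (v ` S)"
    by (rule vec.dim_image_eq[OF lin]) (use inj in \<open>auto intro: inj_on_subset\<close>)
  have gS: "g ` v ` S = v ` f ` S" by (simp add: g_def image_image)
  have "g ` v ` S = v ` S"
    using sub
  proof
    assume "S \<subseteq> f ` S"
    then have "v ` S \<subseteq> g ` v ` S" unfolding gS by (rule image_mono)
    then show ?thesis using vec.subspace_dim_equal[OF sS sgS] dim by simp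
  next
    assume "f ` S \<subseteq> S"
    then have "g ` v ` S \<subseteq> v ` S" unfolding gS by (rule image_mono)
    then show ?thesis using vec.subspace_dim_equal[OF sgS sS] dim by simp
  qed
  then have "w ` v ` f ` S = w ` v ` S" unfolding gS by simp
  then show ?thesis by (simp add: image_image)
qed

lemma mat_times_component: "(mat c ** X) $ i $ j = c * X $ i $ j" for X :: "'a::semiring_1^'n^'m"
  by (simp add: matrix_matrix_mult_def mat_def if_distrib if_distribR sum.delta' cong: if_cong)

text \<open>\<open>contract2 R X = Tr\<^sub>2 (R X\<^sub>2)\<close>\<close>

definition contract2 :: "'k::field^('n::finite \<times> 'n)^('n \<times> 'n) \<Rightarrow> 'k^'n^'n \<Rightarrow> 'k^'n^'n" where
  "contract2 R X = (\<chi> i j. \<Sum>b\<in>UNIV. \<Sum>d\<in>UNIV. R $ (i, b) $ (j, d) * X $ d $ b)"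

lemma sum_pair: "(\<Sum>p\<in>UNIV. g p) = (\<Sum>a\<in>UNIV. \<Sum>b\<in>UNIV. g (a, b))"
  by (simp add: sum.cartesian_product)

lemma sum_pair_fst:
  "(\<Sum>p\<in>UNIV. h p * (if fst p = j then g p else 0)) = (\<Sum>d\<in>UNIV. h (j, d) * g (j, d))"
  for h :: "'n::finite \<times> 'n \<Rightarrow> 'a::semiring_0"
proof -
  have "(\<Sum>p\<in>UNIV. h p * (if fst p = j then g p else 0))
    = (\<Sum>c\<in>UNIV. if c = j then \<Sum>d\<in>UNIV. h (c, d) * g (c, d) else 0)"
    unfolding sum_pair by (rule sum.cong) auto
  then show ?thesis by simp
qed

lemma sum_pair_snd:
  "(\<Sum>p\<in>UNIV. h p * (if snd p = j then g p else 0)) = (\<Sum>d\<in>UNIV. h (d, j) * g (d, j))"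
  for h :: "'n::finite \<times> 'n \<Rightarrow> 'a::semiring_0"
proof -
  have "(\<Sum>p\<in>UNIV. h p * (if snd p = j then g p else 0))
    = (\<Sum>d\<in>UNIV. \<Sum>c\<in>UNIV. if c = j then h (d, c) * g (d, c) else 0)"
    unfolding sum_pair by (intro sum.cong) auto
  then show ?thesis by simp
qed

lemma ptrace_on2_on1:
  "ptrace (Suc i) (on2 i R * on1 (Suc i) X) = on1 i (contract2 R X)"
proof (rule oper_eqI)
  fix I J :: "nat \<Rightarrow> 'a"
  show "entry (ptrace (Suc i) (on2 i R * on1 (Suc i) X)) I J = entry (on1 i (contract2 R X)) I J"
  proof (cases "\<forall>m. m \<noteq> i \<longrightarrow> I m = J m")
    case True
    have "entry (on1 (Suc i) X) (upd2 (I(Suc i := a)) i p) (J(Suc i := a))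
      = (if fst p = J i then X $ snd p $ a else 0)" for a p
      using True by (auto simp: on1.rep_eq)
    then have "entry (ptrace (Suc i) (on2 i R * on1 (Suc i) X)) I J
      = (\<Sum>a\<in>UNIV. \<Sum>p\<in>UNIV. R $ (I i, a) $ p * (if fst p = J i then X $ snd p $ a else 0))"
      using True by (simp add: ptrace.rep_eq entry_on2_times)
    then show ?thesis using True by (simp add: on1.rep_eq contract2_def sum_pair_fst)
  next
    case False
    then obtain m where m: "m \<noteq> i" "I m \<noteq> J m" by auto
    have "entry (on1 (Suc i) X) (upd2 (I(Suc i := a)) i p) (J(Suc i := b)) = 0"
      if "I (Suc i) = J (Suc i)" for a b p
    proof -
      have "m \<noteq> Suc i" using m that by auto
      then have "m \<noteq> Suc i \<and> (upd2 (I(Suc i := a)) i p) m \<noteq> (J(Suc i := b)) m"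
        using m by simp
      then have "\<not> (\<forall>m. m \<noteq> Suc i \<longrightarrow> (upd2 (I(Suc i := a)) i p) m = (J(Suc i := b)) m)" by blast
      then show ?thesis unfolding on1.rep_eq by (rule if_not_P)
    qed
    then show ?thesis using False
      by (auto simp: ptrace.rep_eq entry_on2_times on1.rep_eq simp del: fun_upd_apply intro!:
        sum.neutral)
  qed
qed

lemma contract2_add: "contract2 R (X + Y) = contract2 R X + contract2 R Y"
  by (simp add: contract2_def vec_eq_iff sum.distrib algebra_simps)

lemma contract2_scale: "contract2 R (mat c ** X) = mat c ** contract2 R X"
  by (simp add: contract2_def vec_eq_iff mat_times_component sum_distrib_left algebra_simps)

lemma trace_tail_eq_contract2: "trace_tail 2 (tprod 2 [at2 1 R, at1 2 X]) = contract2 R X"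
proof -
  have "on1 0 (trace_tail 2 (tprod 2 [at2 1 R, at1 2 X]))
    = ptraces 1 (2 - 1) (first 2 (tprod 2 [at2 1 R, at1 2 X]))"
    by (rule ptraces_first_eq_trace_tail[symmetric]) simp
  also have "\<dots> = on1 0 (contract2 R X)"
    using ptrace_on2_on1[of 0 R X] by (simp add: first_tprod first_at1 first_at2)
  finally show ?thesis by (simp add: on1_inject)
qed

lemma contract2_eq_1_iff: "is_qtrace_matrix R D \<Longrightarrow> contract2 R X = mat 1 \<longleftrightarrow> X = D"
  unfolding is_qtrace_matrix_def trace_tail_eq_contract2 by blast

text \<open>Adding an element of the kernel to \<open>D\<close> gives another solution of the
  equation that defines \<open>D\<close>; uniqueness therefore means injectivity.\<close>

lemma contract2_eq_0:
  assumes "is_qtrace_matrix R D" "contract2 R X = 0"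
  shows "X = 0"
proof -
  have "contract2 R (X + D) = mat 1"
    using contract2_eq_1_iff[OF assms(1)] assms(2) by (simp add: contract2_add)
  then show ?thesis using contract2_eq_1_iff[OF assms(1)] by simp
qed

lemma central_field [simp]: "central (c :: 'k::field)"
  by (simp add: central_def mult.commute)

lemma trace_oper: "ptrace i (on1 i Y) = scalar (trace Y)"
proof (rule oper_eqI)
  fix I J :: "nat \<Rightarrow> 'a"
  define C where "C \<longleftrightarrow> (\<forall>m. m \<noteq> i \<longrightarrow> I m = J m)"
  have "I = J \<longleftrightarrow> C \<and> I i = J i" unfolding C_def by (metis ext)
  moreover have "entry (on1 i Y) (I(i := a)) (J(i := a)) = (if C then Y $ a $ a else 0)" for a
    by (auto simp: on1.rep_eq C_def)
  ultimately show "entry (ptrace i (on1 i Y)) I J = entry (scalar (trace Y)) I J"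
    by (simp add: ptrace.rep_eq scalar.rep_eq trace_def)
qed

section \<open>Invariance of the q-trace and commutation of R with D_1 D_2\<close>

lemma conj_of_braid:
  fixes r s r' s' :: "'a::monoid_mult"
  assumes i: "r * r' = 1" "r' * r = 1" "s * s' = 1" "s' * s = 1" and braid: "r * s * r = s * r * s"
  shows "r * s' * r' = s' * r' * s" "s * r * s' = r' * s * r" "s' * r * s = r * s * r'"
proof -
  have c: "r * (r' * x) = x" "r' * (r * x) = x" "s * (s' * x) = x" "s' * (s * x) = x" for x
    using i by (simp_all add: mult.assoc[symmetric])
  have br: "r * (s * (r * x)) = s * (r * (s * x))" for x
    using braid by (metis mult.assoc)
  have "s' * (r' * (r * (s * (r * (s' * r'))))) = s' * (r' * (s * (r * (s * (s' * r')))))"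
    by (simp only: br)
  then show "r * s' * r' = s' * r' * s" by (simp add: c i mult.assoc)
  have "r' * (r * (s * (r * s'))) = r' * (s * (r * (s * s')))" by (simp only: br)
  then show "s * r * s' = r' * s * r" by (simp add: c i mult.assoc)
  have "s' * (r * (s * (r * r'))) = s' * (s * (r * (s * r')))" by (simp only: br)
  then show "s' * r * s = r * s * r'" by (simp add: c i mult.assoc)
qed

locale skew_invertible =
  fixes R R' :: "'k::field^('n::finite \<times> 'n)^('n \<times> 'n)" and D :: "'k^'n^'n"
  assumes inv: "R ** R' = mat 1" "R' ** R = mat 1"
    and braid: "on2 0 R * on2 1 R * on2 0 R = on2 1 R * on2 0 R * on2 1 R"
    and D: "contract2 R D = mat 1" "\<And>X. contract2 R X = 0 \<Longrightarrow> X = 0"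
begin

lemma inv_oper: "on2 i R * on2 i R' = 1" "on2 i R' * on2 i R = 1"
  using inv by (simp_all add: on2_mult[symmetric] on2_mat)

lemmas braid_conj = conj_of_braid[OF inv_oper(1)[of 0] inv_oper(2)[of 0] inv_oper(1)[of 1]
  inv_oper(2)[of 1] braid]

text \<open>Let Z be the left-hand side as a matrix. In Tr_2 (R Z_2) the factor B goes round the two
  traces, the braid relation in the form \<open>conj\<close> frees D for its defining equation, A
  and B cancel, and \<open>trace Y\<close> times the identity remains. So Z and
  \<open>trace Y\<close> times D have the same image under the injective map
  \<open>contract2 R\<close>. The pair A, B stands for both R', R and R, R'.\<close>

lemma conj_trace_aux:
  assumes conj: "on2 1 B * on2 0 R * on2 1 A = on2 0 A * on2 1 R * on2 0 B"
    and AB: "on2 0 A * on2 0 B = (1 :: ('n, 'k) oper)"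
  shows "ptrace 1 (on2 0 A * (on1 0 Y * (on1 1 D * on2 0 B))) = scalar (trace Y) * on1 0 D"
proof -
  define t where "t = trace Y"
  \<comment> \<open>The detour through \<open>trace_tail\<close> produces a matrix, to which
    \<open>contract2\<close> can be applied.\<close>
  define Z where "Z = trace_tail 2 (tprod 2 [at2 1 A, at1 1 Y, at1 2 D, at2 1 B])"
  have Z: "on1 0 Z = ptrace 1 (on2 0 A * (on1 0 Y * (on1 1 D * on2 0 B)))"
    unfolding Z_def
    by (subst ptraces_first_eq_trace_tail[symmetric]) (simp_all add: first_tprod first_at1
      first_at2)
  have Z1: "on1 1 Z = ptrace 2 (on2 1 A * (on1 1 Y * (on1 2 D * on2 1 B)))"
    using arg_cong[OF Z, of shift]
    by (simp add: shift_on1 shift_on2 shift_ptrace shift_times numeral_2_eq_2)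
  have "on1 0 (contract2 R Z) = ptrace 1 (on2 0 R * on1 1 Z)"
    using ptrace_on2_on1[of 0 R Z] by simp
  also have "\<dots> = ptrace 1 (ptrace 2 (on2 0 R * (on2 1 A * (on1 1 Y * (on1 2 D * on2 1 B)))))"
    unfolding Z1 by (subst ptrace_triv_times) simp_all
  also have "\<dots> = ptrace 1 (ptrace (Suc 1) ((on2 0 R * on2 1 A * on1 1 Y * on1 2 D) * on2 1 B))"
    by (simp add: mult.assoc numeral_2_eq_2)
  also have "\<dots> = ptrace 1 (ptrace (Suc 1) (on2 1 B * (on2 0 R * on2 1 A * on1 1 Y * on1 2 D)))"
    by (rule ptrace_cyclic2[symmetric]) simp
  also have "\<dots> = ptrace 1 (ptrace 2 ((on2 1 B * on2 0 R * on2 1 A) * (on1 1 Y * on1 2 D)))"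
    by (simp add: mult.assoc numeral_2_eq_2)
  also have "\<dots> = ptrace 1 (ptrace 2 (on2 0 A * (on2 1 R * ((on2 0 B * on1 1 Y) * on1 2 D))))"
    unfolding conj by (simp add: mult.assoc)
  also have "(on2 0 B * on1 1 Y) * on1 2 D = on1 2 D * (on2 0 B * on1 1 Y)"
    by (rule on1_commute[symmetric]) (simp_all add: triv_times)
  also have "ptrace 2 (on2 0 A * (on2 1 R * (on1 2 D * (on2 0 B * on1 1 Y))))
    = on2 0 A * (ptrace 2 (on2 1 R * on1 2 D) * (on2 0 B * on1 1 Y))"
  proof -
    have "ptrace 2 (on2 1 R * on1 2 D * (on2 0 B * on1 1 Y))
      = ptrace 2 (on2 1 R * on1 2 D) * (on2 0 B * on1 1 Y)"
      by (rule ptrace_times_triv) (simp add: triv_times)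
    then show ?thesis by (subst ptrace_triv_times) (simp_all add: mult.assoc)
  qed
  also have "ptrace 2 (on2 1 R * on1 2 D) = 1"
    using ptrace_on2_on1[of 1 R D] D(1) by (simp add: numeral_2_eq_2 on1_mat)
  also have "on2 0 A * (1 * (on2 0 B * on1 1 Y)) = on1 1 Y"
    by (simp add: mult.assoc[symmetric] AB)
  also have "ptrace 1 (on1 1 Y) = on1 0 (mat t)"
    by (simp add: trace_oper on1_mat t_def)
  finally have "contract2 R Z = mat t" by (simp only: on1_inject)
  then have "contract2 R (Z + mat (- t) ** D) = 0"
    by (simp add: contract2_add contract2_scale D(1)) (simp add: mat_def vec_eq_iff)
  then have 0: "Z + mat (- t) ** D = 0" by (rule D(2))
  have "Z = mat t ** D"
    using 0 by (simp add: vec_eq_iff mat_times_component)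
  then have "on1 0 Z = scalar t * on1 0 D"
    by (simp add: on1_mult on1_mat)
  then show ?thesis using Z by (simp add: t_def)
qed

text \<open>Taking the matrix unit with row \<open>m\<close> and column \<open>m'\<close> for Y
  gives an identity between numbers, which any embedding of the field carries to other coefficient
  algebras.\<close>

lemma conj_trace_entry_aux:
  assumes "on2 1 B * on2 0 R * on2 1 A = on2 0 A * on2 1 R * on2 0 B"
    and "on2 0 A * on2 0 B = (1 :: ('n, 'k) oper)"
  shows "(\<Sum>b\<in>UNIV. \<Sum>c\<in>UNIV. \<Sum>d\<in>UNIV. A $ (i, b) $ (m, c) * (D $ c $ d * B $ (m', d) $ (j, b)))
    = (if m = m' then D $ i $ j else 0)"
proof -
  define Y :: "'k^'n^'n" where "Y = (\<chi> a b. if b = m' then if a = m then 1 else 0 else 0)"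
  have tr: "trace Y = (if m = m' then 1 else 0)"
    by (simp add: trace_def Y_def)
  have "Y $ a $ x * g x = (if x = m' then if a = m then g x else 0 else 0)"
    for a x and g :: "'n \<Rightarrow> 'k"
    by (simp add: Y_def)
  then have Y: "(\<Sum>x\<in>UNIV. Y $ a $ x * g x) = (if a = m then g m' else 0)" for a and g :: "'n \<Rightarrow> 'k"
    by simp
  let ?I = "\<lambda>_::nat. i" and ?J = "(\<lambda>_::nat. i)(0 := j)"
  have "entry (ptrace 1 (on2 0 A * (on1 0 Y * (on1 1 D * on2 0 B)))) ?I ?J
    = entry (scalar (trace Y) * on1 0 D) ?I ?J"
    using conj_trace_aux[OF assms, of Y] by simp
  also have "\<dots> = (if m = m' then D $ i $ j else 0)"
    by (simp add: tr on1.rep_eq)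
  also have "entry (ptrace 1 (on2 0 A * (on1 0 Y * (on1 1 D * on2 0 B)))) ?I ?J
    = (\<Sum>b\<in>UNIV. \<Sum>p\<in>UNIV. A $ (i, b) $ p
        * (\<Sum>x\<in>UNIV. Y $ fst p $ x * (\<Sum>d\<in>UNIV. D $ snd p $ d * B $ (x, d) $ (j, b))))"
    by (simp add: ptrace.rep_eq entry_on2_times entry_on1_times on2.rep_eq)
  also have "\<dots> = (\<Sum>b\<in>UNIV. \<Sum>p\<in>UNIV. A $ (i, b) $ p
        * (if fst p = m then (\<Sum>d\<in>UNIV. D $ snd p $ d * B $ (m', d) $ (j, b)) else 0))"
    by (simp only: Y)
  finally show ?thesis
    by (simp add: sum_pair_fst sum_distrib_left)
qed

lemmas conj_trace_entry = conj_trace_entry_aux[OF braid_conj(2) inv_oper(2)]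
  conj_trace_entry_aux[OF braid_conj(3) inv_oper(1)]

text \<open>The map \<tau> of the overview.\<close>

definition contract1 :: "'k^'n^'n \<Rightarrow> 'k^'n^'n" where
  "contract1 Z = (\<chi> c b. \<Sum>p\<in>UNIV. Z $ fst p $ snd p * R' $ (snd p, c) $ (fst p, b))"

lemmas swap_pair = sum.swap[where A = "UNIV :: 'n set" and B = "UNIV :: ('n \<times> 'n) set"]

text \<open>The invariance in entries, for the pair R, R', summed against the entries of Z. The pair
  R', R gives the companion with D on the right.\<close>

lemma contract2_contract1_left: "contract2 R (D ** contract1 Z) = D ** Z"
proof (simp add: vec_eq_iff, intro allI)
  fix i m
  have "contract2 R (D ** contract1 Z) $ i $ m
    = (\<Sum>b\<in>UNIV. \<Sum>c\<in>UNIV. \<Sum>d\<in>UNIV. \<Sum>p\<in>UNIV. Z $ fst p $ snd p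
        * (R $ (i, b) $ (m, c) * (D $ c $ d * R' $ (snd p, d) $ (fst p, b))))"
    by (simp add: contract2_def contract1_def matrix_matrix_mult_def sum_distrib_left mult_ac)
  also have "\<dots> = (\<Sum>p\<in>UNIV. \<Sum>b\<in>UNIV. \<Sum>c\<in>UNIV. \<Sum>d\<in>UNIV. Z $ fst p $ snd p
        * (R $ (i, b) $ (m, c) * (D $ c $ d * R' $ (snd p, d) $ (fst p, b))))"
    by (simp only: swap_pair)
  also have "\<dots> = (\<Sum>p\<in>UNIV. Z $ fst p $ snd p * (if m = snd p then D $ i $ fst p else 0))"
    by (simp only: sum_distrib_left[symmetric] conj_trace_entry(2)[unfolded
      sum_distrib_left[symmetric]])
  also have "\<dots> = (D ** Z) $ i $ m"
    by (simp add: sum_pair matrix_matrix_mult_def if_distrib mult.commute cong: if_cong)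
  finally show "contract2 R (D ** contract1 Z) $ i $ m = (D ** Z) $ i $ m" .
qed

lemma contract2_contract1_right: "contract2 R (contract1 Z ** D) = Z ** D"
proof (simp add: vec_eq_iff, intro allI)
  fix s m
  have "contract2 R (contract1 Z ** D) $ s $ m
    = (\<Sum>b\<in>UNIV. \<Sum>c\<in>UNIV. \<Sum>d\<in>UNIV. \<Sum>p\<in>UNIV. Z $ fst p $ snd p
        * (R' $ (snd p, c) $ (fst p, d) * (D $ d $ b * R $ (s, b) $ (m, c))))"
    by (simp add: contract2_def contract1_def matrix_matrix_mult_def sum_distrib_left
        sum_distrib_right mult_ac)
  also have "\<dots> = (\<Sum>c\<in>UNIV. \<Sum>b\<in>UNIV. \<Sum>d\<in>UNIV. \<Sum>p\<in>UNIV. Z $ fst p $ snd p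
        * (R' $ (snd p, c) $ (fst p, d) * (D $ d $ b * R $ (s, b) $ (m, c))))"
    by (rule sum.swap)
  also have "\<dots> = (\<Sum>c\<in>UNIV. \<Sum>d\<in>UNIV. \<Sum>b\<in>UNIV. \<Sum>p\<in>UNIV. Z $ fst p $ snd p
        * (R' $ (snd p, c) $ (fst p, d) * (D $ d $ b * R $ (s, b) $ (m, c))))"
    by (intro sum.cong refl sum.swap)
  also have "\<dots> = (\<Sum>p\<in>UNIV. \<Sum>c\<in>UNIV. \<Sum>d\<in>UNIV. \<Sum>b\<in>UNIV. Z $ fst p $ snd p
        * (R' $ (snd p, c) $ (fst p, d) * (D $ d $ b * R $ (s, b) $ (m, c))))"
    by (simp only: swap_pair)
  also have "\<dots> = (\<Sum>p\<in>UNIV. Z $ fst p $ snd p * (if fst p = s then D $ snd p $ m else 0))"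
    by (simp only: sum_distrib_left[symmetric] conj_trace_entry(1)[unfolded
      sum_distrib_left[symmetric]])
  also have "\<dots> = (Z ** D) $ s $ m"
    by (simp add: sum_pair_fst matrix_matrix_mult_def)
  finally show "contract2 R (contract1 Z ** D) $ s $ m = (Z ** D) $ s $ m" .
qed

text \<open>By \<open>contract2_contract1_left\<close> the subspace \<open>{D Z}\<close> is contained in, hence equal to, its
  image under the injective map \<open>contract2 R\<close>; this image contains the image \<open>I\<close> of \<open>D\<close>.\<close>

lemma D_invertible: "\<exists>E. D ** E = mat 1 \<and> E ** D = mat 1"
proof -
  let ?S = "range (\<lambda>Z. D ** Z)"
  have "contract2 R ` ?S = ?S"
  proof (rule linear_inj_image_subspace)
    show "0 \<in> ?S" by (rule range_eqI[of _ _ 0]) simp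
    show "X + Y \<in> ?S" if "X \<in> ?S" "Y \<in> ?S" for X Y
      using that by (auto simp: matrix_add_ldistrib[symmetric])
    show "mat c ** X \<in> ?S" if X: "X \<in> ?S" for c X
    proof -
      obtain Z where "X = D ** Z" using X by blast
      then have "mat c ** X = D ** (mat c ** Z)"
        unfolding vec_eq_iff mat_times_component matrix_matrix_mult_def[of D]
        by (simp add: mat_times_component sum_distrib_left mult_ac)
      then show ?thesis by blast
    qed
    have "?S \<subseteq> contract2 R ` ?S" using contract2_contract1_left by (metis (no_types, lifting) image_eqI image_subsetI rangeI)
    then show "?S \<subseteq> contract2 R ` ?S \<or> contract2 R ` ?S \<subseteq> ?S" ..
  qed (use D(2) in \<open>auto simp: contract2_add contract2_scale\<close>)
  moreover have "D \<in> ?S" by (rule range_eqI[of _ _ "mat 1"]) simp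
  ultimately have "mat 1 \<in> ?S" using D(1) by (metis image_eqI)
  then obtain E where "D ** E = mat 1" by (metis imageE)
  then show ?thesis using matrix_left_right_inverse by blast
qed

text \<open>If \<open>contract1 X = 0\<close>, then D X = 0 by
  \<open>contract2_contract1_left\<close>, and X = 0 because D is invertible. An injective
  endomorphism of a finite-dimensional space is onto.\<close>

lemma contract1_surj: "\<exists>Z. contract1 Z = X"
proof -
  obtain E where E: "E ** D = mat 1" using D_invertible by blast
  have "contract1 ` UNIV = UNIV"
  proof (rule linear_inj_image_subspace)
    show "contract1 (X + Y) = contract1 X + contract1 Y" for X Y
      by (simp add: contract1_def vec_eq_iff algebra_simps sum.distrib)
    show "contract1 (mat c ** X) = mat c ** contract1 X" for c X
      by (simp add: contract1_def vec_eq_iff mat_times_component sum_distrib_left mult.assoc)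
    show "X = 0" if "contract1 X = 0" for X
    proof -
      have "D ** X = 0" using contract2_contract1_left[of X] that
        by (simp add: contract2_def vec_eq_iff matrix_matrix_mult_def)
      then have "E ** (D ** X) = 0" by simp
      then show ?thesis by (simp add: matrix_mul_assoc E)
    qed
  qed auto
  then show ?thesis by (metis UNIV_I imageE)
qed

text \<open>For X = \<tau>(Z) both sides are D Z D.\<close>

lemma contract2_D: "contract2 R (D ** X) ** D = D ** contract2 R (X ** D)"
proof -
  obtain Z where "X = contract1 Z" using contract1_surj by metis
  then show ?thesis
    by (simp add: contract2_contract1_left contract2_contract1_right matrix_mul_assoc)
qed

text \<open>This is \<open>contract2_D\<close> for the matrix unit X with row \<open>d\<close> and
  column \<open>b\<close>.\<close>

lemma R_DD_entry: "(\<Sum>m\<in>UNIV. \<Sum>c\<in>UNIV. R $ (i, b) $ (m, c) * (D $ m $ j * D $ c $ d))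
  = (\<Sum>m\<in>UNIV. \<Sum>c\<in>UNIV. D $ i $ m * (D $ b $ c * R $ (m, c) $ (j, d)))"
proof -
  define X :: "'k^'n^'n" where "X = (\<chi> x y. if x = d then if y = b then 1 else 0 else 0)"
  have "D $ x $ z * X $ z $ y = (if z = d then if y = b then D $ x $ z else 0 else 0)" for x y z
    by (simp add: X_def)
  then have DX: "(D ** X) $ x $ y = (if y = b then D $ x $ d else 0)" for x y
    by (simp add: matrix_matrix_mult_def)
  have "X $ x $ z * D $ z $ y = (if z = b then if x = d then D $ z $ y else 0 else 0)" for x y z
    by (simp add: X_def)
  then have XD: "(X ** D) $ x $ y = (if x = d then D $ b $ y else 0)" for x y
    by (simp add: matrix_matrix_mult_def)
  have "contract2 R (D ** X) $ i $ m = (\<Sum>c\<in>UNIV. R $ (i, b) $ (m, c) * D $ c $ d)" for m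
    unfolding contract2_def by (subst sum.swap) (simp add: DX if_distrib cong: if_cong)
  then have 1: "(contract2 R (D ** X) ** D) $ i $ j
    = (\<Sum>m\<in>UNIV. \<Sum>c\<in>UNIV. R $ (i, b) $ (m, c) * (D $ m $ j * D $ c $ d))"
    unfolding matrix_matrix_mult_def[of "contract2 R (D ** X)" D]
    by (simp add: sum_distrib_left sum_distrib_right mult_ac)
  have "contract2 R (X ** D) $ m $ j = (\<Sum>c\<in>UNIV. D $ b $ c * R $ (m, c) $ (j, d))" for m
    unfolding contract2_def by (simp add: XD if_distrib mult.commute cong: if_cong)
  then have 2: "(D ** contract2 R (X ** D)) $ i $ j
    = (\<Sum>m\<in>UNIV. \<Sum>c\<in>UNIV. D $ i $ m * (D $ b $ c * R $ (m, c) $ (j, d)))"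
    unfolding matrix_matrix_mult_def[of D "contract2 R (X ** D)"]
    by (simp add: sum_distrib_left)
  show ?thesis unfolding 1[symmetric] 2[symmetric] contract2_D ..
qed

lemma R_DD: "on2 i R * (on1 i D * on1 (Suc i) D) = on1 i D * on1 (Suc i) D * on2 i R"
proof -
  define DD where "DD = (\<chi> p r. D $ fst p $ fst r * D $ snd p $ snd r)"
  have DD: "on1 i D * on1 (Suc i) D = on2 i DD"
  proof (rule oper_eqI)
    fix I J :: "nat \<Rightarrow> 'n"
    have "(\<Sum>a\<in>UNIV. D $ I i $ a * entry (on1 (Suc i) D) (I(i := a)) J)
      = (\<Sum>a\<in>{J i}. D $ I i $ a * entry (on1 (Suc i) D) (I(i := a)) J)"
      by (rule sum.mono_neutral_right) (auto simp: on1.rep_eq)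
    then show "entry (on1 i D * on1 (Suc i) D) I J = entry (on2 i DD) I J"
      by (auto simp: entry_on1_times on1.rep_eq on2.rep_eq DD_def)
  qed
  have "R ** DD = DD ** R"
  proof (simp add: vec_eq_iff, intro allI)
    fix i b j d
    show "(R ** DD) $ (i, b) $ (j, d) = (DD ** R) $ (i, b) $ (j, d)"
      using R_DD_entry[of i b j d]
      by (simp add: matrix_matrix_mult_def sum_pair DD_def mult.assoc)
  qed
  then show ?thesis unfolding DD by (simp add: on2_mult[symmetric])
qed

end

text \<open>The entries of X may be arbitrary: as those of A, B and D are central, each summand is
  an entry of X times a numerical sum that \<open>AB\<close> evaluates.\<close>

lemma qtrace_conj:
  fixes X :: "('n::finite, 'a::ring_1) oper"
  assumes X: "triv (Suc i) X"
    and cen: "\<And>a b. central (A $ a $ b)" "\<And>a b. central (B $ a $ b)" "\<And>a b. central (D $ a $ b)"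
    and AB: "\<And>i j m m'. (\<Sum>b\<in>UNIV. \<Sum>c\<in>UNIV. \<Sum>d\<in>UNIV.
        A $ (i, b) $ (m, c) * (D $ c $ d * B $ (m', d) $ (j, b))) = (if m = m' then D $ i $ j else 0)"
  shows "ptrace (Suc i) (on1 (Suc i) D * (on2 i B * X * on2 i A)) = ptrace i (on1 i D * X)"
proof (rule oper_eqI)
  fix I J :: "nat \<Rightarrow> 'n"
  define x where "x m m' = entry X (I(i := m)) (J(i := m'))" for m m'
  show "entry (ptrace (Suc i) (on1 (Suc i) D * (on2 i B * X * on2 i A))) I J
    = entry (ptrace i (on1 i D * X)) I J"
  proof (cases "I (Suc i) = J (Suc i)")
    case True
    have upd: "upd2 (K(Suc i := a)) i p = upd2 K i p" for K :: "nat \<Rightarrow> 'n" and a p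
      by (auto simp: fun_eq_iff)
    have X': "entry X (upd2 I i p) (upd2 J i r) = (if snd p = snd r then x (fst p) (fst r) else 0)" for p r
    proof (cases "snd p = snd r")
      case eq: True
      then show ?thesis
        using triv_upd[OF X, of "I(i := fst p)" "J(i := fst r)" "snd r"] True by (simp add: x_def)
    next
      case False
      then show ?thesis using triv_0[OF X] by simp
    qed
    have cen': "D $ b $ d * ((B $ p $ r * y) * A $ u $ v) = y * (A $ u $ v * (D $ b $ d * B $ p $ r))"
      for b d p r u v y
    proof -
      have "D $ b $ d * ((B $ p $ r * y) * A $ u $ v) = (B $ p $ r * y) * A $ u $ v * D $ b $ d"
        using cen(3) by (simp add: central_def)
      also have "\<dots> = (B $ p $ r * (y * A $ u $ v * D $ b $ d))" by (simp add: mult.assoc)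
      also have "\<dots> = y * A $ u $ v * D $ b $ d * B $ p $ r"
        using cen(2) by (simp add: central_def)
      finally show ?thesis by (simp add: mult.assoc)
    qed
    \<comment> \<open>\<open>P\<close> bundles the two indices that X leaves free; the sums over
      \<open>b\<close>, \<open>c\<close>, \<open>d\<close> are then exactly the one in
      \<open>AB\<close>.\<close>
    define F where "F P b d c = x (snd P) (fst P)
      * (A $ (fst P, c) $ (J i, b) * (D $ b $ d * B $ (I i, d) $ (snd P, c)))" for P b d c
    have "entry (ptrace (Suc i) (on1 (Suc i) D * (on2 i B * X * on2 i A))) I J
      = (\<Sum>b\<in>UNIV. \<Sum>d\<in>UNIV. D $ b $ d * (\<Sum>r\<in>UNIV. (\<Sum>p\<in>UNIV. B $ (I i, d) $ p
          * (if snd p = snd r then x (fst p) (fst r) else 0)) * A $ r $ (J i, b)))"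
      using True
      by (simp add: ptrace.rep_eq entry_on1_times entry_on2_times entry_times_on2 X' upd)
    also have "\<dots> = (\<Sum>b\<in>UNIV. \<Sum>d\<in>UNIV. \<Sum>m'\<in>UNIV. \<Sum>c\<in>UNIV. \<Sum>m\<in>UNIV. F (m', m) b d c)"
      unfolding sum_pair_snd
      by (simp add: sum_pair sum_distrib_left sum_distrib_right cen' F_def)
    also have "\<dots> = (\<Sum>b\<in>UNIV. \<Sum>d\<in>UNIV. \<Sum>c\<in>UNIV. \<Sum>P\<in>UNIV. F P b d c)"
      unfolding sum_pair by (intro sum.cong refl sum.swap)
    also have "\<dots> = (\<Sum>P\<in>UNIV. \<Sum>b\<in>UNIV. \<Sum>d\<in>UNIV. \<Sum>c\<in>UNIV. F P b d c)"
      by (simp only: sum.swap[where A = "UNIV :: 'n set" and B = "UNIV :: ('n \<times> 'n) set"])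
    also have "\<dots> = (\<Sum>P\<in>UNIV. \<Sum>b\<in>UNIV. \<Sum>c\<in>UNIV. \<Sum>d\<in>UNIV. F P b d c)"
      by (intro sum.cong refl sum.swap)
    also have "\<dots> = (\<Sum>P\<in>UNIV. \<Sum>c\<in>UNIV. \<Sum>b\<in>UNIV. \<Sum>d\<in>UNIV. F P b d c)"
      by (intro sum.cong refl sum.swap)
    also have "\<dots> = (\<Sum>P\<in>UNIV. x (snd P) (fst P) * (if J i = I i then D $ fst P $ snd P else 0))"
      unfolding F_def by (simp only: sum_distrib_left[symmetric] AB[unfolded sum_distrib_left[symmetric]])
    also have "\<dots> = entry (ptrace i (on1 i D * X)) I J"
      using cen(3) by (simp add: ptrace.rep_eq entry_on1_times sum_pair x_def central_def)
    finally show ?thesis .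
  next
    case False
    have "triv (Suc i) (ptrace i (on1 i D * X))"
      by (rule triv_ptrace_other) (simp add: triv_times X)
    from triv_0[of "Suc i" _ I J, OF this False] False show ?thesis by (simp add: ptrace.rep_eq[of "Suc i"])
  qed
qed


section \<open>Antisymmetrizers in representations of Hecke algebras\<close>

text \<open>Abstract because it is used on two levels: for the coefficient algebra and for the ring
  of operators over it.\<close>

locale field_embedding =
  fixes e :: "'k::field \<Rightarrow> 'a::ring_1"
  assumes e_add: "e (c + d) = e c + e d"
    and e_mult: "e (c * d) = e c * e d"
    and e_1 [simp]: "e 1 = 1"
    and e_central: "e c * x = x * e c"
begin

lemma e_0 [simp]: "e 0 = 0"
  using e_add[of 0 0] by simp

lemma e_uminus: "e (- c) = - e c"
  using e_add[of "- c" c] by (simp add: eq_neg_iff_add_eq_0)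

lemma e_diff: "e (c - d) = e c - e d"
  using e_add[of c "- d"] by (simp add: e_uminus)

definition scale :: "'k \<Rightarrow> 'a \<Rightarrow> 'a" where
  "scale c x = e c * x"

lemma e_scale: "e c * x = scale c x" "x * e c = scale c x"
  by (simp_all add: scale_def e_central)

lemma scale_simps:
  "x * scale c y = scale c (x * y)" "scale c x * y = scale c (x * y)"
  "scale c (scale d x) = scale (c * d) x" "scale c (x + y) = scale c x + scale c y"
  "scale c (x - y) = scale c x - scale c y" "scale c (- x) = - scale c x" "scale c 0 = 0"
  "scale 1 x = x" "scale 0 x = 0" "scale (c + d) x = scale c x + scale d x"
  "scale (c - d) x = scale c x - scale d x" "scale (- c) x = - scale c x"
proof -
  show "x * scale c y = scale c (x * y)"
    unfolding scale_def by (metis mult.assoc e_central)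
qed (simp_all add: scale_def e_mult e_add e_diff e_uminus mult.assoc distrib_left distrib_right
  left_diff_distrib right_diff_distrib)

text \<open>As rewrite rules these collect all numerical factors of a product in one
  \<open>scale\<close> at the front.\<close>

lemmas sc = e_scale scale_simps algebra_simps

lemma e_power: "e (c ^ m) = e c ^ m"
  by (induction m) (simp_all add: e_mult)

lemma e_sum: "e (sum g S) = (\<Sum>i\<in>S. e (g i))"
  by (induction S rule: infinite_finite_induct) (simp_all add: e_add)

lemma central_e [simp]: "central (e c)"
  by (simp add: central_def e_central)

end

text \<open>The recursion of \<open>antisymmetrizer\<close> for abstract generators
  \<open>f\<close>; translated generators such as \<open>f (Suc i)\<close> are then covered as
  well.\<close>

fun asym :: "('k::field \<Rightarrow> 'a::ring_1) \<Rightarrow> 'k \<Rightarrow> (nat \<Rightarrow> 'a) \<Rightarrow> nat \<Rightarrow> 'a" where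
  "asym e q f 0 = 1"
| "asym e q f (Suc 0) = 1"
| "asym e q f (Suc (Suc m)) = e (1 / qnum q (Suc (Suc m))) *
    (asym e q f (Suc m) * (e (q ^ Suc m) - e (qnum q (Suc m)) * f m) * asym e q f (Suc m))"

section \<open>q-numbers\<close>

locale generic_q =
  fixes q :: "'k::field"
  assumes q_nz: "q \<noteq> 0" and not_root: "\<And>m. m \<ge> 1 \<Longrightarrow> q ^ m \<noteq> 1"
begin

lemma q_diff_nz: "q - inverse q \<noteq> 0"
proof
  assume "q - inverse q = 0"
  then have "q * q = q * inverse q" by simp
  then show False using q_nz not_root[of 2] by (simp add: power2_eq_square)
qed

lemma qnum_nz: "m \<ge> 1 \<Longrightarrow> qnum q m \<noteq> 0"
proof
  assume m: "m \<ge> 1" and "qnum q m = 0"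
  then have "q ^ m = inverse q ^ m" using q_diff_nz by (simp add: qnum_def)
  then have "q ^ m * q ^ m = q ^ m * inverse q ^ m" by simp
  also have "\<dots> = 1" using q_nz by (simp flip: power_mult_distrib)
  finally have "q ^ m * q ^ m = 1" .
  then show False using not_root[of "m + m"] m by (simp add: power_add)
qed

lemma qnum_1: "qnum q (Suc 0) = 1"
  using q_diff_nz by (simp add: qnum_def)

lemma qnum_0: "qnum q 0 = 0"
  by (simp add: qnum_def)

text \<open>Where R has the eigenvalue -q^(-1), the middle factor q^m - m_q R of the recursion is
  q^m + q^(-1) m_q. That this is (m+1)_q explains the normalization of the antisymmetrizers.\<close>

lemma qnum_Suc: "qnum q (Suc m) = q ^ m + inverse q * qnum q m"
proof -
  have "(q - inverse q) * (q ^ m + inverse q * qnum q m)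
    = q ^ Suc m - inverse q * q ^ m + inverse q * ((q - inverse q) * qnum q m)"
    by (simp add: algebra_simps)
  also have "(q - inverse q) * qnum q m = q ^ m - inverse q ^ m"
    using q_diff_nz by (simp add: qnum_def)
  also have "q ^ Suc m - inverse q * q ^ m + inverse q * (q ^ m - inverse q ^ m)
    = q ^ Suc m - inverse q ^ Suc m" by (simp add: algebra_simps)
  finally show ?thesis unfolding qnum_def[of q "Suc m"] using q_diff_nz
    by (metis nonzero_mult_div_cancel_left)
qed

end

section \<open>Eigenvalue equations for the antisymmetrizers\<close>

context field_embedding
begin

text \<open>
  If \<open>a\<close> and \<open>b\<close> are the antisymmetrizers of \<open>m\<close> and \<open>m - 1\<close> copies, then \<open>n\<close>, \<open>n'\<close>, \<open>p\<close>, \<open>t\<close>, \<open>t'\<close> are \<open>m\<^sub>q\<close>,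
  \<open>(m-1)\<^sub>q\<close>, \<open>q\<^sup>m\<^sup>-\<^sup>1\<close>, \<open>q\<close>, \<open>q\<^sup>-\<^sup>1\<close>; for \<open>m = 1\<close> one takes \<open>b = 1\<close> and \<open>s = 0\<close>.
\<close>

lemma hecke_left_step:
  assumes tt: "t * t' = 1" and br: "b * r = r * b" and ab: "b * a = a" and aa: "a * a = a"
    and Na: "e n * a = e p * b - e n' * (b * s * b)"
    and sa: "e n' * (s * a) = - (e t' * (e n' * a))"
    and braid: "r * s * r = s * r * s" and quad: "r * r = 1 + e (t - t') * r"
  shows "r * (a * (e (t * p) - e n * r) * a) = - (e t' * (a * (e (t * p) - e n * r) * a))"
proof -
  have br': "r * (b * x) = b * (r * x)" for x by (metis br mult.assoc)
  have bra: "b * (r * a) = r * a" by (metis br ab mult.assoc)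
  have "scale n (a * (r * a)) = (e n * a) * (r * a)" by (simp add: sc)
  also have "\<dots> = scale p (r * a) - scale n' (b * (s * (r * a)))"
    unfolding Na by (simp add: sc bra)
  finally have ara: "scale n (a * (r * a)) = scale p (r * a) - scale n' (b * (s * (r * a)))" .
  have "scale n' (r * (b * (s * (r * a)))) = b * (r * s * r) * (e n' * a)"
    by (simp add: sc br')
  also have "\<dots> = b * s * r * (e n' * (s * a))" unfolding braid by (simp add: sc)
  also have "\<dots> = - scale (t' * n') (b * (s * (r * a)))"
    unfolding sa by (simp add: sc)
  finally have rbsra: "scale n' (r * (b * (s * (r * a)))) = - scale (t' * n') (b * (s * (r * a)))" .
  have "r * (r * a) = (r * r) * a" by (simp only: mult.assoc)
  also have "\<dots> = a + scale t (r * a) - scale t' (r * a)"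
    unfolding quad by (simp add: sc)
  finally have rra: "r * (r * a) = a + scale t (r * a) - scale t' (r * a)" .
  define E where "E = a * (e (t * p) - e n * r) * a"
  have "E = scale (t * p) (a * a) - scale n (a * (r * a))"
    by (simp add: E_def sc)
  then have E: "E = scale (t * p) a - scale p (r * a) + scale n' (b * (s * (r * a)))"
    by (simp add: ara aa)
  have tt': "t * (t' * c) = c" for c using tt by (simp add: mult.assoc[symmetric])
  have "r * E = scale (t * p) (r * a) - scale p (r * (r * a)) + scale n' (r * (b * (s * (r * a))))"
    unfolding E by (simp add: sc)
  also have "\<dots> = - (e t' * E)"
    unfolding rra rbsra E by (simp add: sc tt tt')
  finally show ?thesis unfolding E_def .
qed

text \<open>The mirror image of \<open>hecke_left_step\<close>. Expanding \<open>e n * a\<close>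
  leaves a combination of \<open>a\<close>, \<open>a * r\<close> and
  \<open>a * (r * (s * b))\<close>. Right multiplication by \<open>r\<close> multiplies the last
  term by \<open>- e t'\<close>, by the braid relation and because \<open>a\<close> absorbs
  \<open>s\<close>; the quadratic relation does the same for the combination of the other
  two.\<close>

lemma hecke_right_step:
  assumes tt: "t * t' = 1" and br: "b * r = r * b" and ab: "a * b = a" and aa: "a * a = a"
    and Na: "e n * a = e p * b - e n' * (b * s * b)"
    and as: "e n' * (a * s) = - (e t' * (e n' * a))"
    and braid: "r * s * r = s * r * s" and quad: "r * r = 1 + e (t - t') * r"
  shows "a * (e (t * p) - e n * r) * a * r = - (e t' * (a * (e (t * p) - e n * r) * a))"
proof -
  have arb: "a * (r * (b * x)) = a * (r * x)" for x by (metis br ab mult.assoc)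
  have arb': "a * (r * b) = a * r" by (metis br ab mult.assoc)
  have "scale n (a * (r * a)) = a * (r * (e n * a))" by (simp add: sc)
  also have "\<dots> = scale p (a * r) - scale n' (a * (r * (s * b)))"
    unfolding Na by (simp add: sc arb arb')
  finally have ara: "scale n (a * (r * a)) = scale p (a * r) - scale n' (a * (r * (s * b)))" .
  have "scale n' (a * (r * (s * (b * r)))) = (e n' * a) * (r * s * r) * b"
    by (simp add: sc br)
  also have "\<dots> = (e n' * (a * s)) * (r * (s * b))" unfolding braid by (simp add: sc)
  also have "\<dots> = - scale (t' * n') (a * (r * (s * b)))"
    unfolding as by (simp add: sc)
  finally have rbsra: "scale n' (a * (r * (s * (b * r)))) = - scale (t' * n') (a * (r * (s * b)))" .
  have rra: "a * (r * r) = a + scale t (a * r) - scale t' (a * r)"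
    unfolding quad by (simp add: sc)
  define E where "E = a * (e (t * p) - e n * r) * a"
  have "E = scale (t * p) (a * a) - scale n (a * (r * a))"
    by (simp add: E_def sc)
  then have E: "E = scale (t * p) a - scale p (a * r) + scale n' (a * (r * (s * b)))"
    by (simp add: ara aa)
  have tt': "t * (t' * c) = c" for c using tt by (simp add: mult.assoc[symmetric])
  have "E * r = scale (t * p) (a * r) - scale p (a * (r * r)) + scale n' (a * (r * (s * (b * r))))"
    unfolding E by (simp add: sc)
  also have "\<dots> = - (e t' * E)"
    unfolding rra rbsra E by (simp add: sc tt tt')
  finally show ?thesis unfolding E_def .
qed

text \<open>Besides commutation, where \<open>g\<close> is \<open>f\<close>, this covers ordered
  products of the R_i that raise the index of the generators by one.\<close>

lemma asym_intertwine:
  assumes "\<And>i. Suc i < m \<Longrightarrow> x * f i = g i * x"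
  shows "x * asym e q f m = asym e q g m * x"
  using assms
proof (induction m rule: induct_nat_012)
  case (ge2 m)
  let ?A = "asym e q f (Suc m)" and ?B = "asym e q g (Suc m)"
  have A: "x * ?A = ?B * x" using ge2 by simp
  have f: "x * f m = g m * x" using ge2.prems by simp
  have M: "x * (e c - e d * f m) = (e c - e d * g m) * x" for c d
    by (simp add: sc f)
  have "x * (?A * (e c - e d * f m) * ?A) = (?B * (e c - e d * g m) * ?B) * x" for c d
    by (metis A M mult.assoc)
  then show ?case by (simp add: e_scale scale_simps)
qed simp_all

lemmas asym_commute = asym_intertwine[where g = f and f = f for f]

end

locale hecke_rep = field_embedding e + generic_q q
  for e :: "'k::field \<Rightarrow> 'a::ring_1" and q :: 'k +
  fixes f :: "nat \<Rightarrow> 'a"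
  assumes braid: "f i * f (Suc i) * f i = f (Suc i) * f i * f (Suc i)"
    and far: "Suc i < j \<Longrightarrow> f i * f j = f j * f i"
    and quad: "f i * f i = 1 + e (q - inverse q) * f i"
begin

abbreviation "A \<equiv> asym e q f"

lemma scale_qnum_cancel: "m \<ge> 1 \<Longrightarrow> scale (1 / qnum q m) (scale (qnum q m) x) = x"
  using qnum_nz[of m] by (simp add: scale_simps)

lemma eigen_right:
  assumes "X * r = - (e (inverse q) * X)"
  shows "X * (e (q ^ m) - e (qnum q m) * r) = scale (qnum q (Suc m)) X"
  using assms by (simp add: right_diff_distrib e_scale scale_simps qnum_Suc mult.commute)

lemma eigen_left:
  assumes "r * X = - (e (inverse q) * X)"
  shows "(e (q ^ m) - e (qnum q m) * r) * X = scale (qnum q (Suc m)) X"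
  using assms by (simp add: left_diff_distrib mult.assoc e_scale scale_simps qnum_Suc mult.commute)

text \<open>Each middle factor of the recursion acts on X as a q-number that its normalization
  cancels. Applied to an antisymmetrizer in place of X this gives idempotence.\<close>

lemma absorb_right:
  assumes "\<And>i. Suc i < m \<Longrightarrow> X * f i = - (e (inverse q) * X)"
  shows "X * A m = X"
  using assms
proof (induction m rule: induct_nat_012)
  case (ge2 m)
  have X: "X * A (Suc m) = X" using ge2 by simp
  have "X * (A (Suc m) * (e (q ^ Suc m) - e (qnum q (Suc m)) * f m) * A (Suc m))
    = (X * A (Suc m)) * (e (q ^ Suc m) - e (qnum q (Suc m)) * f m) * A (Suc m)"
    by (simp only: mult.assoc)
  also have "\<dots> = scale (qnum q (Suc (Suc m))) X"
    unfolding X using ge2.prems by (subst eigen_right) (simp_all add: X scale_simps(2))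
  finally show ?case
    by (simp add: e_scale(1) scale_simps(1) scale_qnum_cancel del: power_Suc scale_simps(3))
qed simp_all

lemma absorb_left:
  assumes "\<And>i. Suc i < m \<Longrightarrow> f i * X = - (e (inverse q) * X)"
  shows "A m * X = X"
  using assms
proof (induction m rule: induct_nat_012)
  case (ge2 m)
  have X: "A (Suc m) * X = X" using ge2 by simp
  have "(A (Suc m) * (e (q ^ Suc m) - e (qnum q (Suc m)) * f m) * A (Suc m)) * X
    = A (Suc m) * ((e (q ^ Suc m) - e (qnum q (Suc m)) * f m) * X)"
    by (simp only: mult.assoc X)
  also have "\<dots> = scale (qnum q (Suc (Suc m))) X"
    using ge2.prems by (subst eigen_left) (simp_all add: X scale_simps(1))
  finally show ?case
    by (simp add: e_scale(1) scale_simps(2) scale_qnum_cancel del: power_Suc)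
qed simp_all

text \<open>The older generators meet an outer factor \<open>?a\<close>, where the induction
  hypothesis applies. The newest one is the case of the two Hecke steps, with the preceding
  generator as \<open>s\<close> and the antisymmetrizer of one copy fewer as
  \<open>b\<close>.\<close>

lemma asym_eigen:
  "Suc i < m \<Longrightarrow> f i * A m = - (e (inverse q) * A m) \<and> A m * f i = - (e (inverse q) * A m)"
proof (induction m arbitrary: i rule: induct_nat_012)
  case (ge2 m)
  let ?a = "A (Suc m)"
  define E where "E = ?a * (e (q * q ^ m) - e (qnum q (Suc m)) * f m) * ?a"
  have A: "A (Suc (Suc m)) = e (1 / qnum q (Suc (Suc m))) * E"
    by (simp add: E_def)
  have "f i * E = - (e (inverse q) * E) \<and> E * f i = - (e (inverse q) * E)"
  proof (cases "i < m")
    case True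
    then have ai: "f i * ?a = - (e (inverse q) * ?a)" "?a * f i = - (e (inverse q) * ?a)"
      using ge2.IH(2) by auto
    have "f i * E = (f i * ?a) * (e (q * q ^ m) - e (qnum q (Suc m)) * f m) * ?a"
      "E * f i = ?a * (e (q * q ^ m) - e (qnum q (Suc m)) * f m) * (?a * f i)"
      by (simp_all only: E_def mult.assoc)
    then show ?thesis unfolding ai E_def by (simp add: mult.assoc e_scale(1) scale_simps(1,2))
  next
    case False
    then have i: "i = m" using ge2.prems by simp
    have qq: "q * inverse q = 1" using q_nz by simp
    have aa: "?a * ?a = ?a" using absorb_right ge2.IH(2) by simp
    show ?thesis
    proof (cases m)
      case 0
      have *: "f 0 * E = - (e (inverse q) * E)" unfolding E_def i 0
        by (rule hecke_left_step[where b = 1 and n' = 0 and s = 0]) (simp_all add: qnum_1 quad q_nz)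
      have "E * f 0 = - (e (inverse q) * E)" unfolding E_def i 0
        by (rule hecke_right_step[where b = 1 and n' = 0 and s = 0]) (simp_all add: qnum_1 quad
          q_nz)
      then show ?thesis using * i 0 by simp
    next
      case (Suc l)
      have br: "A m * f m = f m * A m"
        by (rule asym_commute[symmetric]) (rule far[symmetric])
      have sa: "f l * ?a = - (e (inverse q) * ?a)" "?a * f l = - (e (inverse q) * ?a)"
        using ge2.IH(2)[of l] Suc by simp_all
      have ba: "A m * ?a = ?a" "?a * A m = ?a"
        using absorb_left[of m ?a] absorb_right[of m ?a] ge2.IH(2) by simp_all
      have bb: "A m * A m = A m" using absorb_right ge2.IH(1) by simp
      have "e (qnum q (Suc m)) * ?a = A m * (e (q ^ m) - e (qnum q m) * f l) * A m"
        unfolding Suc using scale_qnum_cancel[of "Suc (Suc l)"]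
        by (simp add: e_scale(1)) (simp add: scale_simps(3) qnum_nz)
      also have "\<dots> = e (q ^ m) * A m - e (qnum q m) * (A m * f l * A m)"
        by (simp add: sc bb)
      finally have Na: "e (qnum q (Suc m)) * ?a
        = e (q ^ m) * A m - e (qnum q m) * (A m * f l * A m)" .
      have br': "f m * f l * f m = f l * f m * f l" using braid[of l] Suc by simp
      have "f m * E = - (e (inverse q) * E)" unfolding E_def
        by (rule hecke_left_step[OF qq br ba(1) aa Na _ br' quad]) (simp add: sa sc)
      moreover have "E * f m = - (e (inverse q) * E)" unfolding E_def
        by (rule hecke_right_step[OF qq br ba(2) aa Na _ br' quad]) (simp add: sa sc)
      ultimately show ?thesis by (simp add: i)
    qed
  qed
  then show ?case unfolding A by (simp add: e_scale(1) scale_simps(1,2,3,6) mult.commute)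
qed simp_all

lemma asym_idem: "A m * A m = A m"
  by (rule absorb_right) (simp add: asym_eigen)

lemma hecke_rep_Suc: "hecke_rep e q (\<lambda>i. f (Suc i))"
proof unfold_locales
  show "f (Suc i) * f (Suc j) = f (Suc j) * f (Suc i)" if "Suc i < j" for i j
    by (rule far) (use that in simp)
qed (simp_all add: braid quad)

end

text \<open>The same antisymmetrizer, built up from the last copies instead of the first ones: both are
  characterized by \<open>R\<^sub>i A = A R\<^sub>i = - q\<^sup>-\<^sup>1 A\<close>.\<close>

lemma asym_Suc_shift:
  assumes "hecke_rep e q f" "m \<ge> 1"
  shows "asym e q f (Suc m) = e (1 / qnum q (Suc m)) *
    (asym e q (\<lambda>i. f (Suc i)) m * (e (q ^ m) - e (qnum q m) * f 0) * asym e q (\<lambda>i. f (Suc i)) m)"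
  using assms(2,1)
proof (induction m arbitrary: f rule: dec_induct)
  case base
  then show ?case by simp
next
  case (step m)
  interpret f: hecke_rep e q f by fact
  interpret g: hecke_rep e q "\<lambda>i. f (Suc i)" by (rule f.hecke_rep_Suc)
  interpret h: hecke_rep e q "\<lambda>i. f (Suc (Suc i))" by (rule g.hecke_rep_Suc)
  obtain l where m: "m = Suc l" using step.hyps by (cases m) auto
  let ?a = "g.A (Suc m)"
  define E where "E = ?a * (e (q * q ^ m) - e (qnum q (Suc m)) * f 0) * ?a"
  define B where "B = e (1 / qnum q (Suc (Suc m))) * E"
  have br: "h.A m * f 0 = f 0 * h.A m"
    by (rule f.asym_commute[symmetric]) (rule f.far, simp)
  have eig: "f (Suc 0) * ?a = - (e (inverse q) * ?a)" "?a * f (Suc 0) = - (e (inverse q) * ?a)"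
    using g.asym_eigen[of 0 "Suc m"] m by simp_all
  have ba: "h.A m * ?a = ?a" "?a * h.A m = ?a"
    using h.absorb_left[of m ?a] h.absorb_right[of m ?a] g.asym_eigen by simp_all
  have Na: "e (qnum q (Suc m)) * ?a = e (q ^ m) * h.A m - e (qnum q m) * (h.A m * f (Suc 0) * h.A m)"
  proof -
    have "?a = e (1 / qnum q (Suc m)) * (h.A m * (e (q ^ m) - e (qnum q m) * f (Suc 0)) * h.A m)"
      using step.IH[OF f.hecke_rep_Suc] by simp
    then have "e (qnum q (Suc m)) * ?a = h.A m * (e (q ^ m) - e (qnum q m) * f (Suc 0)) * h.A m"
      using f.scale_qnum_cancel[of "Suc m"] f.qnum_nz[of "Suc m"]
      by (simp only: f.e_scale(1) f.scale_simps(3)) (simp add: f.scale_simps(8))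
    then show ?thesis by (simp add: f.sc h.asym_idem)
  qed
  have qq: "q * inverse q = 1" using f.q_nz by simp
  have L: "f 0 * E = - (e (inverse q) * E)" unfolding E_def
    by (rule f.hecke_left_step[OF qq br ba(1) g.asym_idem Na _ f.braid f.quad])
      (simp add: eig f.sc)
  have R: "E * f 0 = - (e (inverse q) * E)" unfolding E_def
    by (rule f.hecke_right_step[OF qq br ba(2) g.asym_idem Na _ f.braid f.quad])
      (simp add: eig f.sc)
  have Bi: "f i * B = - (e (inverse q) * B) \<and> B * f i = - (e (inverse q) * B)" if "Suc i < Suc (Suc m)" for i
  proof -
    have "f i * E = - (e (inverse q) * E) \<and> E * f i = - (e (inverse q) * E)"
    proof (cases i)
      case (Suc j)
      then have ai: "f i * ?a = - (e (inverse q) * ?a)" "?a * f i = - (e (inverse q) * ?a)"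
        using g.asym_eigen[of j "Suc m"] that by auto
      have "f i * E = (f i * ?a) * (e (q * q ^ m) - e (qnum q (Suc m)) * f 0) * ?a"
        "E * f i = ?a * (e (q * q ^ m) - e (qnum q (Suc m)) * f 0) * (?a * f i)"
        by (simp_all only: E_def mult.assoc)
      then show ?thesis unfolding ai E_def by (simp add: mult.assoc f.e_scale(1) f.scale_simps(1,2))
    qed (use L R in simp)
    then show ?thesis unfolding B_def
      by (simp add: f.e_scale(1) f.scale_simps(1,2,3,6) mult.commute)
  qed
  let ?X = "f.A (Suc (Suc m))"
  have "?X * B = B" by (rule f.absorb_left) (simp add: Bi)
  moreover have "?X * B = ?X"
  proof -
    have Xa: "?X * ?a = ?X" by (rule g.absorb_right) (simp add: f.asym_eigen del: asym.simps)
    have "?X * E = (?X * ?a) * (e (q ^ Suc m) - e (qnum q (Suc m)) * f 0) * ?a"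
      by (simp only: E_def mult.assoc power_Suc)
    also have "\<dots> = f.scale (qnum q (Suc (Suc m))) ?X"
      unfolding Xa using f.asym_eigen[of 0 "Suc (Suc m)"]
      by (subst f.eigen_right) (simp_all add: Xa f.scale_simps(2) del: asym.simps)
    finally show ?thesis
      by (simp add: B_def f.e_scale(1) f.scale_simps(1) f.scale_qnum_cancel del: asym.simps)
  qed
  ultimately show ?case by (simp add: B_def E_def del: asym.simps)
qed


section \<open>Tensor operators with coefficients in an algebra\<close>

primrec chain :: "(nat \<Rightarrow> 'a::monoid_mult) \<Rightarrow> nat \<Rightarrow> nat \<Rightarrow> 'a" where
  "chain g a 0 = 1"
| "chain g a (Suc n) = chain g a n * g (a + n)"

primrec rchain :: "(nat \<Rightarrow> 'a::monoid_mult) \<Rightarrow> nat \<Rightarrow> nat \<Rightarrow> 'a" where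
  "rchain g a 0 = 1"
| "rchain g a (Suc n) = g (a + n) * rchain g a n"

lemma chain_Suc': "chain g a (Suc n) = g a * chain g (Suc a) n"
  by (induction n) (simp_all add: mult.assoc)

lemma rchain_Suc': "rchain g a (Suc n) = rchain g (Suc a) n * g a"
  by (induction n) (simp_all add: mult.assoc)

lemma chain_add: "chain g a (m + n) = chain g a m * chain g (a + m) n"
  by (induction n) (simp_all add: mult.assoc add.assoc)

lemma chain_commute:
  "(\<And>i. a \<le> i \<Longrightarrow> i < a + n \<Longrightarrow> x * g i = g i * x) \<Longrightarrow> x * chain g a n = chain g a n * x"
proof (induction n)
  case (Suc n)
  have "x * chain g a n = chain g a n * x" "x * g (a + n) = g (a + n) * x"
    using Suc by simp_all
  then show ?case by (simp add: mult.assoc[symmetric]) (simp add: mult.assoc)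
qed simp

lemma chain_inverse:
  assumes "\<And>i. g i * g' i = 1" "\<And>i. g' i * g i = 1"
  shows "chain g a n * rchain g' a n = 1" "rchain g' a n * chain g a n = 1"
proof -
  show "chain g a n * rchain g' a n = 1"
  proof (induction n)
    case (Suc n)
    have "chain g a (Suc n) * rchain g' a (Suc n)
      = chain g a n * (g (a + n) * g' (a + n)) * rchain g' a n"
      by (simp add: mult.assoc)
    then show ?case by (simp add: assms Suc)
  qed simp
  show "rchain g' a n * chain g a n = 1"
  proof (induction n)
    case (Suc n)
    have "rchain g' a (Suc n) * chain g a (Suc n)
      = g' (a + n) * (rchain g' a n * chain g a n) * g (a + n)"
      by (simp add: mult.assoc)
    then show ?case by (simp add: assms Suc)
  qed simp
qed

lemma triv_chain:
  "(\<And>i. a \<le> i \<Longrightarrow> i < a + n \<Longrightarrow> triv m (g i)) \<Longrightarrow> triv m (chain g a n)"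
  for g :: "nat \<Rightarrow> ('n, 'a::ring_1) oper"
  by (induction n) (simp_all add: triv_times)

lemma triv_rchain:
  "(\<And>i. a \<le> i \<Longrightarrow> i < a + n \<Longrightarrow> triv m (g i)) \<Longrightarrow> triv m (rchain g a n)"
  for g :: "nat \<Rightarrow> ('n, 'a::ring_1) oper"
  by (induction n) (simp_all add: triv_times)

text \<open>The last assumption is the Hecke condition in the form R - R^(-1) = q - q^(-1).\<close>

locale tensor_setting = skew_invertible R R' D + generic_q q + field_embedding e
  for R R' :: "'k::field^('n::finite \<times> 'n)^('n \<times> 'n)" and D :: "'k^'n^'n" and q :: 'k
    and e :: "'k \<Rightarrow> 'a::ring_1" +
  assumes R': "R' = R - mat (q - inverse q)"
begin

abbreviation lift :: "('n, 'k) oper \<Rightarrow> ('n, 'a) oper" where "lift \<equiv> map_oper e"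

lemma lift_times: "lift (X * Y) = lift X * lift Y"
  by (rule map_oper_times) (simp_all add: e_add e_mult)

lemma lift_add: "lift (X + Y) = lift X + lift Y"
  by (rule map_oper_add) (rule e_add)

lemma lift_1: "lift 1 = 1"
  using map_oper_scalar[of e "1 :: 'k"] by simp

lemma lift_scalar: "lift (scalar c) = scalar (e c)"
  by (rule map_oper_scalar) simp

lemma lift_diff: "lift (X - Y) = lift X - lift Y"
  using lift_add[of "X - Y" Y] by simp

abbreviation sc :: "'k \<Rightarrow> ('n, 'a) oper" where "sc c \<equiv> scalar (e c)"

definition rr :: "nat \<Rightarrow> ('n, 'a) oper" where "rr i = on2 i (map_matrix e R)"
definition rr' :: "nat \<Rightarrow> ('n, 'a) oper" where "rr' i = on2 i (map_matrix e R')"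
definition dd :: "nat \<Rightarrow> ('n, 'a) oper" where "dd i = on1 i (map_matrix e D)"

lemma lift_on: "lift (on2 i R) = rr i" "lift (on2 i R') = rr' i" "lift (on1 i D) = dd i"
  by (simp_all add: rr_def rr'_def dd_def map_oper_on1 map_oper_on2)

lemma central_map: "central (map_matrix e M $ a $ b)"
  by (simp add: map_matrix_def)

lemma rr_inv: "rr i * rr' i = 1" "rr' i * rr i = 1"
  by (simp_all flip: lift_on lift_times add: inv_oper lift_1)

lemma on2_braid: "on2 i R * on2 (Suc i) R * on2 i R = on2 (Suc i) R * on2 i R * on2 (Suc i) R"
proof (induction i)
  case 0
  then show ?case using braid by simp
next
  case (Suc i)
  show ?case using arg_cong[OF Suc, of shift] by (simp only: shift_times shift_on2)
qed

lemma rr_braid: "rr i * rr (Suc i) * rr i = rr (Suc i) * rr i * rr (Suc i)"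
  by (simp flip: lift_on lift_times add: on2_braid)

lemma triv_rr [simp]: "m \<noteq> i \<Longrightarrow> m \<noteq> Suc i \<Longrightarrow> triv m (rr i)" "m \<noteq> i \<Longrightarrow> m \<noteq> Suc i \<Longrightarrow> triv m (rr' i)"
  by (simp_all add: rr_def rr'_def)

lemma triv_dd [simp]: "m \<noteq> i \<Longrightarrow> triv m (dd i)"
  by (simp add: dd_def)

lemma rr_commute: "triv i X \<Longrightarrow> triv (Suc i) X \<Longrightarrow> rr i * X = X * rr i"
  unfolding rr_def by (rule on2_commute) (simp_all add: central_map)

lemma rr'_commute: "triv i X \<Longrightarrow> triv (Suc i) X \<Longrightarrow> rr' i * X = X * rr' i"
  unfolding rr'_def by (rule on2_commute) (simp_all add: central_map)

lemma dd_commute: "triv i X \<Longrightarrow> dd i * X = X * dd i"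
  unfolding dd_def by (rule on1_commute) (simp_all add: central_map)

lemma rr_far: "Suc i < j \<Longrightarrow> rr i * rr j = rr j * rr i"
  by (rule rr_commute) simp_all

lemma rr'_eq: "rr' i = rr i - sc (q - inverse q)"
proof -
  have "on2 i R' = on2 i R - scalar (q - inverse q)"
    by (subst R') (simp only: on2_diff on2_mat)
  then show ?thesis unfolding lift_on[symmetric] by (simp only: lift_diff lift_scalar)
qed

lemma rr_quad: "rr i * rr i = 1 + sc (q - inverse q) * rr i"
proof -
  have "(rr i - sc (q - inverse q)) * rr i = 1"
    using rr_inv(2)[of i] by (simp only: rr'_eq)
  then show ?thesis by (simp add: left_diff_distrib algebra_simps)
qed

text \<open>Numbers remain central in the ring of operators, in contrast to general
  coefficients.\<close>

sublocale op: field_embedding sc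
proof
  show "sc c * x = x * sc c" for c and x :: "('n, 'a) oper"
    by (rule oper_eqI) (simp add: e_central)
qed (simp_all add: e_add e_mult scalar_add scalar_mult)

sublocale hecke: hecke_rep sc q rr
  by unfold_locales (fact rr_braid rr_far rr_quad)+

lemma hecke_shift: "hecke_rep sc q (\<lambda>i. rr (a + i))"
proof (induction a)
  case 0
  then show ?case using hecke.hecke_rep_axioms by simp
next
  case (Suc a)
  then show ?case using hecke_rep.hecke_rep_Suc[OF Suc] by simp
qed

text \<open>The antisymmetrizer on the copies \<open>a\<close>, ...,
  \<open>a + m - 1\<close>.\<close>

definition antisym :: "nat \<Rightarrow> nat \<Rightarrow> ('n, 'a) oper" where
  "antisym a m = asym sc q (\<lambda>i. rr (a + i)) m"

lemma antisym_commute: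
  assumes "\<And>i. a \<le> i \<Longrightarrow> Suc i < a + m \<Longrightarrow> x * rr i = rr i * x"
  shows "x * antisym a m = antisym a m * x"
  unfolding antisym_def by (rule op.asym_commute) (use assms in simp)

lemma antisym_0 [simp]: "antisym a 0 = 1" and antisym_1 [simp]: "antisym a (Suc 0) = 1"
  by (simp_all add: antisym_def)

lemma antisym_idem: "antisym a m * antisym a m = antisym a m"
  unfolding antisym_def by (rule hecke_rep.asym_idem[OF hecke_shift])

text \<open>The recursion that splits off the first copy instead of the last. With the denominator
  cleared it includes \<open>m = 0\<close>, where the term with R carries the factor 0_q =
  0.\<close>

lemma antisym_Suc: "sc (qnum q (Suc m)) * antisym a (Suc m) =
  antisym (Suc a) m * (sc (q ^ m) - sc (qnum q m) * rr a) * antisym (Suc a) m"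
proof (cases "m = 0")
  case True
  then show ?thesis by (simp add: qnum_1 qnum_0)
next
  case False
  then show ?thesis
    using asym_Suc_shift[OF hecke_shift[of a], of m] qnum_nz[of "Suc m"]
    by (simp add: antisym_def mult.assoc[symmetric] op.e_mult[symmetric] del: asym.simps)
qed

lemma shift_rr: "shift (rr i) = rr (Suc i)" "shift (dd i) = dd (Suc i)"
  by (simp_all add: rr_def dd_def shift_on1 shift_on2)

lemma shift_asym: "shift (asym sc q f m) = asym sc q (\<lambda>i. shift (f i)) m"
  by (induction m rule: induct_nat_012)
    (simp_all add: shift_times shift_diff shift_scalar)

lemma shift_antisym: "shift (antisym a m) = antisym (Suc a) m"
  by (simp add: antisym_def shift_asym shift_rr)

lemma triv_asym: "(\<And>i. Suc i < m \<Longrightarrow> triv l (f i)) \<Longrightarrow> triv l (asym sc q f m)"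
  by (induction m rule: induct_nat_012) (simp_all add: triv_times triv_diff)

lemma triv_antisym: "l < a \<or> a + m \<le> l \<Longrightarrow> triv l (antisym a m)"
  unfolding antisym_def by (rule triv_asym) auto


subsection \<open>q-traces\<close>

definition qtr :: "nat \<Rightarrow> ('n, 'a) oper \<Rightarrow> ('n, 'a) oper" where
  "qtr i X = ptrace i (dd i * X)"

primrec qtrs :: "nat \<Rightarrow> nat \<Rightarrow> ('n, 'a) oper \<Rightarrow> ('n, 'a) oper" where
  "qtrs a 0 X = X"
| "qtrs a (Suc m) X = qtrs a m (qtr (a + m) X)"

lemma rr_dd: "rr i * (dd i * dd (Suc i)) = dd i * dd (Suc i) * rr i"
  by (simp flip: lift_on lift_times add: R_DD)

lemma qtr_triv_times: "triv i A \<Longrightarrow> qtr i (A * X) = A * qtr i X"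
  unfolding qtr_def by (subst ptrace_triv_times[symmetric]) (simp_all add: dd_commute flip:
    mult.assoc)

lemma qtr_times_triv: "triv i A \<Longrightarrow> qtr i (X * A) = qtr i X * A"
  unfolding qtr_def by (simp add: ptrace_times_triv flip: mult.assoc)

lemma qtr_diff: "qtr i (X - Y) = qtr i X - qtr i Y"
  by (simp add: qtr_def right_diff_distrib ptrace_diff)

lemma triv_qtr: "triv i (qtr i X)"
  by (simp add: qtr_def triv_ptrace)

lemma triv_qtr_other: "triv j X \<Longrightarrow> triv j (qtr i X)"
  by (cases "i = j") (simp_all add: triv_qtr, simp add: qtr_def triv_ptrace_other triv_times)

text \<open>R passes D_i D_(i+1) and then goes round the ordinary traces over both copies.\<close>

lemma qtr_cyclic: "qtr i (qtr (Suc i) (rr i * X)) = qtr i (qtr (Suc i) (X * rr i))"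
proof -
  have qq: "qtr i (qtr (Suc i) Y) = ptrace i (ptrace (Suc i) (dd i * dd (Suc i) * Y))" for Y
    by (simp add: qtr_def ptrace_triv_times[symmetric] mult.assoc)
  have "qtr i (qtr (Suc i) (rr i * X)) = ptrace i (ptrace (Suc i) (rr i * (dd i * dd (Suc i) * X)))"
    unfolding qq using rr_dd[of i] by (simp flip: mult.assoc)
  also have "\<dots> = qtr i (qtr (Suc i) (X * rr i))"
    unfolding qq rr_def by (subst ptrace_cyclic2) (simp_all add: central_map mult.assoc)
  finally show ?thesis .
qed

lemma qtr_rr: "qtr (Suc i) (rr i) = 1"
proof -
  have "lift (ptrace (Suc i) (on2 i R * on1 (Suc i) D)) = ptrace (Suc i) (rr i * dd (Suc i))"
    by (simp add: map_oper_ptrace e_add lift_times lift_on)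
  then have "ptrace (Suc i) (rr i * dd (Suc i)) = 1"
    by (simp add: ptrace_on2_on1 D(1) on1_mat lift_1)
  then show ?thesis unfolding qtr_def dd_def by (subst ptrace_cyclic) (simp_all add: central_map)
qed

lemma conj_trace_entry_lift:
  "(\<Sum>b\<in>UNIV. \<Sum>c\<in>UNIV. \<Sum>d\<in>UNIV. map_matrix e R' $ (i, b) $ (m, c)
      * (map_matrix e D $ c $ d * map_matrix e R $ (m', d) $ (j, b)))
    = (if m = m' then map_matrix e D $ i $ j else 0)"
  "(\<Sum>b\<in>UNIV. \<Sum>c\<in>UNIV. \<Sum>d\<in>UNIV. map_matrix e R $ (i, b) $ (m, c)
      * (map_matrix e D $ c $ d * map_matrix e R' $ (m', d) $ (j, b)))
    = (if m = m' then map_matrix e D $ i $ j else 0)"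
  using arg_cong[OF conj_trace_entry(1)[of i m m' j], of e]
    arg_cong[OF conj_trace_entry(2)[of i m m' j], of e]
  by (simp_all add: e_sum e_mult map_matrix_def if_distrib[of e])

lemma qtr_conj:
  assumes "triv (Suc i) X"
  shows "qtr (Suc i) (rr i * X * rr' i) = qtr i X" "qtr (Suc i) (rr' i * X * rr i) = qtr i X"
  unfolding qtr_def rr_def rr'_def dd_def
  by (rule qtrace_conj[OF assms]; fact central_map conj_trace_entry_lift)+

lemma qtrs_add: "qtrs a (l + m) X = qtrs a l (qtrs (a + l) m X)"
  by (induction m arbitrary: X) (simp_all add: add.assoc)

lemma qtrs_Suc': "qtrs a (Suc m) X = qtr a (qtrs (Suc a) m X)"
  using qtrs_add[of a 1 m X] by simp

lemma qtrs_triv_times: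
  "(\<And>i. a \<le> i \<Longrightarrow> i < a + m \<Longrightarrow> triv i A) \<Longrightarrow> qtrs a m (A * X) = A * qtrs a m X"
  by (induction m arbitrary: X) (simp_all add: qtr_triv_times)

lemma qtrs_times_triv:
  "(\<And>i. a \<le> i \<Longrightarrow> i < a + m \<Longrightarrow> triv i A) \<Longrightarrow> qtrs a m (X * A) = qtrs a m X * A"
  by (induction m arbitrary: X) (simp_all add: qtr_times_triv)

lemma qtrs_scalar: "qtrs a m (scalar u * X) = scalar u * qtrs a m X"
  by (rule qtrs_triv_times) simp

lemma qtrs_diff: "qtrs a m (X - Y) = qtrs a m X - qtrs a m Y"
  by (induction m arbitrary: X Y) (simp_all add: qtr_diff)

lemma shift_qtrs: "shift (qtrs a m X) = qtrs (Suc a) m (shift X)"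
  by (induction m arbitrary: X) (simp_all add: qtr_def shift_ptrace shift_times shift_rr)

lemma qtrs_eq_ptraces: "qtrs a m X = ptraces a m (chain dd a m * X)"
proof (induction m arbitrary: X)
  case (Suc m)
  have "chain dd a m * ptrace (a + m) (dd (a + m) * X)
    = ptrace (a + m) (chain dd a m * (dd (a + m) * X))"
    by (rule ptrace_triv_times[symmetric]) (auto intro!: triv_chain)
  then show ?case by (simp add: Suc qtr_def mult.assoc)
qed simp

lemma qtrs_cyclic_rr:
  "a \<le> i \<Longrightarrow> Suc i < a + m \<Longrightarrow> qtrs a m (rr i * X) = qtrs a m (X * rr i)"
proof (induction m arbitrary: X)
  case (Suc m)
  show ?case
  proof (cases "Suc i < a + m")
    case True
    then show ?thesis using Suc by (simp add: qtr_triv_times qtr_times_triv)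
  next
    case False
    define m' where "m' = i - a"
    then have m: "m = Suc m'" "i = a + m'" using Suc.prems False by auto
    then show ?thesis using qtr_cyclic[of i X] by simp
  qed
qed simp

definition cyclic :: "nat \<Rightarrow> nat \<Rightarrow> ('n, 'a) oper \<Rightarrow> bool" where
  "cyclic a m A \<longleftrightarrow> (\<forall>X. qtrs a m (A * X) = qtrs a m (X * A))"

lemma cyclic_times: "cyclic a m A \<Longrightarrow> cyclic a m B \<Longrightarrow> cyclic a m (A * B)"
  unfolding cyclic_def by (metis mult.assoc)

lemma cyclic_diff: "cyclic a m A \<Longrightarrow> cyclic a m B \<Longrightarrow> cyclic a m (A - B)"
  unfolding cyclic_def by (simp add: left_diff_distrib right_diff_distrib qtrs_diff)

lemma cyclic_sc: "cyclic a m (sc c)"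
  unfolding cyclic_def by (simp add: op.e_central)

text \<open>Operators that go round the q-trace are closed under products, differences and numerical
  factors, and antisymmetrizers are built from the R_i by these.\<close>

lemma cyclic_antisym:
  assumes "a \<le> b" "b + l \<le> a + m"
  shows "cyclic a m (antisym b l)"
proof -
  have *: "cyclic a m (asym sc q f l)" if "\<And>i. Suc i < l \<Longrightarrow> cyclic a m (f i)" for f
    using that
  proof (induction l rule: induct_nat_012)
    case 0
    then show ?case by (simp add: cyclic_def)
  next
    case 1
    then show ?case by (simp add: cyclic_def)
  next
    case (ge2 l)
    then show ?case unfolding asym.simps
      by (intro cyclic_times cyclic_diff cyclic_sc) simp_all
  qed
  show ?thesis unfolding antisym_def
    by (rule *) (use assms in \<open>auto simp: cyclic_def intro: qtrs_cyclic_rr\<close>)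
qed

end

lemma intertwine_times: "a * x = x * c \<Longrightarrow> b * x = x * d \<Longrightarrow> a * b * x = x * (c * d)"
  for a :: "'a::semigroup_mult"
  by (metis mult.assoc)

lemma commute_times: "x * a = a * x \<Longrightarrow> x * b = b * x \<Longrightarrow> x * (a * b) = a * b * x"
  for a :: "'a::semigroup_mult"
  by (metis mult.assoc)

lemma swap_assoc: "a * b = c * d \<Longrightarrow> a * (b * x) = c * (d * x)"
  for a :: "'a::semigroup_mult"
  by (metis mult.assoc)

context tensor_setting
begin

section \<open>The Cayley-Hamilton-Newton identities\<close>

text \<open>
  With \<open>G\<^sub>b\<close> the trace of \<open>R\<^sub>0 \<cdots> R\<^sub>b\<^sub>-\<^sub>1\<close> times the antisymmetrizer on the copies \<open>b, \<dots>, k - 1\<close>, times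
  \<open>(k-b)\<^sub>q\<close>, the recursion for the antisymmetrizer that splits off copy \<open>b\<close> turns into
  \<open>G\<^sub>b = q\<^sup>k\<^sup>-\<^sup>b\<^sup>-\<^sup>1 V\<^sub>b - G\<^sub>b\<^sub>+\<^sub>1\<close>, because the remaining antisymmetrizer can be moved cyclically.
\<close>

lemma chn:
  assumes k: "k \<ge> 1" and TT: "\<And>i. Suc i < k \<Longrightarrow> rr i * TT = TT * rr i"
  shows "sc (qnum q k) * qtrs 1 (k - 1) (antisym 0 k * TT)
    = - (\<Sum>j<k. sc ((-1) ^ (k - j)) * (sc (q ^ j) *
        qtrs 1 (k - 1) (chain rr 0 (k - j - 1) * antisym (k - j) j * TT)))"
proof -
  let ?W = "\<lambda>N. qtrs 1 (k - 1) (N * TT)"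
  define V where "V b = ?W (chain rr 0 b * antisym (Suc b) (k - Suc b))" for b
  define G where "G b = sc (qnum q (k - b)) * ?W (chain rr 0 b * antisym b (k - b))" for b
  have rec: "G b = sc (q ^ (k - Suc b)) * V b - G (Suc b)" if "b < k" for b
  proof -
    define m where "m = k - Suc b"
    have m: "k - b = Suc m" "k - Suc b = m" "Suc b + m = k" using that by (auto simp: m_def)
    let ?S = "antisym (Suc b) m"
    have SR: "?S * chain rr 0 b = chain rr 0 b * ?S"
      by (rule chain_commute, rule antisym_commute[symmetric], rule rr_far) simp
    have ST: "TT * ?S = ?S * TT"
      by (rule antisym_commute) (use m in \<open>simp add: TT\<close>)
    \<comment> \<open>All copies of \<open>?S\<close> are traced, copy 0 is not among them, so
      \<open>?S\<close> may go round and return past \<open>TT\<close>.\<close>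
    have cyc: "?W (?S * Y) = ?W (Y * ?S)" for Y
    proof -
      have "cyclic 1 (k - 1) ?S" by (rule cyclic_antisym) (use m in auto)
      then have "?W (?S * Y) = qtrs 1 (k - 1) (Y * TT * ?S)" by (simp add: cyclic_def mult.assoc)
      then show ?thesis by (simp add: mult.assoc ST)
    qed
    have "G b = ?W (chain rr 0 b * (sc (qnum q (Suc m)) * antisym b (Suc m)))"
      unfolding G_def m qtrs_scalar[symmetric] by (simp add: op.e_scale op.scale_simps mult.assoc)
    also have "\<dots> = ?W (?S * (chain rr 0 b * (sc (q ^ m) - sc (qnum q m) * rr b) * ?S))"
      unfolding antisym_Suc using SR by (simp flip: mult.assoc)
    also have "\<dots> = ?W (chain rr 0 b * (sc (q ^ m) - sc (qnum q m) * rr b) * (?S * ?S))"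
      unfolding cyc by (simp only: mult.assoc)
    also have "\<dots> = ?W (sc (q ^ m) * (chain rr 0 b * ?S) - sc (qnum q m) * (chain rr 0 (Suc
      b) * ?S))"
      unfolding antisym_idem
      by (simp add: op.e_scale op.scale_simps right_diff_distrib left_diff_distrib mult.assoc)
    also have "\<dots> = sc (q ^ m) * V b - G (Suc b)"
      by (simp add: left_diff_distrib qtrs_diff mult.assoc qtrs_scalar V_def G_def m)
    finally show ?thesis by (simp add: m)
  qed
  \<comment> \<open>The factor 0_q ends the recursion.\<close>
  have Gk: "G k = 0" by (simp add: G_def qnum_0)
  have sum: "G b = (\<Sum>i<n. sc ((-1) ^ i) * (sc (q ^ (k - Suc (b + i))) * V (b + i)))"
    if "b + n = k" for b n
    using that
  proof (induction n arbitrary: b)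
    case 0
    then show ?case using Gk by simp
  next
    case (Suc n)
    have "G b = sc (q ^ (k - Suc b)) * V b - G (Suc b)" using Suc.prems by (intro rec) simp
    also have "G (Suc b) = (\<Sum>i<n. sc ((-1) ^ i) * (sc (q ^ (k - Suc (Suc b + i))) * V (Suc b + i)))"
      using Suc.prems by (intro Suc.IH) simp
    finally show ?case
      unfolding sum.lessThan_Suc_shift
      by (simp add: sum_negf[symmetric] e_uminus scalar_uminus)
  qed
  have "sc (qnum q k) * qtrs 1 (k - 1) (antisym 0 k * TT) = G 0"
    by (simp add: G_def)
  also have "\<dots> = (\<Sum>i<k. sc ((-1) ^ i) * (sc (q ^ (k - Suc i)) * V i))"
    using sum[of 0 k] by simp
  also have "\<dots> = (\<Sum>j<k. sc ((-1) ^ (k - Suc j)) * (sc (q ^ (k - Suc (k - Suc j))) * V (k - Suc j)))"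
    by (rule sum.nat_diff_reindex[symmetric])
  also have "\<dots> = - (\<Sum>j<k. sc ((-1) ^ (k - j)) * (sc (q ^ j) *
        qtrs 1 (k - 1) (chain rr 0 (k - j - 1) * antisym (k - j) j * TT)))"
    unfolding sum_negf[symmetric]
  proof (rule sum.cong[OF refl])
    fix j assume "j \<in> {..<k}"
    then have j: "k - j = Suc (k - Suc j)" "k - Suc (k - Suc j) = j" by auto
    have "Suc (k - Suc j) = k - j" using j by simp
    then show "sc ((-1) ^ (k - Suc j)) * (sc (q ^ (k - Suc (k - Suc j))) * V (k - Suc j))
      = - (sc ((-1) ^ (k - j)) * (sc (q ^ j) *
        qtrs 1 (k - 1) (chain rr 0 (k - j - 1) * antisym (k - j) j * TT)))"
      unfolding V_def j(2) by (simp add: j(1) e_uminus scalar_uminus)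
  qed
  finally show ?thesis .
qed


subsection \<open>RTT matrices\<close>

definition Tchain :: "'a^'n^'n \<Rightarrow> nat \<Rightarrow> ('n, 'a) oper" where
  "Tchain T k = chain (\<lambda>i. on1 i T) 0 k"

lemma triv_Tchain: "k \<le> l \<Longrightarrow> triv l (Tchain T k)"
  unfolding Tchain_def by (rule triv_chain) simp

lemma Tchain_commute:
  assumes rtt: "rr 0 * (on1 0 T * on1 1 T) = on1 0 T * on1 1 T * rr 0" and "Suc i < k"
  shows "rr i * Tchain T k = Tchain T k * rr i"
proof -
  have r: "rr i * (on1 i T * on1 (Suc i) T) = on1 i T * on1 (Suc i) T * rr i"
  proof (induction i)
    case (Suc i)
    show ?case using arg_cong[OF Suc, of shift] by (simp only: shift_times shift_on1 shift_rr)
  qed (use rtt in simp)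
  define B where "B = chain (\<lambda>i. on1 i T) 0 i"
  obtain l where k: "k = Suc (Suc i) + l" using \<open>Suc i < k\<close> less_iff_Suc_add by auto
  define C where "C = chain (\<lambda>i. on1 i T) (Suc (Suc i)) l"
  have "Tchain T k = B * (on1 i T * on1 (Suc i) T) * C"
    using chain_add[of "\<lambda>i. on1 i T" 0 "Suc (Suc i)" l]
    by (simp add: k Tchain_def B_def C_def mult.assoc)
  moreover have "rr i * B = B * rr i" unfolding B_def by (rule rr_commute; rule triv_chain) auto
  moreover have "rr i * C = C * rr i" unfolding C_def by (rule rr_commute; rule triv_chain) auto
  ultimately show ?thesis using r by (auto intro!: commute_times)
qed

lemma shift_funpow_on1: "(shift ^^ a) (on1 i X) = on1 (a + i) X"
  by (induction a) (simp_all add: shift_on1)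

lemma shift_funpow_times: "(shift ^^ a) (X * Y) = (shift ^^ a) X * (shift ^^ a) Y"
  for X Y :: "('n, 'a) oper"
  by (induction a) (simp_all add: shift_times)

lemma shift_funpow_antisym: "(shift ^^ a) (antisym b m) = antisym (a + b) m"
  by (induction a) (simp_all add: shift_antisym)

lemma shift_funpow_qtrs: "(shift ^^ a) (qtrs b m X) = qtrs (a + b) m ((shift ^^ a) X)"
  by (induction a) (simp_all add: shift_qtrs)

lemma shift_funpow_scalar: "(shift ^^ a) (scalar u) = scalar u"
  by (induction a) (simp_all add: shift_scalar)

lemma shift_funpow_Tchain: "(shift ^^ a) (Tchain T m) = chain (\<lambda>i. on1 i T) a m"
  unfolding Tchain_def
proof (induction m)
  case 0
  then show ?case using shift_funpow_scalar[of a "1 :: 'a"] by simp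
qed (simp add: shift_funpow_times shift_funpow_on1)

text \<open>The factors of T are local: the last \<open>j\<close> of them are a translate of the
  first \<open>j\<close>. The traces over the last copies therefore produce the value of the smaller
  q-trace, as a factor on the right.\<close>

lemma qtrs_split:
  assumes sigma: "qtrs 0 j (antisym 0 j * Tchain T j) = scalar u" and a: "a \<ge> 1"
  shows "qtrs 1 (a + j - 1) (chain rr 0 (a - 1) * antisym a j * Tchain T (a + j))
    = qtrs 1 (a - 1) (chain rr 0 (a - 1) * Tchain T a) * scalar u"
proof -
  have "Tchain T (a + j) = Tchain T a * (shift ^^ a) (Tchain T j)"
    unfolding shift_funpow_Tchain by (simp add: Tchain_def chain_add)
  moreover have "antisym a j * Tchain T a = Tchain T a * antisym a j"
    by (rule antisym_commute[symmetric], rule rr_commute[symmetric]; rule triv_Tchain) simp_all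
  ultimately have "chain rr 0 (a - 1) * antisym a j * Tchain T (a + j)
    = chain rr 0 (a - 1) * Tchain T a * (shift ^^ a) (antisym 0 j * Tchain T j)"
    unfolding shift_funpow_times shift_funpow_antisym
      by (simp add: mult.assoc) (simp flip: mult.assoc)
  moreover have "qtrs a j (chain rr 0 (a - 1) * Tchain T a * (shift ^^ a) (antisym 0
    j * Tchain T j))
    = chain rr 0 (a - 1) * Tchain T a * qtrs (a + 0) j ((shift ^^ a) (antisym 0 j * Tchain T j))"
    by (subst qtrs_triv_times) (use a in \<open>auto intro!: triv_times triv_chain triv_Tchain\<close>)
  moreover have "qtrs (a + 0) j ((shift ^^ a) (antisym 0 j * Tchain T j)) = scalar u"
    by (simp only: shift_funpow_qtrs[symmetric] sigma shift_funpow_scalar)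
  moreover have "qtrs 1 (a + j - 1) X = qtrs 1 (a - 1) (qtrs a j X)" for X
    using qtrs_add[of 1 "a - 1" j X] a by simp
  ultimately show ?thesis by (simp add: qtrs_times_triv)
qed


subsection \<open>RLRL matrices\<close>

text \<open>This is L with barred index \<open>k + 1\<close>. All conjugations are unfolded: R_(k-1)
  ... R_0 stands on the left, so the operator occupies the copies 0, ..., \<open>k\<close>.\<close>

definition Lcopy :: "'a^'n^'n \<Rightarrow> nat \<Rightarrow> ('n, 'a) oper" where
  "Lcopy L k = rchain rr 0 k * on1 0 L * chain rr' 0 k"

definition Lchain :: "'a^'n^'n \<Rightarrow> nat \<Rightarrow> ('n, 'a) oper" where
  "Lchain L k = chain (Lcopy L) 0 k"

lemma Lcopy_Suc: "Lcopy L (Suc k) = rr k * Lcopy L k * rr' k"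
  by (simp add: Lcopy_def mult.assoc)

lemma triv_Lcopy: "k < l \<Longrightarrow> triv l (Lcopy L k)"
  unfolding Lcopy_def by (intro triv_times triv_chain triv_rchain) auto

lemma triv_Lchain: "k \<le> l \<Longrightarrow> triv l (Lchain L k)"
  unfolding Lchain_def by (rule triv_chain) (simp add: triv_Lcopy)

lemma conj_rr: "rr (Suc i) * rr' i * rr' (Suc i) = rr' i * rr' (Suc i) * rr i"
  using conj_of_braid(1)[OF rr_inv(1)[of "Suc i"] rr_inv(2)[of "Suc i"] rr_inv(1)[of i]
    rr_inv(2)[of i]]
    rr_braid[of i] by simp

text \<open>In the critical case \<open>k = Suc i\<close> of the induction step, the braid relation
  turns R_i in front into R_(i+1) next to \<open>Lcopy L i\<close>, which it commutes with, and then
  back into R_i behind.\<close>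

lemma Lcopy_commute: "Suc i < k \<Longrightarrow> rr i * Lcopy L k = Lcopy L k * rr i"
proof (induction k)
  case (Suc k)
  show ?case
  proof (cases "Suc i < k")
    case True
    have 1: "rr i * rr k = rr k * rr i" using True by (rule rr_far)
    have 2: "rr i * rr' k = rr' k * rr i" by (rule rr_commute) (use True in auto)
    show ?thesis unfolding Lcopy_Suc by (intro commute_times 1 2 Suc.IH[OF True])
  next
    case False
    then have k: "k = Suc i" using Suc.prems by simp
    have c: "rr (Suc i) * Lcopy L i = Lcopy L i * rr (Suc i)"
      by (rule rr_commute) (simp_all add: triv_Lcopy)
    have "rr i * Lcopy L (Suc k) = (rr i * rr (Suc i) * rr i) * Lcopy L i * rr' i * rr' (Suc i)"
      by (simp add: k Lcopy_Suc mult.assoc)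
    also have "\<dots> = rr (Suc i) * rr i * (rr (Suc i) * Lcopy L i) * rr' i * rr' (Suc i)"
      unfolding rr_braid by (simp only: mult.assoc)
    also have "\<dots> = rr (Suc i) * rr i * Lcopy L i * (rr (Suc i) * rr' i * rr' (Suc i))"
      unfolding c by (simp only: mult.assoc)
    also have "\<dots> = Lcopy L (Suc k) * rr i"
      unfolding conj_rr by (simp add: k Lcopy_Suc mult.assoc)
    finally show ?thesis .
  qed
qed simp

lemma chain_rr_inv: "chain rr a n * rchain rr' a n = 1" "rchain rr' a n * chain rr a n = 1"
  "chain rr' a n * rchain rr a n = 1" "rchain rr a n * chain rr' a n = 1"
  using chain_inverse[of rr rr'] chain_inverse[of rr' rr] rr_inv by simp_all

text \<open>For L, conjugation by this product plays the role that translation by one copy plays for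
  T.\<close>

lemma chain_rr_shift: "a \<le> i \<Longrightarrow> Suc i < a + n \<Longrightarrow> chain rr a n * rr i = rr (Suc i) * chain rr a n"
proof (induction n)
  case (Suc n)
  show ?case
  proof (cases "Suc i < a + n")
    case True
    have "chain rr a (Suc n) * rr i = chain rr a n * (rr (a + n) * rr i)" by (simp add: mult.assoc)
    also have "\<dots> = (chain rr a n * rr i) * rr (a + n)"
      unfolding rr_far[OF True, symmetric] by (simp only: mult.assoc)
    finally show ?thesis using Suc.IH Suc.prems True by (simp add: mult.assoc)
  next
    case False
    define n' where "n' = i - a"
    have n: "n = Suc n'" "i = a + n'" using False Suc.prems by (auto simp: n'_def)
    have c: "chain rr a n' * rr (Suc i) = rr (Suc i) * chain rr a n'"
      by (rule chain_commute[symmetric], rule rr_far[symmetric]) (use n in auto)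
    have "chain rr a (Suc n) * rr i = chain rr a n' * (rr i * rr (Suc i) * rr i)"
      by (simp add: n mult.assoc)
    also have "\<dots> = chain rr a n' * rr (Suc i) * rr i * rr (Suc i)"
      unfolding rr_braid by (simp only: mult.assoc)
    also have "\<dots> = rr (Suc i) * chain rr a (Suc n)"
      unfolding c by (simp add: n mult.assoc)
    finally show ?thesis .
  qed
qed simp

lemma rchain_rr_shift: "Suc i < n \<Longrightarrow> rr i * rchain rr 0 n = rchain rr 0 n * rr (Suc i)"
proof (induction n)
  case (Suc n)
  show ?case
  proof (cases "Suc i < n")
    case True
    have "rr i * rchain rr 0 (Suc n) = (rr i * rr n) * rchain rr 0 n" by (simp add: mult.assoc)
    also have "\<dots> = rr n * (rr i * rchain rr 0 n)"
      unfolding rr_far[OF True] by (simp only: mult.assoc)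
    finally show ?thesis using Suc.IH Suc.prems True by (simp add: mult.assoc)
  next
    case False
    then have n: "n = Suc i" using Suc.prems by simp
    have c: "rr (Suc i) * rchain rr 0 i = rchain rr 0 i * rr (Suc i)"
      by (rule rr_commute; rule triv_rchain) auto
    have "rr i * rchain rr 0 (Suc n) = (rr i * rr (Suc i) * rr i) * rchain rr 0 i"
      by (simp add: n mult.assoc)
    also have "\<dots> = rr (Suc i) * rr i * (rr (Suc i) * rchain rr 0 i)"
      unfolding rr_braid by (simp only: mult.assoc)
    also have "\<dots> = rchain rr 0 (Suc n) * rr (Suc i)"
      unfolding c by (simp add: n mult.assoc)
    finally show ?thesis .
  qed
qed simp

lemma antisym_chain_rr:
  assumes "a \<le> b" "b + m \<le> a + n"
  shows "antisym (Suc b) m * chain rr a n = chain rr a n * antisym b m"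
  unfolding antisym_def
  by (rule op.asym_intertwine[symmetric]) (use assms in \<open>auto intro: chain_rr_shift\<close>)

lemma antisym_chain_rr': "antisym 1 m * chain rr' 0 m = chain rr' 0 m * antisym 0 m"
  unfolding antisym_def
proof (rule op.asym_intertwine[symmetric])
  fix i assume "Suc i < m"
  then have "chain rr' 0 m * (rr i * rchain rr 0 m) * chain rr' 0 m
    = chain rr' 0 m * (rchain rr 0 m * rr (Suc i)) * chain rr' 0 m"
    by (simp add: rchain_rr_shift)
  then show "chain rr' 0 m * rr (0 + i) = rr (1 + i) * chain rr' 0 m"
    by (simp add: mult.assoc chain_rr_inv) (simp add: chain_rr_inv flip: mult.assoc)
qed

text \<open>Peel off the outermost pair \<open>g\<close>, \<open>g'\<close>: by \<open>conj\<close>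
  the q-trace over the last copy becomes the one over its left neighbour. Repetition moves all
  traces one copy to the left.\<close>

lemma qtrs_chain_conj_aux:
  assumes conj: "\<And>i X. triv (Suc i) X \<Longrightarrow> qtr (Suc i) (g i * X * g' i) = qtr i X"
    and g: "\<And>i l. l \<noteq> i \<Longrightarrow> l \<noteq> Suc i \<Longrightarrow> triv l (g i)"
    and g': "\<And>i l. l \<noteq> i \<Longrightarrow> l \<noteq> Suc i \<Longrightarrow> triv l (g' i)"
    and X: "\<And>l. a + n \<le> l \<Longrightarrow> triv l X"
  shows "qtrs (Suc a) n (chain g a n * X * rchain g' a n) = qtrs a n X"
  using X
proof (induction n arbitrary: X)
  case (Suc n)
  have tg: "triv (Suc (a + n)) (chain g a n)" by (rule triv_chain) (simp add: g)
  have tg': "triv (Suc (a + n)) (rchain g' a n)" by (rule triv_rchain) (simp add: g')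
  have "qtr (Suc (a + n)) (chain g a (Suc n) * X * rchain g' a (Suc n))
    = qtr (Suc (a + n)) (chain g a n * ((g (a + n) * X * g' (a + n)) * rchain g' a n))"
    by (simp add: mult.assoc)
  also have "\<dots> = chain g a n * (qtr (Suc (a + n)) (g (a + n) * X * g' (a + n)) * rchain g' a n)"
    by (simp only: qtr_triv_times[OF tg] qtr_times_triv[OF tg'])
  also have "qtr (Suc (a + n)) (g (a + n) * X * g' (a + n)) = qtr (a + n) X"
    by (rule conj) (simp add: Suc.prems)
  finally have "qtrs (Suc a) (Suc n) (chain g a (Suc n) * X * rchain g' a (Suc n))
    = qtrs (Suc a) n (chain g a n * qtr (a + n) X * rchain g' a n)" by (simp add: mult.assoc)
  also have "\<dots> = qtrs a n (qtr (a + n) X)"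
  proof (rule Suc.IH)
    show "triv l (qtr (a + n) X)" if "a + n \<le> l" for l
      using that triv_qtr triv_qtr_other Suc.prems[of l] by (cases "l = a + n") auto
  qed
  finally show ?case by simp
qed simp

lemma qtrs_chain_conj:
  assumes "\<And>l. a + n \<le> l \<Longrightarrow> triv l X"
  shows "qtrs (Suc a) n (chain rr a n * X * rchain rr' a n) = qtrs a n X"
    and "qtrs (Suc a) n (chain rr' a n * X * rchain rr a n) = qtrs a n X"
  by (rule qtrs_chain_conj_aux; simp add: qtr_conj assms)+

text \<open>The copies of L after the first are together the conjugate of the product of the first
  \<open>k\<close> copies. This splits off L on the left.\<close>

lemma L_Lchain: "on1 0 L * (chain rr 0 k * Lchain L k * rchain rr' 0 k) = Lchain L (Suc k)"
proof (induction k)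
  case 0
  then show ?case by (simp add: Lchain_def Lcopy_def)
next
  case (Suc k)
  have c: "rr k * Lchain L k = Lchain L k * rr k"
    by (rule rr_commute; rule triv_Lchain) simp_all
  have d: "Lcopy L (Suc k) * rchain rr' 0 k = rchain rr' 0 k * Lcopy L (Suc k)"
  proof -
    have "Lcopy L (Suc k) * chain rr 0 k = chain rr 0 k * Lcopy L (Suc k)"
      by (rule chain_commute) (simp add: Lcopy_commute)
    then have "rchain rr' 0 k * (Lcopy L (Suc k) * chain rr 0 k) * rchain rr' 0 k
      = rchain rr' 0 k * (chain rr 0 k * Lcopy L (Suc k)) * rchain rr' 0 k" by simp
    then show ?thesis by (simp add: mult.assoc chain_rr_inv) (simp add: chain_rr_inv flip:
      mult.assoc)
  qed
  have "on1 0 L * (chain rr 0 (Suc k) * Lchain L (Suc k) * rchain rr' 0 (Suc k))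
    = on1 0 L * chain rr 0 k * (rr k * Lchain L k) * Lcopy L k * rr' k * rchain rr' 0 k"
    by (simp add: Lchain_def mult.assoc)
  also have "\<dots> = on1 0 L * chain rr 0 k * Lchain L k * (Lcopy L (Suc k) * rchain rr' 0 k)"
    unfolding c Lcopy_Suc by (simp only: mult.assoc)
  also have "\<dots> = (on1 0 L * (chain rr 0 k * Lchain L k * rchain rr' 0 k)) * Lcopy L (Suc k)"
    unfolding d by (simp only: mult.assoc)
  also have "\<dots> = Lchain L (Suc (Suc k))"
    unfolding Suc by (simp add: Lchain_def)
  finally show ?case .
qed

text \<open>The assumption is the form in which the map \<open>\<phi>\<close> delivers the RLRL
  relations; the relations themselves are its case \<open>k = 2\<close>, see
  \<open>rlrl\<close>.\<close>

context
  fixes L :: "'a^'n^'n"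
  assumes LL: "\<And>i k. Suc i < k \<Longrightarrow> rr i * Lchain L k = Lchain L k * rr i"
begin

text \<open>The last copy is (R_(k-1) ... R_0) L times the inverse of that product. By
  \<open>LL\<close> the whole chain commutes with R_(k-1) ... R_0, which moves the braid factors to
  the left and L to the right end.\<close>

lemma Lchain_L: "chain rr' 0 k * Lchain L k * rchain rr 0 k * on1 0 L = Lchain L (Suc k)"
proof -
  have "Lchain L (Suc k) * rchain rr 0 k = rchain rr 0 k * Lchain L (Suc k)"
  proof -
    have "x * rchain g 0 n = rchain g 0 n * x" if "\<And>i. i < n \<Longrightarrow> x * g i = g i * x"
      for x n and g :: "nat \<Rightarrow> ('n, 'a) oper"
      using that
    proof (induction n)
      case (Suc n)
      have "x * rchain g 0 n = rchain g 0 n * x" "x * g n = g n * x" using Suc by simp_all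
      then show ?case by simp (metis mult.assoc)
    qed simp
    then show ?thesis by (simp add: LL)
  qed
  then have "rchain rr 0 k * Lchain L (Suc k)
    = Lchain L k * rchain rr 0 k * on1 0 L * (chain rr' 0 k * rchain rr 0 k)"
    by (simp add: Lchain_def Lcopy_def mult.assoc)
  then have "chain rr' 0 k * (rchain rr 0 k * Lchain L (Suc k))
    = chain rr' 0 k * (Lchain L k * rchain rr 0 k * on1 0 L)"
    by (simp add: chain_rr_inv)
  then show ?thesis by (simp add: chain_rr_inv flip: mult.assoc)
qed

text \<open>The same q-trace is computed twice. Splitting off L on the right gives \<sigma> L,
  splitting it off on the left gives L \<sigma>; what is left in between is \<sigma> by conjugation
  invariance.\<close>

lemma
  assumes sigma: "qtrs 0 j (antisym 0 j * Lchain L j) = scalar u"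
  shows qtrs_antisym_Lchain: "qtrs 1 j (antisym 1 j * Lchain L (Suc j)) = scalar u * on1 0 L"
    and sigma_central: "on1 0 L * scalar u = scalar u * on1 0 L"
proof -
  let ?A = "antisym 0 j" and ?A' = "antisym 1 j"
  have tr: "triv l (?A * Lchain L j)" if "j \<le> l" for l
    using that by (intro triv_times triv_Lchain triv_antisym) auto
  note A1 = antisym_chain_rr'[of j] and A2 = antisym_chain_rr[of 0 0 j j, simplified]
  have "qtrs 1 j (?A' * Lchain L (Suc j))
    = qtrs (Suc 0) j (chain rr' 0 j * (?A * Lchain L j) * rchain rr 0 j * on1 0 L)"
    unfolding Lchain_L[symmetric] using A1 by (simp flip: mult.assoc)
  also have "\<dots> = qtrs (Suc 0) j (chain rr' 0 j * (?A * Lchain L j) * rchain rr 0 j) * on1 0 L"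
    by (rule qtrs_times_triv) simp
  also have "\<dots> = scalar u * on1 0 L"
    by (subst qtrs_chain_conj(2)) (simp_all add: tr sigma)
  finally show 1: "qtrs 1 j (?A' * Lchain L (Suc j)) = scalar u * on1 0 L" .
  have "?A' * on1 0 L = on1 0 L * ?A'"
    by (rule antisym_commute[symmetric], rule rr_commute[symmetric]) auto
  then have "?A' * (on1 0 L * X) = on1 0 L * (?A' * X)" for X by (rule swap_assoc)
  moreover have "?A' * (chain rr 0 j * X) = chain rr 0 j * (?A * X)" for X
    by (rule swap_assoc) (use A2 in simp)
  ultimately have "qtrs 1 j (?A' * Lchain L (Suc j))
    = qtrs (Suc 0) j (on1 0 L * (chain rr 0 j * (?A * Lchain L j) * rchain rr' 0 j))"
    unfolding L_Lchain[symmetric] by (simp add: mult.assoc)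
  also have "\<dots> = on1 0 L * qtrs (Suc 0) j (chain rr 0 j * (?A * Lchain L j) * rchain rr' 0 j)"
    by (rule qtrs_triv_times) simp
  also have "\<dots> = on1 0 L * scalar u"
    by (subst qtrs_chain_conj(1)) (simp_all add: tr sigma)
  finally show "on1 0 L * scalar u = scalar u * on1 0 L" using 1 by simp
qed

lemma rlrl: "rr 0 * on1 0 L * rr 0 * on1 0 L = on1 0 L * rr 0 * on1 0 L * rr 0"
proof -
  have "Lchain L 2 = on1 0 L * rr 0 * on1 0 L * rr' 0"
    by (simp add: Lchain_def Lcopy_def numeral_2_eq_2 mult.assoc)
  then have "rr 0 * (on1 0 L * rr 0 * on1 0 L * rr' 0) * rr 0
    = on1 0 L * rr 0 * on1 0 L * rr' 0 * rr 0 * rr 0"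
    using LL[of 0 2] by simp
  then show ?thesis by (simp add: mult.assoc rr_inv)
qed

text \<open>Induction on \<open>b\<close>. After L is split off on the left, conjugation invariance
  replaces the inner traces by the previous value \<open>Y\<close>, which stands between R L R and
  R^(-1). Once R L R has moved past \<open>Y\<close>, the remaining q-trace is that of Y R L, and
  the q-trace of R over the second copy is 1. So each step contributes one factor L.\<close>

lemma qtrs_Lchain:
  assumes sigma: "qtrs 0 j (antisym 0 j * Lchain L j) = scalar u"
  shows "qtrs 1 (b + j) (chain rr 0 b * antisym (Suc b) j * Lchain L (Suc (b + j)))
    = scalar u * on1 0 L ^ Suc b"
proof (induction b)
  case 0
  then show ?case using qtrs_antisym_Lchain[OF sigma] by simp
next
  case (Suc b)
  define n where "n = b + j"
  let ?L = "on1 0 L :: ('n, 'a) oper" and ?J = "chain rr 0 (Suc n)" and ?J' = "rchain rr' 0 (Suc n)"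
  let ?B = "chain rr 0 b * antisym (Suc b) j"
  define Y where "Y = scalar u * ?L ^ Suc b"
  have triv_LL: "triv l (?B * Lchain L (Suc n))" if "Suc n \<le> l" for l
    using that unfolding n_def by (intro triv_times triv_chain triv_antisym triv_Lchain) auto
  have JB: "chain rr 1 b * antisym (Suc (Suc b)) j * ?J = ?J * ?B"
  proof -
    have "chain rr 1 m * ?J = ?J * chain rr 0 m" if "m \<le> n" for m
      using that
    proof (induction m)
      case (Suc m)
      have "chain rr 1 (Suc m) * ?J = chain rr 1 m * (rr (Suc m) * ?J)" by (simp add: mult.assoc)
      also have "rr (Suc m) * ?J = ?J * rr m"
        by (rule chain_rr_shift[symmetric]) (use Suc.prems in auto)
      also have "chain rr 1 m * (?J * rr m) = (chain rr 1 m * ?J) * rr m" by (simp only: mult.assoc)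
      also have "chain rr 1 m * ?J = ?J * chain rr 0 m" using Suc by simp
      finally show ?case by (simp only: chain.simps mult.assoc add_0)
    qed simp
    from this[of b] have "chain rr 1 b * ?J = ?J * chain rr 0 b" by (simp add: n_def)
    moreover have "antisym (Suc (Suc b)) j * ?J = ?J * antisym (Suc b) j"
      by (rule antisym_chain_rr) (simp_all add: n_def)
    ultimately show ?thesis by (rule intertwine_times)
  qed
  have BL: "chain rr 1 b * antisym (Suc (Suc b)) j * ?L
    = ?L * (chain rr 1 b * antisym (Suc (Suc b)) j)"
  proof -
    have "?L * chain rr 1 b = chain rr 1 b * ?L"
      by (rule chain_commute, rule rr_commute[symmetric]) auto
    moreover have "?L * antisym (Suc (Suc b)) j = antisym (Suc (Suc b)) j * ?L"
      by (rule antisym_commute, rule rr_commute[symmetric]) auto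
    ultimately show ?thesis by (intro commute_times[symmetric])
  qed
  have IH: "qtrs 1 n (?B * Lchain L (Suc n)) = Y" using Suc.IH by (simp add: n_def Y_def)
  have YL: "?L * Y = Y * ?L"
  proof -
    have "?L * Y = scalar u * (?L * ?L ^ Suc b)"
      unfolding Y_def by (simp only: mult.assoc[symmetric] sigma_central[OF sigma])
    also have "?L * ?L ^ Suc b = ?L ^ Suc b * ?L" by (rule power_commutes[symmetric])
    finally show ?thesis by (simp add: Y_def mult.assoc)
  qed
  \<comment> \<open>R L R commutes with L by the RLRL relations, and with \<open>scalar u\<close>
    because both R and L do.\<close>
  have YM: "rr 0 * ?L * rr 0 * Y = Y * (rr 0 * ?L * rr 0)"
  proof -
    let ?M = "rr 0 * ?L * rr 0"
    have M: "?M * ?L = ?L * ?M" using rlrl by (simp add: mult.assoc)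
    have "scalar u * rr 0 = rr 0 * scalar u" by (rule rr_commute[symmetric]) simp_all
    then have "scalar u * ?M = ?M * scalar u"
      by (intro commute_times sigma_central[OF sigma, symmetric])
    then have "?M * scalar u = scalar u * ?M" ..
    moreover have "?M * ?L ^ m = ?L ^ m * ?M" for m
      by (rule power_commuting_commutes[OF M[symmetric], symmetric])
    ultimately show ?thesis unfolding Y_def by (rule commute_times)
  qed
  have "chain rr 0 (Suc b) * antisym (Suc (Suc b)) j * Lchain L (Suc (Suc n))
    = rr 0 * (chain rr 1 b * antisym (Suc (Suc b)) j * ?L) * (?J * Lchain L (Suc n) * ?J')"
    unfolding L_Lchain[symmetric] chain_Suc' by (simp add: mult.assoc)
  also have "\<dots> = rr 0 * ?L * (chain rr 1 b * antisym (Suc (Suc b)) j * ?J) * Lchain L (Suc n) * ?J'"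
    unfolding BL by (simp only: mult.assoc)
  also have "\<dots> = (rr 0 * ?L * rr 0) * (chain rr 1 n * (?B * Lchain L (Suc n)) * rchain rr' 1 n)
    * rr' 0"
    unfolding JB unfolding chain_Suc'[of rr] rchain_Suc'[of rr'] by (simp add: mult.assoc)
  finally have eq: "chain rr 0 (Suc b) * antisym (Suc (Suc b)) j * Lchain L (Suc (Suc n))
    = (rr 0 * ?L * rr 0) * (chain rr 1 n * (?B * Lchain L (Suc n)) * rchain rr' 1 n) * rr' 0" .
  have "qtrs 1 (Suc n) (chain rr 0 (Suc b) * antisym (Suc (Suc b)) j * Lchain L (Suc (Suc n)))
    = qtr 1 (qtrs 2 n ((rr 0 * ?L * rr 0) * (chain rr 1 n * (?B * Lchain L (Suc n)) * rchain
      rr' 1 n) * rr' 0))"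
    unfolding eq qtrs_Suc' by (simp add: numeral_2_eq_2)
  also have "qtrs 2 n ((rr 0 * ?L * rr 0) * (chain rr 1 n * (?B * Lchain L (Suc n)) * rchain
    rr' 1 n) * rr' 0)
    = (rr 0 * ?L * rr 0) * qtrs (Suc 1) n (chain rr 1 n * (?B * Lchain L (Suc n)) * rchain rr' 1
      n) * rr' 0"
    by (subst qtrs_times_triv, simp, subst qtrs_triv_times) (simp_all add: triv_times
      numeral_2_eq_2)
  also have "qtrs (Suc 1) n (chain rr 1 n * (?B * Lchain L (Suc n)) * rchain rr' 1 n) = Y"
    unfolding IH[symmetric] by (rule qtrs_chain_conj(1)) (simp add: triv_LL)
  also have "(rr 0 * ?L * rr 0) * Y * rr' 0 = Y * (rr 0 * ?L)"
    unfolding YM by (simp add: mult.assoc rr_inv)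
  also have "qtr 1 (Y * (rr 0 * ?L)) = Y * (qtr (Suc 0) (rr 0) * ?L)"
  proof -
    have "triv 1 (?L ^ m)" for m by (induction m) (simp_all add: triv_times)
    from this[of "Suc b"] have "triv 1 Y" unfolding Y_def by (intro triv_times triv_scalar)
    then show ?thesis by (simp add: qtr_triv_times qtr_times_triv)
  qed
  also have "\<dots> = scalar u * ?L ^ Suc (Suc b)"
    by (simp add: qtr_rr Y_def mult.assoc power_commutes)
  finally show ?case by (simp add: n_def)
qed

end

end


section \<open>Translation to operators on lists of indices\<close>

lemma field_embedding_emb: "assoc_algebra scl \<Longrightarrow> field_embedding (emb scl)"
  for scl :: "'k::field \<Rightarrow> 'a::ring_1 \<Rightarrow> 'a"
proof -
  assume "assoc_algebra scl"
  then interpret assoc_algebra scl .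
  show ?thesis
    by unfold_locales (simp_all add: emb_def scale_left_distrib scale_mult_left scale_mult_right)
qed

lemma prod_list_map_upt:
  "prod_list (map h [Suc a..<Suc (a + n)]) = chain (\<lambda>i. h (Suc i)) a n"
  by (induction n) simp_all

lemma first_chain1:
  assumes "a + n \<le> k"
  shows "first k (chain1 k (Suc a) (a + n) X)
    = (chain (\<lambda>i. on1 i X) a n :: ('n::finite, 'a::ring_1) oper)"
proof -
  have "map (\<lambda>i. first k (at1 i X)) [Suc a..<Suc (a + n)]
    = map (\<lambda>i. on1 (i - 1) X) [Suc a..<Suc (a + n)]"
    by (rule map_cong[OF refl], rule first_at1) (use assms in auto)
  moreover have "first k (chain1 k (Suc a) (a + n) X)
    = prod_list (map (\<lambda>i. first k (at1 i X)) [Suc a..<Suc (a + n)])"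
    by (simp add: chain1_def first_tprod comp_def del: upt_Suc)
  ultimately show ?thesis
    using prod_list_map_upt[of "\<lambda>i. on1 (i - 1) X :: ('n, 'a) oper" a n]
    by (simp only: diff_Suc_1)
qed

lemma first_chain2:
  assumes "a + n < k"
  shows "first k (chain2 k (Suc a) (a + n) X)
    = (chain (\<lambda>i. on2 i X) a n :: ('n::finite, 'a::ring_1) oper)"
proof -
  have "map (\<lambda>i. first k (at2 i X)) [Suc a..<Suc (a + n)]
    = map (\<lambda>i. on2 (i - 1) X) [Suc a..<Suc (a + n)]"
    by (rule map_cong[OF refl], rule first_at2) (use assms in auto)
  moreover have "first k (chain2 k (Suc a) (a + n) X)
    = prod_list (map (\<lambda>i. first k (at2 i X)) [Suc a..<Suc (a + n)])"
    by (simp add: chain2_def first_tprod comp_def del: upt_Suc)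
  ultimately show ?thesis
    using prod_list_map_upt[of "\<lambda>i. on2 (i - 1) X :: ('n, 'a) oper" a n]
    by (simp only: diff_Suc_1)
qed

lemma first_antisymmetrizer:
  "first k (antisymmetrizer q R k) = asym scalar q (\<lambda>i. on2 i R) k"
proof (induction k rule: induct_nat_012)
  case (ge2 m)
  let ?M = "\<lambda>I J. q ^ Suc m * tid I J - qnum q (Suc m) * at2 (Suc m) R I J"
  have M: "first (Suc (Suc m)) ?M = scalar (q ^ Suc m) - scalar (qnum q (Suc m)) * on2 m R"
    by (simp add: first_diff first_scale first_tid first_at2 del: power_Suc)
  show ?case
    unfolding antisymmetrizer.simps asym.simps Let_def first_scale first_tprod
    by (simp add: first_extend ge2 M mult.assoc del: power_Suc asym.simps)
qed (simp_all add: first_tid)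

locale list_setting = tensor_setting R R' D q "emb scl" + assoc_algebra scl
  for R R' :: "'k::field^('n::finite \<times> 'n)^('n \<times> 'n)" and D :: "'k^'n^'n" and q :: 'k
    and scl :: "'k \<Rightarrow> 'a::ring_1 \<Rightarrow> 'a"
begin

lemma first_tlift: "first k (tlift scl X) = lift (first k X)"
proof -
  have "tlift scl X = (\<lambda>I J. emb scl (X I J))" by (simp add: tlift_def fun_eq_iff)
  then show ?thesis by (simp add: map_oper_first)
qed

lemma lift_asym: "lift (asym scalar q f m) = asym sc q (\<lambda>i. lift (f i)) m"
  by (induction m rule: induct_nat_012) (simp_all add: lift_times lift_diff lift_scalar lift_1)

lemma lift_chain: "lift (chain g a n) = chain (\<lambda>i. lift (g i)) a n"
  by (induction n) (simp_all add: lift_times lift_1)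

lemma antisym_eq_lift: "antisym a m = lift (asym scalar q (\<lambda>i. on2 (a + i) R) m)"
  by (simp add: lift_asym antisym_def lift_on)

lemma chain_rr_eq_lift: "chain rr a m = lift (chain (\<lambda>i. on2 i R) a m)"
  by (simp add: lift_chain lift_on)

lemma first_tlift_antisymmetrizer: "first k (tlift scl (antisymmetrizer q R k)) = antisym 0 k"
  by (simp add: first_tlift first_antisymmetrizer antisym_eq_lift)

lemma first_Tchain: "first k (chain1 k 1 k T) = Tchain T k"
  using first_chain1[of 0 k k T] by (simp add: Tchain_def)

lemma on1_T_wedge: "k \<ge> 1 \<Longrightarrow>
    on1 0 (T_wedge scl q R T k) = ptraces 1 (k - 1) (antisym 0 k * Tchain T k)"
  unfolding T_wedge_def
  by (simp add: ptraces_first_eq_trace_tail[symmetric] first_tmult first_tlift_antisymmetrizer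
      first_Tchain del: One_nat_def)

lemma on1_T_power: "k \<ge> 1 \<Longrightarrow>
    on1 0 (T_power scl R T k) = ptraces 1 (k - 1) (chain rr 0 (k - 1) * Tchain T k)"
  unfolding T_power_def
  using first_chain2[of 0 "k - 1" k R]
  by (simp add: ptraces_first_eq_trace_tail[symmetric] first_tmult first_tlift
    first_Tchain[unfolded One_nat_def]
      chain_rr_eq_lift)

lemma scalar_sigma_T:
  "scalar (sigma_T scl q R T k) = sc (q ^ k) * ptraces 0 k (antisym 0 k * Tchain T k)"
proof (cases "k = 0")
  case True
  then show ?thesis by (simp add: sigma_T_def Tchain_def)
next
  case False
  then show ?thesis
    by (simp add: sigma_T_def scalar_mult ptraces_first_eq_trace_all[symmetric] first_tmult
        first_tlift_antisymmetrizer first_Tchain[unfolded One_nat_def])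
qed

lemma Tchain_D: "Tchain (map_matrix (emb scl) D ** T) k = chain dd 0 k * Tchain T k"
  unfolding Tchain_def
proof (induction k)
  case (Suc k)
  have "dd k * chain (\<lambda>i. on1 i T) 0 k = chain (\<lambda>i. on1 i T) 0 k * dd k"
    by (rule dd_commute, rule triv_chain) simp
  moreover have "chain (\<lambda>i. on1 i (map_matrix (emb scl) D ** T)) 0 (Suc k)
    = chain (\<lambda>i. on1 i (map_matrix (emb scl) D ** T)) 0 k * (dd k * on1 k T)"
    by (simp add: on1_mult dd_def)
  ultimately show ?case unfolding Suc by (simp add: mult.assoc) (simp flip: mult.assoc)
qed simp

lemma on1_D_eq: "(\<lambda>i. on1 i (map_matrix (emb scl) D)) = dd"
  by (simp add: dd_def fun_eq_iff)

text \<open>By \<open>rr_dd\<close> the matrix D is itself an RTT matrix, so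
  \<open>Tchain_commute\<close> applies to it.\<close>

lemma chain_dd_commute: "Suc i < k \<Longrightarrow> chain dd 0 k * rr i = rr i * chain dd 0 k"
  using Tchain_commute[of "map_matrix (emb scl) D" i k] rr_dd[of 0]
  by (simp add: Tchain_def on1_D_eq dd_def)

text \<open>In the traced copies D turns traces into q-traces. Copy 0 is not traced, and its D is
  the common factor in front of the transformed identities.\<close>

lemma ptraces_tail_D:
  assumes "k \<ge> 1" "chain dd 0 k * N = N * chain dd 0 k"
  shows "ptraces 1 (k - 1) (N * Tchain (map_matrix (emb scl) D ** T) k)
    = dd 0 * qtrs 1 (k - 1) (N * Tchain T k)"
proof -
  have "N * Tchain (map_matrix (emb scl) D ** T) k = chain dd 0 k * (N * Tchain T k)"
    using assms(2) by (simp add: Tchain_D flip: mult.assoc)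
  also have "chain dd 0 k = dd 0 * chain dd 1 (k - 1)"
    using assms(1) chain_Suc'[of dd 0 "k - 1"] by simp
  finally show ?thesis
    by (simp add: qtrs_eq_ptraces mult.assoc) (rule ptraces_triv_times, simp)
qed

lemma on1_T_wedge_D: "k \<ge> 1 \<Longrightarrow> on1 0 (T_wedge scl q R (map_matrix (emb scl) D ** T) k)
    = dd 0 * qtrs 1 (k - 1) (antisym 0 k * Tchain T k)"
  unfolding on1_T_wedge by (rule ptraces_tail_D) (auto intro!: antisym_commute chain_dd_commute)

lemma on1_T_power_D: "k \<ge> 1 \<Longrightarrow> on1 0 (T_power scl R (map_matrix (emb scl) D ** T) k)
    = dd 0 * qtrs 1 (k - 1) (chain rr 0 (k - 1) * Tchain T k)"
  unfolding on1_T_power by (rule ptraces_tail_D) (auto intro!: chain_commute chain_dd_commute)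

lemma scalar_sigma_T_D: "scalar (sigma_T scl q R (map_matrix (emb scl) D ** T) k)
    = sc (q ^ k) * qtrs 0 k (antisym 0 k * Tchain T k)"
proof -
  have "chain dd 0 k * antisym 0 k = antisym 0 k * chain dd 0 k"
    by (rule antisym_commute) (simp add: chain_dd_commute)
  then show ?thesis
    by (simp add: scalar_sigma_T Tchain_D qtrs_eq_ptraces) (simp flip: mult.assoc)
qed

lemma sigma_T_exists: "\<exists>u. qtrs 0 k (antisym 0 k * Tchain T k) = scalar u"
proof -
  have "first k (tprod k [chain1 k 1 k (map_matrix (emb scl) D), tlift scl (antisymmetrizer q R
    k), chain1 k 1 k T])
    = chain dd 0 k * (antisym 0 k * Tchain T k)"
    using first_Tchain[of k "map_matrix (emb scl) D"]
    by (simp add: first_tprod first_tlift_antisymmetrizer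
      first_Tchain[unfolded One_nat_def] Tchain_def on1_D_eq)
  then show ?thesis unfolding qtrs_eq_ptraces by (metis ptraces_first_eq_trace_all)
qed

lemma matrix_inv_R: "matrix_inv R = R'"
  unfolding matrix_inv_def
proof (rule some_equality)
  show "R ** R' = mat 1 \<and> R' ** R = mat 1" using inv by blast
  show "X = R'" if "R ** X = mat 1 \<and> X ** R = mat 1" for X
  proof -
    have "X = (R' ** R) ** X" by (simp add: inv)
    also have "\<dots> = R' ** (R ** X)" by (rule matrix_mul_assoc[symmetric])
    finally show "X = R'" using that by simp
  qed
qed

lemma first_L_copy: "i < n \<Longrightarrow> first n (L_copy scl R L n (Suc i)) = Lcopy L i"
proof (induction i)
  case 0
  then show ?case using first_at1[of 1 n L] by (simp add: Lcopy_def)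
next
  case (Suc i)
  then show ?case
    by (simp add: first_tprod first_tlift first_at2 lift_on matrix_inv_R Lcopy_Suc mult.assoc)
qed

lemma first_L_chain: "first k (L_chain scl R L k) = Lchain L k"
proof -
  have "map (\<lambda>i. first k (L_copy scl R L k i)) [Suc 0..<Suc (0 + k)]
    = map (\<lambda>i. Lcopy L (i - 1)) [Suc 0..<Suc (0 + k)]"
    by (rule map_cong[OF refl]) (metis One_nat_def Suc_le_eq Suc_pred add_0 atLeastLessThan_iff
      first_L_copy less_Suc_eq_le set_upt diff_Suc_1 Suc_le_D)
  moreover have "first k (L_chain scl R L k)
    = prod_list (map (\<lambda>i. first k (L_copy scl R L k i)) [Suc 0..<Suc (0 + k)])"
    by (simp add: L_chain_def first_tprod comp_def del: upt_Suc)
  ultimately show ?thesis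
    unfolding Lchain_def using prod_list_map_upt[of "\<lambda>i. Lcopy L (i - 1)" 0 k]
    by (simp only: diff_Suc_1)
qed

lemma first_chain_dd: "a + n \<le> k \<Longrightarrow> first k (tlift scl (chain1 k (Suc a) (a + n) D)) = chain dd a n"
  by (simp add: first_tlift first_chain1 lift_chain lift_on)

lemma on1_L_wedge: "k \<ge> 1 \<Longrightarrow>
    on1 0 (L_wedge scl q R D L k) = qtrs 1 (k - 1) (antisym 0 k * Lchain L k)"
  using first_chain_dd[of 1 "k - 1" k]
  by (simp add: L_wedge_def ptraces_first_eq_trace_tail[symmetric] first_tprod numeral_2_eq_2
      first_tlift_antisymmetrizer first_L_chain qtrs_eq_ptraces)

lemma sigma_L_eq: "scalar (trace_all k (tprod k [tlift scl (chain1 k 1 k D),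
    tlift scl (antisymmetrizer q R k), L_chain scl R L k])) = qtrs 0 k (antisym 0 k * Lchain L k)"
  using first_chain_dd[of 0 k k]
  by (simp add: ptraces_first_eq_trace_all[symmetric] first_tprod
      first_tlift_antisymmetrizer first_L_chain qtrs_eq_ptraces)

lemma sigma_L_exists: "\<exists>u. qtrs 0 k (antisym 0 k * Lchain L k) = scalar u"
  using sigma_L_eq by metis

lemma scalar_sigma_L:
  "scalar (sigma_L scl q R D L k) = sc (q ^ k) * qtrs 0 k (antisym 0 k * Lchain L k)"
proof (cases "k = 0")
  case True
  then show ?thesis by (simp add: sigma_L_def Lchain_def)
next
  case False
  then show ?thesis by (simp add: sigma_L_def scalar_mult sigma_L_eq[unfolded One_nat_def])
qed

lemma tlift_apply_neq: "length I \<noteq> length J \<Longrightarrow> tlift scl (at2 i X) I J = 0"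
  by (simp add: tlift_def at2_def op.e_0 field_embedding.e_0)

lemma foldr_tmult_eq_0:
  assumes "length J \<noteq> k"
  shows "Zs \<noteq> [] \<or> length I = k \<Longrightarrow> foldr (tmult k) Zs tid I J = 0"
proof (induction Zs arbitrary: I)
  case Nil
  then have "I \<noteq> J" using assms by auto
  then show ?case by (simp add: tid_def)
next
  case (Cons Z Zs)
  have "Z I K * foldr (tmult k) Zs tid K J = 0" if "length K = k" for K
    using Cons.IH[of K] that by simp
  then show ?case by (simp add: tmult_def[of k Z])
qed

lemma tprod_eq_0:
  assumes "\<And>I J. length I \<noteq> length J \<Longrightarrow> Z I J = 0" "length I \<noteq> k \<or> length J \<noteq> k"
  shows "tprod k (Z # Zs) I J = 0"
proof (cases "length J = k")
  case True
  then have "Z I K = 0" if "length K = k" for K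
    using assms that by metis
  then show ?thesis by (simp add: tprod_def tmult_def[of k Z])
next
  case False
  show ?thesis unfolding tprod_def by (rule foldr_tmult_eq_0[OF False]) simp
qed

text \<open>The relations are equations between functions of all pairs of lists, so lists of other
  lengths count too. There both products vanish: a first factor supported on lists of equal length
  takes care of \<open>I\<close>, and \<open>tid\<close> at the end takes care of
  \<open>J\<close>.\<close>

lemma tprod_eqI:
  assumes X: "\<And>I J. length I \<noteq> length J \<Longrightarrow> X I J = 0"
    and Y: "\<And>I J. length I \<noteq> length J \<Longrightarrow> Y I J = 0"
    and eq: "prod_list (map (first k) (X # Xs))
      = (prod_list (map (first k) (Y # Ys)) :: ('n, 'a) oper)"
  shows "tprod k (X # Xs) = tprod k (Y # Ys)"
proof (intro ext)
  fix I J
  show "tprod k (X # Xs) I J = tprod k (Y # Ys) I J"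
  proof (cases "length I = k \<and> length J = k")
    case True
    have "first k (tprod k (X # Xs)) = (first k (tprod k (Y # Ys)) :: ('n, 'a) oper)"
      unfolding first_tprod by (rule eq)
    then show ?thesis by (rule first_inject) (use True in simp_all)
  next
    case False
    then have IJ: "length I \<noteq> k \<or> length J \<noteq> k" by blast
    have "tprod k (X # Xs) I J = 0" by (rule tprod_eq_0[OF _ IJ]) (rule X)
    moreover have "tprod k (Y # Ys) I J = 0" by (rule tprod_eq_0[OF _ IJ]) (rule Y)
    ultimately show ?thesis by simp
  qed
qed

lemma rtt_relations_oper:
  "rtt_relations scl R T \<longleftrightarrow> rr 0 * (on1 0 T * on1 1 T) = on1 0 T * on1 1 T * rr 0"
proof
  assume "rtt_relations scl R T"
  from arg_cong[OF this[unfolded rtt_relations_def], of "first 2"]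
  show "rr 0 * (on1 0 T * on1 1 T) = on1 0 T * on1 1 T * rr 0"
    by (simp add: first_tprod first_tlift first_at1 first_at2 lift_on mult.assoc)
next
  assume rtt: "rr 0 * (on1 0 T * on1 1 T) = on1 0 T * on1 1 T * rr 0"
  show "rtt_relations scl R T" unfolding rtt_relations_def
    by (rule tprod_eqI) (use rtt in \<open>simp_all add: first_tlift first_at1 first_at2 lift_on
      mult.assoc tlift_apply_neq at1_def\<close>)
qed

lemma rlrl_relations_oper:
  assumes "rr 0 * on1 0 L * rr 0 * on1 0 L = on1 0 L * rr 0 * on1 0 L * rr 0"
  shows "rlrl_relations scl R L"
  unfolding rlrl_relations_def
  by (rule tprod_eqI) (use assms in \<open>simp_all add: first_tlift first_at1 first_at2 lift_on
    mult.assoc tlift_apply_neq at1_def\<close>)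

end


section \<open>The factorization map\<close>

lemma linear_eq_additive:
  fixes sc :: "'k::field \<Rightarrow> 'x::ring_1 \<Rightarrow> 'x"
  assumes "assoc_algebra sc"
  shows "Vector_Spaces.linear sc (*) f \<longleftrightarrow>
    (\<forall>x y. f (x + y) = f x + f y) \<and> (\<forall>c x. f (sc c x) = c * f x)"
proof -
  interpret assoc_algebra sc by fact
  interpret k: vector_space "(*) :: 'k \<Rightarrow> 'k \<Rightarrow> 'k"
    by unfold_locales (simp_all add: algebra_simps)
  show ?thesis
  proof
    assume "Vector_Spaces.linear sc (*) f"
    then interpret Vector_Spaces.linear sc "(*)" f .
    show "(\<forall>x y. f (x + y) = f x + f y) \<and> (\<forall>c x. f (sc c x) = c * f x)"
      by (simp add: add scale)
  next
    assume "(\<forall>x y. f (x + y) = f x + f y) \<and> (\<forall>c x. f (sc c x) = c * f x)"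
    then show "Vector_Spaces.linear sc (*) f" by unfold_locales simp_all
  qed
qed

lemma length_2_iff: "length xs = 2 \<longleftrightarrow> (\<exists>x y. xs = [x, y])"
  by (auto simp: numeral_2_eq_2 length_Suc_conv)

lemma length_3_iff: "length xs = 3 \<longleftrightarrow> (\<exists>x y z. xs = [x, y, z])"
  by (auto simp: numeral_3_eq_3 length_Suc_conv)

lemma length_1_iff: "length xs = 1 \<longleftrightarrow> (\<exists>x. xs = [x])"
  by (auto simp: length_Suc_conv)

locale factorization =
  X: rtt_algebra scaleX R T +
  U1: dual_power scaleX T 1 scaleU pair1 +
  U2: dual_power scaleX T 2 scaleU2 pair2 +
  U3: dual_power scaleX T 3 scaleU3 pair3
  for R :: "'k::field^('n::finite \<times> 'n)^('n \<times> 'n)"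
    and scaleX :: "'k \<Rightarrow> 'x::ring_1 \<Rightarrow> 'x" and T :: "'x^'n^'n"
    and scaleU :: "'k \<Rightarrow> 'u::ring_1 \<Rightarrow> 'u" and pair1 :: "'u \<Rightarrow> 'x list \<Rightarrow> 'k"
    and scaleU2 :: "'k \<Rightarrow> 'v::ring_1 \<Rightarrow> 'v" and pair2 :: "'v \<Rightarrow> 'x list \<Rightarrow> 'k"
    and scaleU3 :: "'k \<Rightarrow> 'w::ring_1 \<Rightarrow> 'w" and pair3 :: "'w \<Rightarrow> 'x list \<Rightarrow> 'k" +
  fixes \<R> :: 'v
  assumes universal: "universal_R_matrix pair1 pair2 pair3 \<R>"
    and image: "rep_image pair2 T \<R> = permutation_matrix ** R"
begin

definition linear_form :: "('x \<Rightarrow> 'k) \<Rightarrow> bool" where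
  "linear_form f \<longleftrightarrow> (\<forall>x y. f (x + y) = f x + f y) \<and> (\<forall>c x. f (scaleX c x) = c * f x)"

lemma linear_iff: "Vector_Spaces.linear scaleX (*) f \<longleftrightarrow> linear_form f"
  unfolding linear_form_def by (rule linear_eq_additive) (rule X.assoc_algebra_axioms)

lemma form1: "multilinear_form scaleX 1 B \<longleftrightarrow> linear_form (\<lambda>x. B [x])"
  unfolding multilinear_form_def linear_iff by (auto simp: length_Suc_conv)

lemma form2: "multilinear_form scaleX 2 B \<longleftrightarrow>
    (\<forall>y. linear_form (\<lambda>x. B [x, y])) \<and> (\<forall>x. linear_form (\<lambda>y. B [x, y]))"
proof
  assume "multilinear_form scaleX 2 B"
  then have *: "linear_form (\<lambda>z. B (xs[i := z]))" if "length xs = 2" "i < 2" for xs i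
    unfolding multilinear_form_def linear_iff using that by blast
  show "(\<forall>y. linear_form (\<lambda>x. B [x, y])) \<and> (\<forall>x. linear_form (\<lambda>y. B [x, y]))"
    using *[of "[0, y]" 0 for y] *[of "[x, 0]" 1 for x] by simp
next
  assume R: "(\<forall>y. linear_form (\<lambda>x. B [x, y])) \<and> (\<forall>x. linear_form (\<lambda>y. B [x, y]))"
  show "multilinear_form scaleX 2 B"
    unfolding multilinear_form_def linear_iff
  proof (intro allI impI)
    fix xs :: "'x list" and i :: nat assume "length xs = 2" "i < 2"
    moreover from \<open>i < 2\<close> have "i = 0 \<or> i = 1" by auto
    ultimately show "linear_form (\<lambda>y. B (xs[i := y]))" using R by (auto simp: length_2_iff)
  qed
qed

lemma form3: "multilinear_form scaleX 3 B \<longleftrightarrow>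
    (\<forall>y z. linear_form (\<lambda>x. B [x, y, z])) \<and> (\<forall>x z. linear_form (\<lambda>y. B [x, y, z]))
    \<and> (\<forall>x y. linear_form (\<lambda>z. B [x, y, z]))" (is "_ \<longleftrightarrow> ?R")
proof
  assume "multilinear_form scaleX 3 B"
  then have *: "linear_form (\<lambda>z. B (xs[i := z]))" if "length xs = 3" "i < 3" for xs i
    unfolding multilinear_form_def linear_iff using that by blast
  show ?R
    using *[of "[0, y, z]" 0 for y z] *[of "[x, 0, z]" 1 for x z] *[of "[x, y, 0]" 2 for x y]
      by simp
next
  assume R: ?R
  show "multilinear_form scaleX 3 B"
    unfolding multilinear_form_def linear_iff
  proof (intro allI impI)
    fix xs :: "'x list" and i :: nat assume "length xs = 3" "i < 3"
    moreover from \<open>i < 3\<close> have "i = 0 \<or> i = 1 \<or> i = 2" by auto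
    ultimately show "linear_form (\<lambda>y. B (xs[i := y]))" using R by (auto simp: length_3_iff)
  qed
qed

lemma pair1_linear: "linear_form (\<lambda>x. pair1 u [x])"
  using U1.pair_multilinear[of u] form1 by simp

lemma pair2_linear: "linear_form (\<lambda>x. pair2 w [x, y])" "linear_form (\<lambda>y. pair2 w [x, y])"
  using U2.pair_multilinear[of w] form2 by blast+

lemma of_form1: "linear_form (\<lambda>x. B [x]) \<Longrightarrow> pair1 (of_form 1 pair1 B) [x] = B [x]"
  using theI'[OF U1.pair_perfect[of B]] form1[of B] unfolding of_form_def by simp

lemma of_form2:
  "(\<And>y. linear_form (\<lambda>x. B [x, y])) \<Longrightarrow> (\<And>x. linear_form (\<lambda>y. B [x, y]))
    \<Longrightarrow> pair2 (of_form 2 pair2 B) [x, y] = B [x, y]"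
  using theI'[OF U2.pair_perfect[of B]] form2[of B] unfolding of_form_def by simp

lemma of_form3:
  "(\<And>y z. linear_form (\<lambda>x. B [x, y, z])) \<Longrightarrow> (\<And>x z. linear_form (\<lambda>y. B [x, y, z]))
    \<Longrightarrow> (\<And>x y. linear_form (\<lambda>z. B [x, y, z]))
    \<Longrightarrow> pair3 (of_form 3 pair3 B) [x, y, z] = B [x, y, z]"
  using theI'[OF U3.pair_perfect[of B]] form3[of B] unfolding of_form_def by simp

lemma pair1_eqI: "(\<And>x. pair1 u [x] = pair1 v [x]) \<Longrightarrow> u = v"
  using U1.pair_perfect[OF U1.pair_multilinear[of u]] length_1_iff
  by (metis (mono_tags, lifting))

lemma word_eq_monomial: "prod_list (map (\<lambda>(i, j). T $ i $ j) w)
  = monomial T (map fst w) (map snd w)"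
  unfolding monomial_def by (induction w) auto

text \<open>As T generates the algebra, the monomials span it.\<close>

lemma monomial_induct:
  assumes "\<And>x y. P x \<Longrightarrow> P y \<Longrightarrow> P (x + y)" "\<And>c x. P x \<Longrightarrow> P (scaleX c x)"
    "\<And>I J. length J = length I \<Longrightarrow> P (monomial T I J)"
  shows "P x"
proof -
  obtain p where x: "x = evaluate scaleX T p" using X.generated by (metis surj_def)
  have "P (scaleX 0 (monomial T [] []))" by (intro assms(2,3)) simp
  then have 0: "P 0" by simp
  have "P (\<Sum>w\<in>S. scaleX (Poly_Mapping.lookup p w) (prod_list (map (\<lambda>(i, j). T $ i $ j) w)))" for S
    by (induction S rule: infinite_finite_induct)
      (auto simp: 0 word_eq_monomial intro!: assms)
  then show ?thesis by (simp add: x evaluate_def)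
qed

lemma linear_eqI:
  assumes "linear_form f" "linear_form g" "\<And>I J. length J = length I
    \<Longrightarrow> f (monomial T I J) = g (monomial T I J)"
  shows "f x = g x"
  by (rule monomial_induct[of "\<lambda>x. f x = g x"]) (use assms in \<open>auto simp: linear_form_def\<close>)

lemma pair1_monomial_eqI:
  "(\<And>I J. length J = length I \<Longrightarrow> pair1 u [monomial T I J] = pair1 v [monomial T I J]) \<Longrightarrow> u = v"
  by (rule pair1_eqI, rule linear_eqI[OF pair1_linear pair1_linear])

lemma pair1_mult: "length J = length I \<Longrightarrow> pair1 (u * v) [monomial T I J]
    = (\<Sum>K | length K = length I. pair1 u [monomial T I K] * pair1 v [monomial T K J])"
proof -
  assume J: "length J = length I"
  have "{Ks. map length Ks = [length I]} = (\<lambda>K. [K]) ` {K :: 'n list. length K = length I}"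
    by (auto simp: map_eq_Cons_conv)
  moreover have "inj_on (\<lambda>K. [K]) {K :: 'n list. length K = length I}" by (simp add: inj_on_def)
  ultimately show ?thesis
    using U1.pair_mult[of "[I]" "[J]" u v] J by (simp add: sum.reindex)
qed

lemma pair1_one: "length J = length I \<Longrightarrow> pair1 1 [monomial T I J] = (if I = J then 1 else 0)"
  using U1.pair_one[of "[I]" "[J]"] by simp

lemma pair2_mult: "length J = length I \<Longrightarrow> length B = length A \<Longrightarrow>
  pair2 (u * v) [monomial T I J, monomial T A B]
    = (\<Sum>K | length K = length I. \<Sum>C | length C = length A.
        pair2 u [monomial T I K, monomial T A C] * pair2 v [monomial T K J, monomial T C B])"
proof -
  assume J: "length J = length I" "length B = length A"
  have "{Ks. map length Ks = [length I, length A]}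
    = (\<lambda>(K, C). [K, C]) ` ({K :: 'n list. length K = length I} \<times> {C :: 'n list. length C =
      length A})"
    by (auto simp: map_eq_Cons_conv image_iff)
  moreover have "inj_on (\<lambda>(K, C). [K, C]) ({K :: 'n list. length K = length I} \<times> {C :: 'n list.
    length C = length A})"
    by (auto simp: inj_on_def)
  ultimately show ?thesis
    using U2.pair_mult[of "[I, A]" "[J, B]" u v] J
    by (simp add: sum.reindex sum.cartesian_product case_prod_unfold)
qed

lemma pair3_mult: "length J = length I \<Longrightarrow> length B = length A \<Longrightarrow> length B' = length A' \<Longrightarrow>
  pair3 (u * v) [monomial T I J, monomial T A B, monomial T A' B']
    = (\<Sum>K | length K = length I. \<Sum>C | length C = length A. \<Sum>C' | length C' = length A'.
        pair3 u [monomial T I K, monomial T A C, monomial T A' C']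
        * pair3 v [monomial T K J, monomial T C B, monomial T C' B'])"
proof -
  assume J: "length J = length I" "length B = length A" "length B' = length A'"
  let ?S = "{K :: 'n list. length K = length I} \<times> {C :: 'n list. length C = length A}
    \<times> {C :: 'n list. length C = length A'}"
  have "{Ks. map length Ks = [length I, length A, length A']} = (\<lambda>(K, C, C'). [K, C, C']) ` ?S"
    by (auto simp: map_eq_Cons_conv image_iff)
  moreover have "inj_on (\<lambda>(K, C, C'). [K, C, C']) ?S"
    by (auto simp: inj_on_def)
  ultimately show ?thesis
    using U3.pair_mult[of "[I, A, A']" "[J, B, B']" u v] J
    by (simp add: sum.reindex sum.cartesian_product case_prod_unfold)
qed

text \<open>The form \<open>\<langle>\<R>, x \<otimes> y\<rangle>\<close> and the two maps \<open>\<langle>\<R>, x\<rangle>\<^sub>2\<close> and \<open>\<langle>\<R>\<^sub>2\<^sub>1, x\<rangle>\<^sub>2\<close>.\<close>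

definition r :: "'x \<Rightarrow> 'x \<Rightarrow> 'k" where "r x y = pair2 \<R> [x, y]"
definition lp :: "'x \<Rightarrow> 'u" where "lp x = of_form 1 pair1 (\<lambda>ys. r (ys ! 0) x)"
definition lm :: "'x \<Rightarrow> 'u" where "lm x = of_form 1 pair1 (\<lambda>ys. r x (ys ! 0))"

lemma r_linear: "linear_form (\<lambda>x. r x y)" "linear_form (\<lambda>y. r x y)"
  unfolding r_def by (fact pair2_linear)+

lemma pair1_lp: "pair1 (lp x) [y] = r y x"
  unfolding lp_def by (subst of_form1) (simp_all add: r_linear)

lemma pair1_lm: "pair1 (lm x) [y] = r x y"
  unfolding lm_def by (subst of_form1) (simp_all add: r_linear)

lemma linear_form_mult: "linear_form f \<Longrightarrow> linear_form (\<lambda>x. f (x * y))" "linear_form f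
  \<Longrightarrow> linear_form (\<lambda>x. f (y * x))"
  by (simp_all add: linear_form_def distrib_left distrib_right X.scale_mult_left X.scale_mult_right)

lemma r_mult_linear:
  "linear_form (\<lambda>x. r (x * y) z)" "linear_form (\<lambda>x. r (y * x) z)"
  "linear_form (\<lambda>x. r z (x * y))" "linear_form (\<lambda>x. r z (y * x))"
  using linear_form_mult[of "\<lambda>x. r x z" y] linear_form_mult[of "\<lambda>x. r z x" y] r_linear by simp_all

lemma pair1_mult_linear: "linear_form (\<lambda>x. pair1 u [x * y])" "linear_form (\<lambda>x. pair1 u [y * x])"
  using linear_form_mult[of "\<lambda>x. pair1 u [x]" y] pair1_linear by simp_all

lemma linear_form_times: "linear_form f \<Longrightarrow> linear_form (\<lambda>x. f x * c)" "linear_form f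
  \<Longrightarrow> linear_form (\<lambda>x. c * f x)"
  by (simp_all add: linear_form_def algebra_simps)

lemma pair1_add: "pair1 (u + v) [x] = pair1 u [x] + pair1 v [x]"
  and pair1_scale: "pair1 (scaleU c u) [x] = c * pair1 u [x]"
  using U1.pair_linear[of "[x]"] unfolding linear_eq_additive[OF U1.U.assoc_algebra_axioms]
    by simp_all

lemma pair1_sum: "pair1 (\<Sum>i\<in>S. g i) [x] = (\<Sum>i\<in>S. pair1 (g i) [x])"
proof -
  have "pair1 0 [x] = 0" using pair1_scale[of 0 0 x] by simp
  then show ?thesis
    by (induction S rule: infinite_finite_induct) (simp_all add: pair1_add)
qed

lemma lp_linear: "lp (x + y) = lp x + lp y" "lp (scaleX c x) = scaleU c (lp x)"
  and lm_linear: "lm (x + y) = lm x + lm y" "lm (scaleX c x) = scaleU c (lm x)"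
  by (rule pair1_eqI; use r_linear in \<open>simp add: pair1_add pair1_scale pair1_lp pair1_lm
    linear_form_def\<close>)+

lemma delta_list:
  "length A = m \<Longrightarrow> (\<Sum>C | length C = m. (if A = C then 1 else 0) * g C) = (g A :: 'k)"
  "length A = m \<Longrightarrow> (\<Sum>C | length C = m. g C * (if A = C then 1 else 0)) = (g A :: 'k)"
  "length A = m \<Longrightarrow> (\<Sum>C | length C = m. g C * (if C = A then 1 else 0)) = (g A :: 'k)"
  for A :: "'n list"
  by (simp_all add: if_distrib if_distribR finite_lists_length cong: if_cong)

section \<open>Consequences of the coproduct axioms for the universal R-matrix\<close>

lemma pair3_coproduct_id: "pair3 (coproduct_id pair2 pair3 \<R>) [x, y, z] = r (x * y) z"
  unfolding coproduct_id_def
  by (subst of_form3) (simp_all add: r_def[symmetric] r_linear r_mult_linear)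

lemma pair3_id_coproduct: "pair3 (id_coproduct pair2 pair3 \<R>) [x, y, z] = r x (y * z)"
  unfolding id_coproduct_def
  by (subst of_form3) (simp_all add: r_def[symmetric] r_linear r_mult_linear)

lemma pair3_leg:
  "pair3 (leg pair1 pair2 pair3 0 2 1 \<R>) [x, y, z] = r x z * pair1 1 [y]"
  "pair3 (leg pair1 pair2 pair3 1 2 0 \<R>) [x, y, z] = r y z * pair1 1 [x]"
  "pair3 (leg pair1 pair2 pair3 0 1 2 \<R>) [x, y, z] = r x y * pair1 1 [z]"
  unfolding leg_def
  by (subst of_form3; simp add: r_def[symmetric] r_linear pair1_linear linear_form_times)+

text \<open>The axiom (\<Delta> \<otimes> id)(\<R>) = \<R>_13 \<R>_23, paired with monomials. The
  unit in the idle factor of each leg gives Kronecker deltas, which remove two of the three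
  sums.\<close>

lemma r_mult_left:
  assumes "length J = length I" "length B = length A" "length B' = length A'"
  shows "r (monomial T A B * monomial T A' B') (monomial T I J)
    = (\<Sum>K | length K = length I. r (monomial T A B) (monomial T I K) *
      r (monomial T A' B') (monomial T K J))"
proof -
  have "coproduct_id pair2 pair3 \<R> = leg pair1 pair2 pair3 0 2 1 \<R> * leg pair1 pair2 pair3 1 2 0 \<R>"
    using universal unfolding universal_R_matrix_def by blast
  then have "r (monomial T A B * monomial T A' B') (monomial T I J)
    = pair3 (leg pair1 pair2 pair3 0 2 1 \<R> * leg pair1 pair2 pair3 1 2 0 \<R>)
        [monomial T A B, monomial T A' B', monomial T I J]"
    using pair3_coproduct_id by metis
  also have "\<dots> = (\<Sum>C | length C = length A. \<Sum>C' | length C' = length A'. \<Sum>K | length K = length I.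
      (r (monomial T A C) (monomial T I K) * (if A' = C' then 1 else 0))
      * (r (monomial T C' B') (monomial T K J) * (if C = B then 1 else 0)))"
    by (subst pair3_mult, simp_all only: assms, intro sum.cong refl) (simp add: assms pair3_leg
      pair1_one del: One_nat_def)
  also have "\<dots> = (\<Sum>C | length C = length A. \<Sum>C' | length C' = length A'.
      (\<Sum>K | length K = length I. r (monomial T A C) (monomial T I K) *
        r (monomial T C' B') (monomial T K J))
        * (if A' = C' then 1 else 0) * (if C = B then 1 else 0))"
    by (simp add: sum_distrib_right sum_distrib_left mult_ac)
  also have "\<dots> = (\<Sum>K | length K = length I. r (monomial T A B) (monomial T I K) *
    r (monomial T A' B') (monomial T K J))"
    unfolding sum_distrib_right[symmetric] by (simp only: delta_list refl assms)
  finally show ?thesis .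
qed

text \<open>The axiom (id \<otimes> \<Delta>)(\<R>) = \<R>_13 \<R>_12, paired with monomials; note
  the reversed order of the factors.\<close>

lemma r_mult_right:
  assumes "length J = length I" "length B = length A" "length B' = length A'"
  shows "r (monomial T I J) (monomial T A B * monomial T A' B')
    = (\<Sum>K | length K = length I. r (monomial T I K) (monomial T A' B') *
      r (monomial T K J) (monomial T A B))"
proof -
  have "id_coproduct pair2 pair3 \<R> = leg pair1 pair2 pair3 0 2 1 \<R> * leg pair1 pair2 pair3 0 1 2 \<R>"
    using universal unfolding universal_R_matrix_def by blast
  then have "r (monomial T I J) (monomial T A B * monomial T A' B')
    = pair3 (leg pair1 pair2 pair3 0 2 1 \<R> * leg pair1 pair2 pair3 0 1 2 \<R>)
        [monomial T I J, monomial T A B, monomial T A' B']"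
    using pair3_id_coproduct by metis
  also have "\<dots> = (\<Sum>K | length K = length I. \<Sum>C | length C = length A. \<Sum>C' | length C' = length A'.
      (r (monomial T I K) (monomial T A' C') * (if A = C then 1 else 0))
      * (r (monomial T K J) (monomial T C B) * (if C' = B' then 1 else 0)))"
    by (subst pair3_mult, simp_all only: assms, intro sum.cong refl) (simp add: assms pair3_leg
      pair1_one del: One_nat_def)
  also have "\<dots> = (\<Sum>K | length K = length I. \<Sum>C | length C = length A.
      (\<Sum>C' | length C' = length A'. (r (monomial T I K) (monomial T A' C') *
        r (monomial T K J) (monomial T C B))
        * (if C' = B' then 1 else 0)) * (if A = C then 1 else 0))"
    by (simp add: sum_distrib_right sum_distrib_left mult_ac)
  also have "\<dots> = (\<Sum>K | length K = length I. r (monomial T I K) (monomial T A' B') *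
    r (monomial T K J) (monomial T A B))"
    by (simp only: delta_list refl assms)
  finally show ?thesis .
qed

text \<open>The reversed order in \<open>r_mult_right\<close> makes \<open>lp\<close>
  antimultiplicative, whereas \<open>lm\<close> is multiplicative. Hence the decreasing product of
  the matrices L^+ in the image of T_1 ... T_k.\<close>

lemma lp_mult: "lp (x * y) = lp y * lp x"
proof (induction x rule: monomial_induct)
  case (3 A B)
  show ?case
  proof (induction y rule: monomial_induct)
    case (3 A' B')
    with \<open>length B = length A\<close> show ?case
      by (intro pair1_monomial_eqI) (simp add: pair1_lp pair1_mult r_mult_right)
  qed (simp_all add: lp_linear distrib_left distrib_right X.scale_mult_right U1.U.scale_mult_left)
qed (simp_all add: lp_linear distrib_left distrib_right X.scale_mult_left U1.U.scale_mult_right)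

lemma lm_mult: "lm (x * y) = lm x * lm y"
proof (induction x rule: monomial_induct)
  case (3 A B)
  show ?case
  proof (induction y rule: monomial_induct)
    case (3 A' B')
    with \<open>length B = length A\<close> show ?case
      by (intro pair1_monomial_eqI) (simp add: pair1_lm pair1_mult r_mult_left)
  qed (simp_all add: lm_linear distrib_left distrib_right X.scale_mult_right U1.U.scale_mult_right)
qed (simp_all add: lm_linear distrib_left distrib_right X.scale_mult_left U1.U.scale_mult_left)

abbreviation phi :: "'x \<Rightarrow> 'u" where "phi \<equiv> factorization_map pair1 pair2 \<R>"

lemma pair1_phi: "pair1 (phi x) [y] = pair2 (flip pair2 \<R> * \<R>) [y, x]"
  unfolding factorization_map_def
  by (subst of_form1) (simp_all add: pair2_linear)

lemma phi_linear: "phi (x + y) = phi x + phi y" "phi (scaleX c x) = scaleU c (phi x)"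
  by (rule pair1_eqI; use pair2_linear in \<open>simp add: pair1_add pair1_scale pair1_phi
    linear_form_def\<close>)+

lemma pair2_flip: "pair2 (flip pair2 w) [x, y] = pair2 w [y, x]"
  unfolding flip_def by (subst of_form2) (simp_all add: pair2_linear)

text \<open>The product in the second leg is dual to the coproduct of the monomial; \<R>_21 receives
  its first part and \<R> its second.\<close>

lemma phi_monomial:
  assumes "length B = length A"
  shows "phi (monomial T A B) = (\<Sum>C | length C = length A. lm (monomial T A C) *
    lp (monomial T C B))"
proof (rule pair1_monomial_eqI)
  fix I J :: "'n list" assume J: "length J = length I"
  have "pair1 (phi (monomial T A B)) [monomial T I J]
    = (\<Sum>K | length K = length I. \<Sum>C | length C = length A.
        r (monomial T A C) (monomial T I K) * r (monomial T K J) (monomial T C B))"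
    by (simp add: pair1_phi pair2_mult J assms pair2_flip r_def)
  also have "\<dots> = (\<Sum>C | length C = length A. \<Sum>K | length K = length I.
        r (monomial T A C) (monomial T I K) * r (monomial T K J) (monomial T C B))"
    by (rule sum.swap)
  finally show "pair1 (phi (monomial T A B)) [monomial T I J]
    = pair1 (\<Sum>C | length C = length A. lm (monomial T A C) * lp (monomial T C B)) [monomial T I J]"
    by (simp add: pair1_sum pair1_mult J pair1_lm pair1_lp)
qed

lemma T_eq_monomial: "T $ i $ j = monomial T [i] [j]"
  by (simp add: monomial_def)

lemma sum_singletons: "(\<Sum>K | length K = Suc 0. g K) = (\<Sum>m\<in>(UNIV :: 'n set). g [m])"
  using sum_lists_Suc[of g 0] by simp

text \<open>P exchanges the two row indices of R, hence the order of \<open>k\<close> and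
  \<open>i\<close>.\<close>

lemma r_T: "r (T $ i $ j) (T $ k $ l) = R $ (k, i) $ (j, l)"
proof -
  have "permutation_matrix $ (i, k) $ p * x = (if p = (k, i) then x else 0)" for p and x :: 'k
    by (cases p) (auto simp: permutation_matrix_def)
  then have "(permutation_matrix ** R) $ (i, k) $ (j, l) = R $ (k, i) $ (j, l)"
    by (simp add: matrix_matrix_mult_def)
  then show ?thesis using image by (auto simp: r_def rep_image_def vec_eq_iff)
qed

section \<open>The exchange relation for L^+ and L^-\<close>

lemma pair2_coproduct: "pair2 (coproduct pair1 pair2 u) [x, y] = pair1 u [x * y]"
  unfolding coproduct_def by (subst of_form2) (simp_all add: pair1_mult_linear)

text \<open>The relation \<R> \<Delta>(u) = \<Delta>^op(u) \<R> for u =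
  \<open>lp (T $ a $ d)\<close>, paired with an entry of T and a monomial. The coproduct of this u
  is again expressed through the form \<open>r\<close>, by \<open>r_mult_left\<close>.\<close>

lemma r_yang_baxter:
  assumes J: "length J = length I"
  shows "(\<Sum>K | length K = length I. \<Sum>m\<in>UNIV. \<Sum>n\<in>UNIV.
      r (monomial T I K) (T $ a $ m) * R $ (m, b) $ (n, d) * r (T $ n $ c) (monomial T K J))
    = (\<Sum>K | length K = length I. \<Sum>m\<in>UNIV. \<Sum>n\<in>UNIV.
      r (T $ b $ m) (monomial T I K) * R $ (a, m) $ (c, n) * r (monomial T K J) (T $ n $ d))"
proof -
  let ?u = "lp (T $ a $ d)"
  have 1: "r (T $ n $ c * monomial T K J) (T $ a $ d)
    = (\<Sum>m\<in>UNIV. R $ (a, n) $ (c, m) * r (monomial T K J) (T $ m $ d))" if "length K = length I"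
      for n K
    using r_mult_left[of "[d]" "[a]" "[c]" "[n]" J K] that J
    by (simp add: T_eq_monomial[symmetric] sum_singletons r_T)
  have 2: "r (monomial T I K * T $ b $ n) (T $ a $ d)
    = (\<Sum>m\<in>UNIV. r (monomial T I K) (T $ a $ m) * R $ (m, b) $ (n, d))" if "length K = length I"
      for n K
    using r_mult_left[of "[d]" "[a]" K I "[n]" "[b]"] that J
    by (simp add: T_eq_monomial[symmetric] sum_singletons r_T)
  have pm: "pair2 (u * v) [T $ b $ c, monomial T I J] = (\<Sum>m\<in>UNIV. \<Sum>K | length K = length I.
      pair2 u [T $ b $ m, monomial T I K] * pair2 v [T $ m $ c, monomial T K J])" for u v
    using pair2_mult[of "[c]" "[b]" J I u v] J
    by (simp add: sum_singletons T_eq_monomial[symmetric])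
  have "\<R> * coproduct pair1 pair2 ?u = flip pair2 (coproduct pair1 pair2 ?u) * \<R>"
    using universal unfolding universal_R_matrix_def by blast
  then have "pair2 (\<R> * coproduct pair1 pair2 ?u) [T $ b $ c, monomial T I J]
    = pair2 (flip pair2 (coproduct pair1 pair2 ?u) * \<R>) [T $ b $ c, monomial T I J]" by simp
  then have "(\<Sum>m\<in>UNIV. \<Sum>K | length K = length I. r (T $ b $ m) (monomial T I K) * r (T $ m $ c *
    monomial T K J) (T $ a $ d))
    = (\<Sum>m\<in>UNIV. \<Sum>K | length K = length I. r (monomial T I K * T $ b $ m) (T $ a $ d) * r (T $
      m $ c) (monomial T K J))"
    by (simp add: pm pair2_flip pair2_coproduct pair1_lp r_def[symmetric])
  then have eq: "(\<Sum>K | length K = length I. \<Sum>m\<in>UNIV. r (T $ b $ m) (monomial T I K) * r (T $ m $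
    c * monomial T K J) (T $ a $ d))
    = (\<Sum>K | length K = length I. \<Sum>m\<in>UNIV. r (monomial T I K * T $ b $ m) (T $ a $ d) * r (T $
      m $ c) (monomial T K J))"
    by (simp only: sum.swap[where A = "UNIV :: 'n set" and B = "{K :: 'n list. length K =
      length I}"])
  have "(\<Sum>K | length K = length I. \<Sum>m\<in>UNIV. \<Sum>n\<in>UNIV.
      r (T $ b $ m) (monomial T I K) * R $ (a, m) $ (c, n) * r (monomial T K J) (T $ n $ d))
    = (\<Sum>K | length K = length I. \<Sum>m\<in>UNIV. r (T $ b $ m) (monomial T I K) * r (T $ m $ c *
      monomial T K J) (T $ a $ d))"
    by (intro sum.cong refl) (simp add: 1 sum_distrib_left mult.assoc)
  also note eq
  also have "(\<Sum>K | length K = length I. \<Sum>m\<in>UNIV. r (monomial T I K * T $ b $ m) (T $ a $ d) *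
    r (T $ m $ c) (monomial T K J))
    = (\<Sum>K | length K = length I. \<Sum>n\<in>UNIV. \<Sum>m\<in>UNIV.
      r (monomial T I K) (T $ a $ m) * R $ (m, b) $ (n, d) * r (T $ n $ c) (monomial T K J))"
    by (intro sum.cong refl) (simp add: 2 sum_distrib_right)
  also have "\<dots> = (\<Sum>K | length K = length I. \<Sum>m\<in>UNIV. \<Sum>n\<in>UNIV.
      r (monomial T I K) (T $ a $ m) * R $ (m, b) $ (n, d) * r (T $ n $ c) (monomial T K J))"
    by (intro sum.cong refl sum.swap)
  finally show ?thesis ..
qed

lemma emb_times: "emb scaleU c * u = scaleU c u" "emb scaleX c * x = scaleX c x"
  by (simp_all add: emb_def U1.U.scale_mult_left X.scale_mult_left)

text \<open>Paired with a monomial this is \<open>r_yang_baxter\<close>; as an equation between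
  matrices it is the exchange relation of the overview.\<close>

lemma lp_lm_exchange:
  "(\<Sum>m\<in>UNIV. \<Sum>n\<in>UNIV. lp (T $ a $ m) * (emb scaleU (R $ (m, b) $ (n, d)) * lm (T $ n $ c)))
    = (\<Sum>m\<in>UNIV. \<Sum>n\<in>UNIV. lm (T $ b $ m) * (emb scaleU (R $ (a, m) $ (c, n)) * lp (T $ n $ d)))"
proof (rule pair1_monomial_eqI)
  fix I J :: "'n list" assume J: "length J = length I"
  have swap: "(\<Sum>m\<in>UNIV. \<Sum>n\<in>UNIV. \<Sum>K | length K = length I. g m n K)
    = (\<Sum>K | length K = length I. \<Sum>m\<in>UNIV. \<Sum>n\<in>UNIV. g m n K)" for g :: "'n \<Rightarrow> 'n \<Rightarrow> 'n list \<Rightarrow> 'k"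
  proof -
    have "(\<Sum>m\<in>UNIV. \<Sum>n\<in>UNIV. \<Sum>K | length K = length I. g m n K)
      = (\<Sum>m\<in>UNIV. \<Sum>K | length K = length I. \<Sum>n\<in>UNIV. g m n K)"
      by (intro sum.cong refl sum.swap)
    also have "\<dots> = (\<Sum>K | length K = length I. \<Sum>m\<in>UNIV. \<Sum>n\<in>UNIV. g m n K)"
      by (rule sum.swap)
    finally show ?thesis .
  qed
  show "pair1 (\<Sum>m\<in>UNIV. \<Sum>n\<in>UNIV. lp (T $ a $ m) * (emb scaleU (R $ (m, b) $ (n, d)) * lm (T $
    n $ c))) [monomial T I J]
    = pair1 (\<Sum>m\<in>UNIV. \<Sum>n\<in>UNIV. lm (T $ b $ m) * (emb scaleU (R $ (a, m) $ (c, n)) * lp (T $ n $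
      d))) [monomial T I J]"
    using r_yang_baxter[OF J, of a b d c]
    by (simp add: pair1_sum pair1_mult J pair1_lm pair1_lp emb_times pair1_scale swap mult.assoc)
qed

lemma Tchain_eq_first: "chain (\<lambda>i. on1 i T) 0 k = first k (monomial T)"
proof (induction k)
  case 0
  show ?case by (rule oper_eqI) (auto simp: entry_simps first.rep_eq monomial_def fun_eq_iff)
next
  case (Suc k)
  show ?case
  proof (rule oper_eqI)
    fix I J :: "nat \<Rightarrow> 'n"
    have "triv k (first k (monomial T))" by (rule triv_first) simp
    then have e: "entry (first k (monomial T) * on1 k T) I J
      = (\<Sum>a\<in>{I k}. entry (first k (monomial T)) I (J(k := a)) * T $ a $ J k)"
      unfolding entry_times_on1 by (intro sum.mono_neutral_right) (auto simp: triv_0)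
    have agree: "(\<forall>m\<ge>k. I m = (J(k := I k)) m) \<longleftrightarrow> (\<forall>m\<ge>Suc k. I m = J m)"
    proof (intro iffI allI impI)
      fix m assume "\<forall>m\<ge>k. I m = (J(k := I k)) m" "Suc k \<le> m"
      then have "I m = (J(k := I k)) m" by (metis Suc_leD)
      then show "I m = J m" using \<open>Suc k \<le> m\<close> by simp
    next
      fix m assume "\<forall>m\<ge>Suc k. I m = J m" "k \<le> m"
      then show "I m = (J(k := I k)) m"
        by (cases "m = k") (simp, metis Suc_leI fun_upd_other le_neq_implies_less)
    qed
    have map: "map (J(k := I k)) [0..<k] = map J [0..<k]" by auto
    have mono: "monomial T (map I [0..<Suc k]) (map J [0..<Suc k])
      = monomial T (map I [0..<k]) (map J [0..<k]) * T $ I k $ J k"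
      by (simp add: monomial_def)
    show "entry (chain (\<lambda>i. on1 i T) 0 (Suc k)) I J = entry (first (Suc k) (monomial T)) I J"
      unfolding chain.simps Suc add_0 e first.rep_eq agree map mono
      by (auto simp: first.rep_eq agree map simp del: upt_Suc fun_upd_apply)
  qed
qed

end

context tensor_setting
begin

text \<open>It suffices to move the accumulated factors P past the next copy of L, which is
  \<open>Q\<close>. There \<open>exch\<close> turns P_k R_k M_k into M_(k+1) R_k P_(k+1), and
  \<open>PP\<close> then brings R_k next to its inverse.\<close>

lemma Lchain_factor:
  assumes exch: "on1 0 P * rr 0 * on1 0 M = on1 1 M * rr 0 * on1 1 P"
    and PP: "on1 1 P * on1 0 P * rr 0 = rr 0 * (on1 1 P * on1 0 P)"
  shows "Lchain (M ** P) k = chain (\<lambda>i. on1 i M) 0 k * rchain (\<lambda>i. on1 i P) 0 k"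
proof -
  let ?P = "\<lambda>i. on1 i P :: ('n, 'a) oper" and ?M = "\<lambda>i. on1 i M :: ('n, 'a) oper"
  have exch: "?P i * rr i * ?M i = ?M (Suc i) * rr i * ?P (Suc i)" for i
  proof (induction i)
    case (Suc i)
    show ?case using arg_cong[OF Suc, of shift] by (simp only: shift_times shift_on1 shift_rr)
  qed (use exch in simp)
  have PP: "?P (Suc i) * ?P i * rr i = rr i * (?P (Suc i) * ?P i)" for i
  proof (induction i)
    case (Suc i)
    show ?case using arg_cong[OF Suc, of shift] by (simp only: shift_times shift_on1 shift_rr)
  qed (use PP in simp)
  have Q: "rchain ?P 0 k * Lcopy (M ** P) k = ?M k * ?P k * rchain ?P 0 k" for k
  proof (induction k)
    case 0
    show ?case by (simp add: Lcopy_def on1_mult)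
  next
    case (Suc k)
    let ?Q = "rchain ?P 0 k"
    have c: "?Q * rr k = rr k * ?Q"
      by (rule rr_commute[symmetric]; rule triv_rchain) auto
    have c': "?Q * rr' k = rr' k * ?Q"
      by (rule rr'_commute[symmetric]; rule triv_rchain) auto
    have "rchain ?P 0 (Suc k) * Lcopy (M ** P) (Suc k)
      = ?P k * (?Q * rr k) * Lcopy (M ** P) k * rr' k"
      by (simp add: Lcopy_Suc mult.assoc)
    also have "\<dots> = ?P k * rr k * (?Q * Lcopy (M ** P) k) * rr' k"
      unfolding c by (simp only: mult.assoc)
    also have "\<dots> = (?P k * rr k * ?M k) * ?P k * (?Q * rr' k)"
      unfolding Suc by (simp only: mult.assoc)
    also have "\<dots> = ?M (Suc k) * (rr k * (?P (Suc k) * ?P k)) * rr' k * ?Q"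
      unfolding exch c' by (simp only: mult.assoc)
    also have "\<dots> = ?M (Suc k) * (?P (Suc k) * ?P k) * (rr k * rr' k) * ?Q"
      unfolding PP[symmetric] by (simp only: mult.assoc)
    finally show ?case by (simp add: rr_inv mult.assoc)
  qed
  show ?thesis
  proof (induction k)
    case (Suc k)
    have "Lchain (M ** P) (Suc k) = chain ?M 0 k * (rchain ?P 0 k * Lcopy (M ** P) k)"
      using Suc by (simp add: Lchain_def mult.assoc)
    then show ?case unfolding Q by (simp add: mult.assoc)
  qed (simp add: Lchain_def)
qed

end

section \<open>Operators in two copies by entries, and evaluation of words\<close>

lemma sum_pair_fst':
  "(\<Sum>p\<in>UNIV. (if j = fst p then g p else 0) * h p) = (\<Sum>d\<in>UNIV. g (j, d) * h (j, d))"
  for h :: "'n::finite \<times> 'n \<Rightarrow> 'a::semiring_0"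
proof -
  have "(\<Sum>p\<in>UNIV. (if j = fst p then g p else 0) * h p)
    = (\<Sum>c\<in>UNIV. if j = c then \<Sum>d\<in>UNIV. g (c, d) * h (c, d) else 0)"
    unfolding sum_pair by (rule sum.cong) auto
  then show ?thesis by simp
qed

lemma sum_pair_snd':
  "(\<Sum>p\<in>UNIV. (if j = snd p then g p else 0) * h p) = (\<Sum>d\<in>UNIV. g (d, j) * h (d, j))"
  for h :: "'n::finite \<times> 'n \<Rightarrow> 'a::semiring_0"
proof -
  have "(\<Sum>p\<in>UNIV. (if j = snd p then g p else 0) * h p)
    = (\<Sum>d\<in>UNIV. \<Sum>c\<in>UNIV. if j = c then g (d, c) * h (d, c) else 0)"
    unfolding sum_pair by (intro sum.cong) auto
  then show ?thesis by simp
qed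

lemma on1_eq_on2_fst:
  "on1 i A = on2 i (\<chi> p r. if snd p = snd r then A $ fst p $ fst r else 0)"
proof (rule oper_eqI)
  fix I J :: "nat \<Rightarrow> 'a"
  have "(\<forall>m. m \<noteq> i \<longrightarrow> I m = J m) \<longleftrightarrow> (\<forall>m. m \<noteq> i \<and> m \<noteq> Suc i \<longrightarrow> I m = J m) \<and> I (Suc i) = J (Suc i)"
    by (metis n_not_Suc_n)
  then show "entry (on1 i A) I J = entry (on2 i (\<chi> p r.
    if snd p = snd r then A $ fst p $ fst r else 0)) I J"
    by (auto simp: on1.rep_eq on2.rep_eq)
qed

lemma on1_eq_on2_snd:
  "on1 (Suc i) A = on2 i (\<chi> p r. if fst p = fst r then A $ snd p $ snd r else 0)"
proof (rule oper_eqI)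
  fix I J :: "nat \<Rightarrow> 'a"
  have "(\<forall>m. m \<noteq> Suc i \<longrightarrow> I m = J m) \<longleftrightarrow> (\<forall>m. m \<noteq> i \<and> m \<noteq> Suc i \<longrightarrow> I m = J m) \<and> I i = J i"
    by (metis n_not_Suc_n)
  then show "entry (on1 (Suc i) A) I J = entry (on2 i (\<chi> p r.
    if fst p = fst r then A $ snd p $ snd r else 0)) I J"
    by (auto simp: on1.rep_eq on2.rep_eq)
qed

lemma on1_times_on1_Suc:
  "on1 i A * on1 (Suc i) B = (on2 i (\<chi> p r. A $ fst p $ fst r * B $ snd p $ snd
    r) :: ('n::finite, 'a::ring_1) oper)"
  unfolding on1_eq_on2_fst[of i A] on1_eq_on2_snd[of i B] on2_mult[symmetric] on2_inject
  by (simp add: vec_eq_iff matrix_matrix_mult_def sum_pair_fst)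
    (simp add: if_distrib[of "\<lambda>t. t * y" for y] cong: if_cong)

context assoc_algebra
begin

lemma evaluate_eq_sum:
  "finite S \<Longrightarrow> Poly_Mapping.keys p \<subseteq> S \<Longrightarrow> evaluate sc T p
    = (\<Sum>w\<in>S. sc (Poly_Mapping.lookup p w) (prod_list (map (\<lambda>(i, j). T $ i $ j) w)))"
  unfolding evaluate_def by (rule sum.mono_neutral_left) (auto simp: in_keys_iff)

lemma evaluate_add: "evaluate sc T (p + r) = evaluate sc T p + evaluate sc T r"
proof -
  let ?S = "Poly_Mapping.keys p \<union> Poly_Mapping.keys r"
  have S: "finite ?S" "Poly_Mapping.keys p \<subseteq> ?S" "Poly_Mapping.keys r \<subseteq> ?S" by auto
  show ?thesis
    unfolding evaluate_eq_sum[OF S(1) Poly_Mapping.keys_add] evaluate_eq_sum[OF S(1,2)]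
      evaluate_eq_sum[OF S(1,3)]
    by (simp add: lookup_add scale_left_distrib sum.distrib)
qed

lemma evaluate_diff: "evaluate sc T (p - r) = evaluate sc T p - evaluate sc T r"
  using evaluate_add[of T "p - r" r] by simp

lemma evaluate_sum: "evaluate sc T (\<Sum>i\<in>S. p i) = (\<Sum>i\<in>S. evaluate sc T (p i))"
  by (induction S rule: infinite_finite_induct) (simp_all add: evaluate_add, simp_all add:
    evaluate_def)

lemma evaluate_single:
  "evaluate sc T (Poly_Mapping.single w c) = sc c (prod_list (map (\<lambda>(i, j). T $ i $ j) w))"
  by (subst evaluate_eq_sum[where S = "{w}"]) auto

end

text \<open>The same numerical data over two coefficient algebras: \<open>XS\<close> is for T and
  \<open>US\<close> for L.\<close>

locale chn_setting =
  factorization R scaleX T scaleU pair1 scaleU2 pair2 scaleU3 pair3 \<R> +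
  XS: list_setting R R' D q scaleX + US: list_setting R R' D q scaleU
  for R R' :: "'k::field^('n::finite \<times> 'n)^('n \<times> 'n)" and D :: "'k^'n^'n" and q :: 'k
    and scaleX :: "'k \<Rightarrow> 'x::ring_1 \<Rightarrow> 'x" and T :: "'x^'n^'n"
    and scaleU :: "'k \<Rightarrow> 'u::ring_1 \<Rightarrow> 'u" and pair1 :: "'u \<Rightarrow> 'x list \<Rightarrow> 'k"
    and scaleU2 :: "'k \<Rightarrow> 'v::ring_1 \<Rightarrow> 'v" and pair2 :: "'v \<Rightarrow> 'x list \<Rightarrow> 'k"
    and scaleU3 :: "'k \<Rightarrow> 'w::ring_1 \<Rightarrow> 'w" and pair3 :: "'w \<Rightarrow> 'x list \<Rightarrow> 'k"
    and \<R> :: 'v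
begin

definition LL :: "'u^'n^'n" where "LL = map_matrix phi T"
definition Lp :: "'u^'n^'n" where "Lp = map_matrix lp T"
definition Lm :: "'u^'n^'n" where "Lm = map_matrix lm T"

lemma zero: "phi 0 = 0" "lp 0 = 0" "lm 0 = 0"
  using phi_linear(2)[of 0 0] lp_linear(2)[of 0 0] lm_linear(2)[of 0 0] by simp_all

lemma phi_emb: "phi (emb scaleX c * x) = emb scaleU c * phi x" "phi (x * emb scaleX c)
  = phi x * emb scaleU c"
  by (simp_all add: XS.e_central[symmetric] US.e_central[symmetric] emb_times phi_linear)

lemma lp_emb: "lp (emb scaleX c * x) = emb scaleU c * lp x" "lp (x * emb scaleX c)
  = lp x * emb scaleU c"
  by (simp_all add: XS.e_central[symmetric] US.e_central[symmetric] emb_times lp_linear)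

text \<open>A field embeds injectively into a nonzero ring, so a vanishing entry over one algebra
  comes from the number 0 and vanishes over the other too.\<close>

lemma lift_supp: "entry (XS.lift N) I J = 0 \<Longrightarrow> entry (US.lift N) I J = 0"
proof -
  assume "entry (XS.lift N) I J = 0"
  then have "emb scaleX (entry N I J) = 0" by (simp add: entry_map_oper)
  then have "entry N I J = 0"
    by (metis XS.e_1 XS.e_mult left_inverse mult_zero_right zero_neq_one)
  then show ?thesis by (simp add: entry_map_oper)
qed

text \<open>Only numerical operators can be pulled out of \<open>\<phi>\<close>, since it is merely
  linear.\<close>

lemma map_phi_left: "map_oper phi (XS.lift N * Y) = US.lift N * map_oper phi Y"
  by (rule map_oper_times_eq, rule phi_linear, erule lift_supp) (simp add: phi_emb zero
    entry_map_oper)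

lemma map_phi_right: "map_oper phi (Y * XS.lift N) = map_oper phi Y * US.lift N"
  by (rule map_oper_times_eq) (auto simp: phi_linear phi_emb zero entry_map_oper)

lemma map_lp_left: "map_oper lp (XS.lift N * Y) = US.lift N * map_oper lp Y"
  by (rule map_oper_times_eq, rule lp_linear, erule lift_supp) (simp add: lp_emb zero
    entry_map_oper)

lemma map_lp_right: "map_oper lp (Y * XS.lift N) = map_oper lp Y * US.lift N"
  by (rule map_oper_times_eq) (auto simp: lp_linear lp_emb zero entry_map_oper)

lemma map_phi_qtrs: "map_oper phi (XS.qtrs a m X) = US.qtrs a m (map_oper phi X)"
proof (induction m arbitrary: X)
  case (Suc m)
  have "map_oper phi (XS.qtr i X) = US.qtr i (map_oper phi X)" for i
    unfolding XS.qtr_def US.qtr_def XS.lift_on(3)[symmetric] US.lift_on(3)[symmetric]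
    by (simp add: map_oper_ptrace phi_linear map_phi_left)
  then show ?case by (simp add: Suc)
qed simp

text \<open>As X ignores copy \<open>k\<close>, each entry of the product is a single product of
  coefficients, and the antimultiplicative \<open>lp\<close> reverses it.\<close>

lemma map_lp_on1:
  assumes X: "triv k X"
  shows "map_oper lp (X * on1 k T) = on1 k Lp * map_oper lp X"
proof (rule oper_eqI)
  fix I J :: "nat \<Rightarrow> 'n"
  have X': "triv k (map_oper lp X)" using X zero(2) by (rule triv_map_oper)
  have "entry (X * on1 k T) I J = (\<Sum>a\<in>{I k}. entry X I (J(k := a)) * T $ a $ J k)"
    unfolding entry_times_on1 by (intro sum.mono_neutral_right) (auto simp: triv_0[OF X])
  moreover have "entry (on1 k Lp * map_oper lp X) I J
    = (\<Sum>a\<in>{J k}. Lp $ I k $ a * entry (map_oper lp X) (I(k := a)) J)"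
    unfolding entry_on1_times by (intro sum.mono_neutral_right) (auto simp: triv_0[OF X'])
  ultimately show "entry (map_oper lp (X * on1 k T)) I J = entry (on1 k Lp * map_oper lp X) I J"
    by (simp add: entry_map_oper zero lp_mult triv_swap[OF X] Lp_def map_matrix_def)
qed

text \<open>Stated for at least one factor, so that the value of \<open>lp\<close> at 1 does not
  enter.\<close>

lemma map_lp_Tchain: "map_oper lp (XS.Tchain T (Suc k)) = rchain (\<lambda>i. on1 i Lp) 0 (Suc k)"
proof (induction k)
  case 0
  show ?case by (simp add: XS.Tchain_def map_oper_on1 zero Lp_def)
next
  case (Suc k)
  have "map_oper lp (XS.Tchain T (Suc k) * on1 (Suc k) T)
    = on1 (Suc k) Lp * map_oper lp (XS.Tchain T (Suc k))"
    by (rule map_lp_on1, rule XS.triv_Tchain) simp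
  then show ?case unfolding Suc by (simp add: XS.Tchain_def)
qed

lemma map_lm_Tchain: "map_oper lm (XS.Tchain T (Suc k)) = chain (\<lambda>i. on1 i Lm) 0 (Suc k)"
proof (induction k)
  case 0
  show ?case by (simp add: XS.Tchain_def map_oper_on1 zero Lm_def)
next
  case (Suc k)
  have "map_oper lm (XS.Tchain T (Suc k) * on1 (Suc k) T)
    = map_oper lm (XS.Tchain T (Suc k)) * map_oper lm (on1 (Suc k) T)"
    by (rule map_oper_times) (simp_all add: lm_linear lm_mult zero)
  then show ?case unfolding Suc by (simp add: XS.Tchain_def map_oper_on1 zero Lm_def)
qed

lemma map_phi_Tchain_factor:
  "map_oper phi (XS.Tchain T k) = map_oper lm (XS.Tchain T k) * map_oper lp (XS.Tchain T k)"
proof -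
  have T: "XS.Tchain T k = first k (monomial T)" unfolding XS.Tchain_def by (rule Tchain_eq_first)
  have "first k (\<lambda>I J. phi (monomial T I J))
    = first k (tmult k (\<lambda>I J. lm (monomial T I J)) (\<lambda>I J. lp (monomial T I J)))"
    by (rule oper_eqI) (auto simp: first.rep_eq tmult_def phi_monomial)
  then show ?thesis unfolding T by (simp add: map_oper_first zero first_tmult)
qed

lemma rtt: "XS.rr 0 * (on1 0 T * on1 1 T) = on1 0 T * on1 1 T * XS.rr 0"
proof -
  have "rtt_element R 1 [] [] a b c d \<in> rtt_ideal R" for a b c d
    using rtt_ideal.add[OF rtt_ideal.zero, of R 1 "[]" "[]" a b c d] by simp
  then have "evaluate scaleX T (rtt_element R 1 [] [] a b c d) = 0" for a b c d
    using X.presented by blast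
  then have "(\<Sum>m\<in>UNIV. \<Sum>n\<in>UNIV. scaleX (R $ (a, b) $ (m, n)) (T $ m $ c * T $ n $ d))
    = (\<Sum>m\<in>UNIV. \<Sum>n\<in>UNIV. scaleX (R $ (m, n) $ (c, d)) (T $ a $ m * T $ b $ n))" for a b c d
    by (simp add: rtt_element_def X.evaluate_diff X.evaluate_sum X.evaluate_single)
  then show ?thesis
    unfolding XS.rr_def One_nat_def on1_times_on1_Suc on2_mult[symmetric] on2_inject
    by (simp add: vec_eq_iff matrix_matrix_mult_def sum_pair
      map_matrix_def XS.e_central[symmetric] emb_times)
qed

lemma Lm_Lp: "LL = Lm ** Lp"
proof -
  have "on1 0 LL = map_oper phi (XS.Tchain T (Suc 0))"
    by (simp add: LL_def XS.Tchain_def map_oper_on1 zero)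
  also have "\<dots> = on1 0 (Lm ** Lp)"
    unfolding map_phi_Tchain_factor map_lm_Tchain map_lp_Tchain by (simp add: on1_mult)
  finally show ?thesis by (simp add: on1_inject)
qed

lemma exchange: "on1 0 Lp * US.rr 0 * on1 0 Lm = on1 1 Lm * US.rr 0 * on1 1 Lp"
  unfolding US.rr_def One_nat_def on1_eq_on2_fst[of 0] on1_eq_on2_snd[of 0] on2_mult[symmetric]
    on2_inject
    matrix_mul_assoc[symmetric]
  by (simp add: vec_eq_iff matrix_matrix_mult_def sum_pair_fst sum_pair_snd sum_pair_fst'
    sum_pair_snd'
      map_matrix_def Lp_def Lm_def)
    (simp add: sum_distrib_left lp_lm_exchange)

text \<open>The image of the RTT relations under \<open>lp\<close>, with the factors T reversed and
  the numerical R kept on its side.\<close>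

lemma Lp_Lp: "on1 1 Lp * on1 0 Lp * US.rr 0 = US.rr 0 * (on1 1 Lp * on1 0 Lp)"
proof -
  have T2: "XS.Tchain T (Suc (Suc 0)) = on1 0 T * on1 1 T" by (simp add: XS.Tchain_def)
  have "map_oper lp (XS.Tchain T (Suc (Suc 0)) * XS.lift (on2 0 R))
    = map_oper lp (XS.lift (on2 0 R) * XS.Tchain T (Suc (Suc 0)))"
    unfolding T2 using rtt by (simp add: XS.lift_on)
  then show ?thesis
    unfolding map_lp_left map_lp_right map_lp_Tchain US.lift_on by simp
qed

lemma map_phi_Tchain: "map_oper phi (XS.Tchain T (Suc k)) = US.Lchain LL (Suc k)"
  unfolding map_phi_Tchain_factor map_lp_Tchain map_lm_Tchain Lm_Lp
  by (rule US.Lchain_factor[symmetric]) (fact exchange Lp_Lp)+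

text \<open>Apply \<open>\<phi>\<close> to the commutation of R_i with T_1 ... T_k. Linearity is
  enough, because R_i is numerical.\<close>

lemma Lchain_commute: "Suc i < k \<Longrightarrow> US.rr i * US.Lchain LL k = US.Lchain LL k * US.rr i"
proof -
  assume "Suc i < k"
  then obtain k' where k: "k = Suc k'" by (cases k) auto
  have "XS.lift (on2 i R) * XS.Tchain T k = XS.Tchain T k * XS.lift (on2 i R)"
    unfolding XS.lift_on using rtt \<open>Suc i < k\<close> by (rule XS.Tchain_commute)
  from arg_cong[OF this, of "map_oper phi"] show ?thesis
    unfolding map_phi_left map_phi_right k map_phi_Tchain US.lift_on .
qed

text \<open>The q-traces and \<open>N\<close> are numerical, so \<open>\<phi>\<close> acts only on
  T_1 ... T_k. Through this equation every term is transformed.\<close>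

lemma map_phi_W:
  "map_oper phi (XS.qtrs a m (XS.lift N * XS.Tchain T (Suc k)))
    = US.qtrs a m (US.lift N * US.Lchain LL (Suc k))"
  unfolding map_phi_qtrs map_phi_left map_phi_Tchain ..

lemma map_phi_dd: "map_oper phi (XS.dd i * X) = US.dd i * map_oper phi X"
  unfolding XS.lift_on(3)[symmetric] US.lift_on(3)[symmetric] by (rule map_phi_left)

lemma map_phi_sc: "map_oper phi (XS.sc c * X) = US.sc c * map_oper phi X"
  unfolding XS.lift_scalar[symmetric] US.lift_scalar[symmetric] by (rule map_phi_left)

abbreviation Tt :: "'x^'n^'n" where "Tt \<equiv> map_matrix (emb scaleX) D ** T"

lemma rtt_Tt: "XS.rr 0 * (on1 0 Tt * on1 1 Tt) = on1 0 Tt * on1 1 Tt * XS.rr 0"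
proof -
  have TT: "on1 0 Tt * on1 1 Tt = XS.dd 0 * XS.dd 1 * (on1 0 T * on1 1 T)"
  proof -
    have "XS.dd 1 * on1 0 T = on1 0 T * XS.dd 1" by (rule XS.dd_commute) simp
    then have "XS.dd 0 * (XS.dd 1 * on1 0 T) * on1 1 T
      = XS.dd 0 * (on1 0 T * XS.dd 1) * on1 1 T" by simp
    then show ?thesis by (simp add: on1_mult XS.dd_def mult.assoc)
  qed
  have "XS.rr 0 * (XS.dd 0 * XS.dd 1) = XS.dd 0 * XS.dd 1 * XS.rr 0"
    using XS.rr_dd[of 0] by simp
  then show ?thesis unfolding TT using rtt
    by (metis (no_types) mult.assoc)
qed

lemma minus_one_power: "scalar ((-1) ^ m) = (XS.sc ((-1) ^ m) :: ('n, 'x) oper)"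
  "scalar ((-1) ^ m) = (US.sc ((-1) ^ m) :: ('n, 'u) oper)"
  by (simp_all add: XS.e_power US.e_power XS.e_uminus US.e_uminus)

lemma on1_T_wedge_eq: "k \<ge> 1 \<Longrightarrow> on1 0 (mat (emb scaleX (qnum q k)) ** T_wedge scaleX q R Tt k)
    = XS.dd 0 * (XS.sc (qnum q k) * XS.qtrs 1 (k - 1) (XS.antisym 0 k * XS.Tchain T k))"
  by (simp add: on1_mult on1_mat XS.on1_T_wedge_D XS.op.e_scale XS.op.scale_simps)

text \<open>The product of \<open>T_power\<close> and \<open>sigma_T\<close> is merged into one
  q-trace that is linear in T_1 ... T_k. Only in this form can \<open>\<phi>\<close> be
  applied.\<close>

lemma on1_T_term:
  assumes "j < k"
  shows "on1 0 (mat ((-1) ^ (k - j)) ** (T_power scaleX R Tt (k - j) ** mat (sigma_T scaleX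
    q R Tt j)))
    = XS.dd 0 * (XS.sc ((-1) ^ (k - j)) * (XS.sc (q ^ j) *
        XS.qtrs 1 (k - 1) (chain XS.rr 0 (k - j - 1) * XS.antisym (k - j) j * XS.Tchain T k)))"
proof -
  obtain u where u: "XS.qtrs 0 j (XS.antisym 0 j * XS.Tchain T j) = scalar u"
    using XS.sigma_T_exists by blast
  have "XS.qtrs 1 (k - 1) (chain XS.rr 0 (k - j - 1) * XS.antisym (k - j) j * XS.Tchain T k)
    = XS.qtrs 1 (k - j - 1) (chain XS.rr 0 (k - j - 1) * XS.Tchain T (k - j)) * scalar u"
    using XS.qtrs_split[OF u, of "k - j"] assms by simp
  then show ?thesis
    using assms by (simp add: on1_mult on1_mat XS.on1_T_power_D XS.scalar_sigma_T_D u
      minus_one_power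
        XS.op.e_scale XS.op.scale_simps mult.assoc)
qed

lemma on1_L_wedge_eq: "k \<ge> 1 \<Longrightarrow> on1 0 (mat (emb scaleU (qnum q k)) ** L_wedge scaleU q R D LL k)
    = US.sc (qnum q k) * US.qtrs 1 (k - 1) (US.antisym 0 k * US.Lchain LL k)"
  by (simp add: on1_mult on1_mat US.on1_L_wedge)

text \<open>The same q-trace with L in place of T, read backwards: its value is split into
  \<open>sigma_L\<close> on the left and a power of L, whose minus signs give the factor
  (-1)^(k-j).\<close>

lemma on1_L_term:
  assumes "j < k"
  shows "on1 0 (mat (sigma_L scaleU q R D LL j) ** mpow (- LL) (k - j))
    = US.sc ((-1) ^ (k - j)) * (US.sc (q ^ j) *
        US.qtrs 1 (k - 1) (chain US.rr 0 (k - j - 1) * US.antisym (k - j) j * US.Lchain LL k))"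
proof -
  obtain u where u: "US.qtrs 0 j (US.antisym 0 j * US.Lchain LL j) = scalar u"
    using US.sigma_L_exists by blast
  obtain b where k: "k = Suc (b + j)"
    using assms by (metis add.commute less_imp_Suc_add)
  have kj: "k - j = Suc b" "k - j - 1 = b" "k - 1 = b + j" by (simp_all add: k)
  have "US.qtrs 1 (b + j) (chain US.rr 0 b * US.antisym (Suc b) j * US.Lchain LL (Suc (b + j)))
    = scalar u * on1 0 LL ^ Suc b"
    by (rule US.qtrs_Lchain[OF Lchain_commute u])
  then have "US.qtrs 1 (k - 1) (chain US.rr 0 (k - j - 1) * US.antisym (k - j) j * US.Lchain LL k)
    = scalar u * on1 0 LL ^ (k - j)"
    unfolding kj unfolding k by (simp only: diff_Suc_1)
  moreover have "(- on1 0 LL) ^ (k - j) = US.sc ((-1) ^ (k - j)) * on1 0 LL ^ (k - j)"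
    unfolding power_minus[of "on1 0 LL"] minus_one_power(2)[symmetric]
    by (simp add: scalar_power scalar_uminus)
  ultimately show ?thesis
    by (simp add: on1_mult on1_mat on1_mpow on1_uminus US.scalar_sigma_L u
        US.op.e_scale US.op.scale_simps mult.assoc mult.commute)
qed

lemma map_phi_wedge:
  assumes "k \<ge> 1"
  shows "map_matrix phi (mat (emb scaleX (qnum q k)) ** T_wedge scaleX q R Tt k)
    = map_matrix (emb scaleU) D ** (mat (emb scaleU (qnum q k)) ** L_wedge scaleU q R D LL k)"
proof -
  obtain k' where k: "k = Suc k'" using assms by (cases k) auto
  have "on1 0 (map_matrix phi (mat (emb scaleX (qnum q k)) ** T_wedge scaleX q R Tt k))
    = map_oper phi (on1 0 (mat (emb scaleX (qnum q k)) ** T_wedge scaleX q R Tt k))"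
    by (simp add: map_oper_on1 zero)
  also have "\<dots> = US.dd 0 * (US.sc (qnum q k) * US.qtrs 1 (k - 1) (US.antisym 0 k * US.Lchain LL k))"
    unfolding on1_T_wedge_eq[OF assms] map_phi_dd map_phi_sc XS.antisym_eq_lift US.antisym_eq_lift
    unfolding k map_phi_W ..
  also have "\<dots> = on1 0 (map_matrix (emb scaleU) D ** (mat (emb scaleU (qnum q k)) ** L_wedge
    scaleU q R D LL k))"
    unfolding on1_mult[of _ "map_matrix (emb scaleU) D"] on1_L_wedge_eq[OF assms] US.dd_def ..
  finally show ?thesis by (simp only: on1_inject)
qed

lemma map_phi_term:
  assumes "j < k"
  shows "map_matrix phi (mat ((-1) ^ (k - j)) ** (T_power scaleX R Tt (k - j) ** mat (sigma_T
    scaleX q R Tt j)))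
    = map_matrix (emb scaleU) D ** (mat (sigma_L scaleU q R D LL j) ** mpow (- LL) (k - j))"
    (is "map_matrix phi ?X = _ ** ?Y")
proof -
  obtain k' where k: "k = Suc k'" using assms by (cases k) auto
  have "on1 0 (map_matrix phi ?X) = map_oper phi (on1 0 ?X)"
    by (simp add: map_oper_on1 zero)
  also have "\<dots> = US.dd 0 * (US.sc ((-1) ^ (k - j)) * (US.sc (q ^ j) *
        US.qtrs 1 (k - 1) (chain US.rr 0 (k - j - 1) * US.antisym (k - j) j * US.Lchain LL k)))"
    unfolding on1_T_term[OF assms] map_phi_dd map_phi_sc XS.antisym_eq_lift US.antisym_eq_lift
      XS.chain_rr_eq_lift US.chain_rr_eq_lift XS.lift_times[symmetric] US.lift_times[symmetric]
    unfolding k map_phi_W ..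
  also have "\<dots> = on1 0 (map_matrix (emb scaleU) D ** ?Y)"
    unfolding on1_mult[of _ "map_matrix (emb scaleU) D"] on1_L_term[OF assms] US.dd_def ..
  finally show ?thesis by (simp only: on1_inject)
qed

lemma chn_T:
  assumes "k \<ge> 1"
  shows "mat (emb scaleX (qnum q k)) ** T_wedge scaleX q R Tt k
    = - (\<Sum>j<k. mat ((-1) ^ (k - j)) ** (T_power scaleX R Tt (k - j) ** mat (sigma_T scaleX
      q R Tt j)))"
proof -
  have "XS.rr i * XS.Tchain T k = XS.Tchain T k * XS.rr i" if "Suc i < k" for i
    using rtt that by (rule XS.Tchain_commute)
  note chn = XS.chn[OF assms this]
  have "XS.dd 0 * (XS.sc (qnum q k) * XS.qtrs 1 (k - 1) (XS.antisym 0 k * XS.Tchain T k))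
    = - (\<Sum>j<k. XS.dd 0 * (XS.sc ((-1) ^ (k - j)) * (XS.sc (q ^ j) *
        XS.qtrs 1 (k - 1) (chain XS.rr 0 (k - j - 1) * XS.antisym (k - j) j * XS.Tchain T k))))"
    by (subst chn) (simp_all add: sum_distrib_left)
  then have "on1 0 (mat (emb scaleX (qnum q k)) ** T_wedge scaleX q R Tt k)
    = - (\<Sum>j<k. on1 0 (mat ((-1) ^ (k - j)) ** (T_power scaleX R Tt (k - j) ** mat (sigma_T
      scaleX q R Tt j))))"
    unfolding on1_T_wedge_eq[OF assms] by (simp add: on1_T_term)
  then show ?thesis by (simp only: on1_uminus[symmetric] on1_sum[symmetric] on1_inject)
qed

lemma chn_L:
  assumes "k \<ge> 1"
  shows "mat (emb scaleU (qnum q k)) ** L_wedge scaleU q R D LL k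
    = - (\<Sum>j<k. mat (sigma_L scaleU q R D LL j) ** mpow (- LL) (k - j))"
proof -
  note chn = US.chn[OF assms Lchain_commute]
  have "on1 0 (mat (emb scaleU (qnum q k)) ** L_wedge scaleU q R D LL k)
    = - (\<Sum>j<k. on1 0 (mat (sigma_L scaleU q R D LL j) ** mpow (- LL) (k - j)))"
    unfolding on1_L_wedge_eq[OF assms] by (subst chn) (simp_all add: on1_L_term)
  then show ?thesis by (simp only: on1_uminus[symmetric] on1_sum[symmetric] on1_inject)
qed

end

text \<open>By S + A = 1 the second matrix is q^(-1) S - q A, which inverts R on each of the two
  eigenspaces. The computation takes place in the ring of operators, where products of matrices are
  ring products.\<close>

lemma hecke_type_inverse:
  fixes R :: "'k::field^('n::finite \<times> 'n)^('n \<times> 'n)"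
  assumes q: "q \<noteq> 0" and R: "hecke_type q R"
  shows "R ** (R - mat (q - inverse q)) = mat 1" "(R - mat (q - inverse q)) ** R = mat 1"
proof -
  obtain S A where SA: "S ** S = S" "A ** A = A" "S ** A = 0" "A ** S = 0" "S + A = mat 1"
    and R: "R = mat q ** S - mat (inverse q) ** A"
    using R unfolding hecke_type_def by blast
  define c where "c x = (on2 0 (mat x) :: ('n, 'k) oper)" for x
  let ?s = "on2 0 S :: ('n, 'k) oper" and ?a = "on2 0 A :: ('n, 'k) oper"
  have c: "c x = scalar x" for x by (simp add: c_def on2_mat)
  have com: "X * c x = c x * X" for X x
    unfolding c by (rule oper_eqI) (simp add: mult.commute)
  have sa: "?s * ?s = ?s" "?a * ?a = ?a" "?s * ?a = 0" "?a * ?s = 0" "?s + ?a = 1"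
    using SA(1-5) on2_diff[of 0 0 0] by (simp_all flip: on2_mult on2_add add: on2_mat)
  have cc: "c x * c y = c (x * y)" "c (x - y) = c x - c y" for x y
    by (simp_all add: c scalar_mult scalar_diff)
  have r: "on2 0 R = c q * ?s - c (inverse q) * ?a"
    by (simp add: R on2_diff on2_mult c_def)
  have "on2 0 (R - mat (q - inverse q)) = on2 0 R - c (q - inverse q) * (?s + ?a)"
    by (simp add: on2_diff c_def sa(5))
  also have "\<dots> = c (inverse q) * ?s - c q * ?a"
    unfolding r cc(2) by (simp add: algebra_simps)
  finally have r': "on2 0 (R - mat (q - inverse q)) = c (inverse q) * ?s - c q * ?a" .
  have c1: "c 1 = 1" by (simp add: c)
  have "on2 0 R * on2 0 (R - mat (q - inverse q))
    = 1" "on2 0 (R - mat (q - inverse q)) * on2 0 R = 1"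
  proof -
    have *: "(c x * ?s - c y * ?a) * (c z * ?s - c w * ?a) = c (x * z) * ?s + c (y * w) * ?a"
      for x y z w
    proof -
      have "(c x * X) * (c z * Y) = c (x * z) * (X * Y)" for x z X Y
      proof -
        have "(c x * X) * (c z * Y) = c x * (X * c z) * Y" by (simp only: mult.assoc)
        then show ?thesis unfolding com[of X] by (simp add: cc(1)[symmetric] mult.assoc)
      qed
      then show ?thesis by (simp add: left_diff_distrib right_diff_distrib sa)
    qed
    show "on2 0 R * on2 0 (R - mat (q - inverse q))
      = 1" "on2 0 (R - mat (q - inverse q)) * on2 0 R = 1"
      unfolding r r' * using q sa(5) by (simp_all add: c1 distrib_left[symmetric])
  qed
  then show "R ** (R - mat (q - inverse q)) = mat 1" "(R - mat (q - inverse q)) ** R = mat 1"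
    unfolding on2_inject[of 0, symmetric, where ?'a = 'k] on2_mult on2_mat scalar_1 .
qed

lemma yang_baxter_oper:
  assumes "yang_baxter R"
  shows "on2 0 R * on2 1 R * on2 0 R = on2 1 R * on2 0 R * on2 1 R"
proof -
  have "first 3 (tprod 3 [at2 1 R, at2 2 R, at2 1 R])
    = first 3 (tprod 3 [at2 2 R, at2 1 R, at2 2 R])"
    using assms unfolding yang_baxter_def by simp
  then show ?thesis by (simp add: first_tprod first_at2 mult.assoc)
qed

text \<open>"Transforms" is meant term by term: the left-hand side and every summand for DT go to D
  times the corresponding term for L. As D is invertible, see \<open>D_invertible\<close>, these
  images determine the terms for L, and no information is lost.\<close>

theorem mainTheorem5:
  fixes q :: "'k::field"
    and R :: "'k^('n::finite \<times> 'n)^('n \<times> 'n)"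
    and D :: "'k^'n^'n"
    and scaleX :: "'k \<Rightarrow> 'x::ring_1 \<Rightarrow> 'x"
    and T Tt :: "'x^'n^'n"
    and scaleU :: "'k \<Rightarrow> 'u::ring_1 \<Rightarrow> 'u" and pair1 :: "'u \<Rightarrow> 'x list \<Rightarrow> 'k"
    and scaleU2 :: "'k \<Rightarrow> 'v::ring_1 \<Rightarrow> 'v" and pair2 :: "'v \<Rightarrow> 'x list \<Rightarrow> 'k"
    and scaleU3 :: "'k \<Rightarrow> 'w::ring_1 \<Rightarrow> 'w" and pair3 :: "'w \<Rightarrow> 'x list \<Rightarrow> 'k"
    and \<R> :: 'v
    and \<phi> :: "'x \<Rightarrow> 'u"
    and L :: "'u^'n^'n"
  assumes q_nonzero: "q \<noteq> 0"
    and q_not_root_of_unity: "\<And>m. m \<ge> 1 \<Longrightarrow> q ^ m \<noteq> 1"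
    and R_yang_baxter: "yang_baxter R"
    and R_hecke: "hecke_type q R"
    and D: "is_qtrace_matrix R D"
    and X_rtt: "rtt_algebra scaleX R T"
    and U_dual: "dual_power scaleX T 1 scaleU pair1"
    and U2_dual: "dual_power scaleX T 2 scaleU2 pair2"
    and U3_dual: "dual_power scaleX T 3 scaleU3 pair3"
    and universal: "universal_R_matrix pair1 pair2 pair3 \<R>"
    and image: "rep_image pair2 T \<R> = permutation_matrix ** R"
    and phi: "\<phi> = factorization_map pair1 pair2 \<R>"
    and Tt: "Tt = map_matrix (emb scaleX) D ** T"
    and L: "L = map_matrix \<phi> T"
  shows "rtt_relations scaleX R Tt \<and> rlrl_relations scaleU R L \<and>
    (\<forall>k\<ge>1.
       mat (emb scaleX (qnum q k)) ** T_wedge scaleX q R Tt k =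
         - (\<Sum>j<k. mat ((-1) ^ (k - j)) **
              (T_power scaleX R Tt (k - j) ** mat (sigma_T scaleX q R Tt j))) \<and>
       map_matrix \<phi> (mat (emb scaleX (qnum q k)) ** T_wedge scaleX q R Tt k) =
         map_matrix (emb scaleU) D ** (mat (emb scaleU (qnum q k)) ** L_wedge scaleU q R D L k) \<and>
       (\<forall>j<k.
          map_matrix \<phi> (mat ((-1) ^ (k - j)) **
              (T_power scaleX R Tt (k - j) ** mat (sigma_T scaleX q R Tt j))) =
            map_matrix (emb scaleU) D **
              (mat (sigma_L scaleU q R D L j) ** mpow (- L) (k - j))) \<and>
       mat (emb scaleU (qnum q k)) ** L_wedge scaleU q R D L k =
         - (\<Sum>j<k. mat (sigma_L scaleU q R D L j) ** mpow (- L) (k - j)))"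
proof -
  let ?R' = "R - mat (q - inverse q)"
  interpret X: rtt_algebra scaleX R T by fact
  interpret U: dual_power scaleX T 1 scaleU pair1 by fact
  interpret S: skew_invertible R ?R' D
    by unfold_locales
      (use hecke_type_inverse[OF q_nonzero R_hecke] yang_baxter_oper[OF R_yang_baxter]
        contract2_eq_1_iff[OF D] contract2_eq_0[OF D] in auto)
  interpret Q: generic_q q by unfold_locales (fact q_nonzero, fact q_not_root_of_unity)
  have "field_embedding (emb scaleX)" "field_embedding (emb scaleU)"
    by (rule field_embedding_emb[OF X.assoc_algebra_axioms], rule field_embedding_emb[OF U.U.assoc_algebra_axioms])
  then interpret chn_setting R ?R' D q scaleX T scaleU pair1 scaleU2 pair2 scaleU3 pair3 \<R>
    by (intro chn_setting.intro factorization.intro list_setting.intro tensor_setting.intro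
        factorization_axioms.intro tensor_setting_axioms.intro
        X_rtt U_dual U2_dual U3_dual universal image S.skew_invertible_axioms Q.generic_q_axioms
        X.assoc_algebra_axioms U.U.assoc_algebra_axioms refl)
  have L': "L = LL" unfolding LL_def L phi ..
  show ?thesis
    unfolding L' Tt phi XS.rtt_relations_oper
    using rtt_Tt US.rlrl_relations_oper[OF US.rlrl[OF Lchain_commute]]
      chn_T map_phi_wedge map_phi_term chn_L
    by blast
qed

end
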